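(* Let $0<r<1$. Then the unique minimizer of $E_r$ in $\mathcal{M}_0$ is the constant map $\mathbf{n}\equiv\mathbf{e}_3$, and the minimizers of $E_r$ in $\mathcal{M}_{-1}$ are exactly the translates of $\mathbf{h}^r$, i.e. the maps $\mathbf{n}(x)=\mathbf{h}^r(x-x_0)$ with $x_0\in\mathbb{R}^2$. Moreover, for every $k\in\mathbb{Z}\setminus\{0,-1\}$, $E_r$ admits no minimizer in $\mathcal{M}_k$.
   Context: Maps $\mathbf{n}=(n_1,n_2,n_3):\mathbb{R}^2\to\mathbb{S}^2\subset\mathbb{R}^3$ (with weak derivatives in $L^2_{loc}$); $\mathbf{e}_1,\mathbf{e}_2,\mathbf{e}_3$ is the canonical basis of $\mathbb{R}^3$. Define $D[\mathbf{n}]=\frac12\int_{\mathbb{R}^2}|\nabla\mathbf{n}|^2dx$, $H[\mathbf{n}]=\int_{\mathbb{R}^2}(\mathbf{n}-\mathbf{e}_3)\cdot(\nabla\times\mathbf{n})dx$ where $\nabla\times\mathbf{n}=(\partial_2 n_3,-\partial_1 n_3,\partial_1 n_2-\partial_2 n_1)$, $V[\mathbf{n}]=\frac18\int_{\mathbb{R}^2}|\mathbf{n}-\mathbf{e}_3|^4dx=\frac12\int_{\mathbb{R}^2}(1-n_3)^2dx$, and $E_r=D+rH+V$ for $r>0$. The energy space is $\mathcal{M}=\{\mathbf{n}:\mathbb{R}^2\to\mathbb{S}^2\mid D[\mathbf{n}]+V[\mathbf{n}]<\infty\}$. The degree is $Q[\mathbf{n}]=\frac1{4\pi}\int_{\mathbb{R}^2}\mathbf{n}\cdot(\partial_1\mathbf{n}\times\partial_2\mathbf{n})dx\in\mathbb{Z}$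 and $\mathcal{M}_k=\{\mathbf{n}\in\mathcal{M}\mid Q[\mathbf{n}]=k\}$. The skyrmion is $\mathbf{h}^r(x)=\mathbf{h}(x/(2r))$ with $\mathbf{h}(x_1,x_2)=\left(\frac{-2x_2}{|x|^2+1},\frac{2x_1}{|x|^2+1},\frac{|x|^2-1}{|x|^2+1}\right)$; it satisfies $\mathbf{h}^r\in\mathcal{M}_{-1}$. A minimizer of $E_r$ in $\mathcal{M}_k$ means $\mathbf{n}\in\mathcal{M}_k$ with $E_r[\mathbf{n}]=\inf_{\mathcal{M}_k}E_r$. *)

theory Defs
  imports "HOL-Analysis.Analysis"
begin

coinductive smooth2 :: "(real^2 \<Rightarrow> real) \<Rightarrow> bool" where
  "(\<forall>x. f differentiable (at x)) \<Longrightarrow>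
   (\<forall>i. smooth2 (\<lambda>x. frechet_derivative f (at x) (axis i 1))) \<Longrightarrow> smooth2 f"

definition pd :: "(real^2 \<Rightarrow> real) \<Rightarrow> 2 \<Rightarrow> real^2 \<Rightarrow> real" where
  "pd f i x = frechet_derivative f (at x) (axis i 1)"

definition test_fun :: "(real^2 \<Rightarrow> real) \<Rightarrow> bool" where
  "test_fun \<phi> \<longleftrightarrow> smooth2 \<phi> \<and> compact (closure {x. \<phi> x \<noteq> 0})"

definition is_weak_grad :: "(real^2 \<Rightarrow> real^3) \<Rightarrow> (2 \<Rightarrow> real^2 \<Rightarrow> real^3) \<Rightarrow> bool" where
  "is_weak_grad n g \<longleftrightarrow>
     n \<in> borel_measurable lebesgue \<and>
     (\<forall>i. g i \<in> borel_measurable lebesgue) \<and>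
     (\<forall>i K. compact K \<longrightarrow> set_integrable lebesgue K (\<lambda>x. (norm (g i x))\<^sup>2)) \<and>
     (\<forall>\<phi> i j. test_fun \<phi> \<longrightarrow>
        (LINT x|lebesgue. n x $ j * pd \<phi> i x) = - (LINT x|lebesgue. g i x $ j * \<phi> x))"

definition grad :: "(real^2 \<Rightarrow> real^3) \<Rightarrow> 2 \<Rightarrow> real^2 \<Rightarrow> real^3" where
  "grad n = (SOME g. is_weak_grad n g)"

definition e3 :: "real^3" where "e3 = axis 3 1"

definition curl :: "(real^2 \<Rightarrow> real^3) \<Rightarrow> real^2 \<Rightarrow> real^3" where
  "curl n x = vector [grad n 2 x $ 3, - (grad n 1 x $ 3), grad n 1 x $ 2 - grad n 2 x $ 1]"

definition gradsq :: "(real^2 \<Rightarrow> real^3) \<Rightarrow> real^2 \<Rightarrow> real" where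
  "gradsq n x = (norm (grad n 1 x))\<^sup>2 + (norm (grad n 2 x))\<^sup>2"

definition Dir :: "(real^2 \<Rightarrow> real^3) \<Rightarrow> real" where
  "Dir n = (1/2) * (LINT x|lebesgue. gradsq n x)"

definition Hel :: "(real^2 \<Rightarrow> real^3) \<Rightarrow> real" where
  "Hel n = (LINT x|lebesgue. (n x - e3) \<bullet> curl n x)"

definition Vpot :: "(real^2 \<Rightarrow> real^3) \<Rightarrow> real" where
  "Vpot n = (1/2) * (LINT x|lebesgue. (1 - n x $ 3)\<^sup>2)"

definition Energy :: "real \<Rightarrow> (real^2 \<Rightarrow> real^3) \<Rightarrow> real" where
  "Energy r n = Dir n + r * Hel n + Vpot n"

definition Mspace :: "(real^2 \<Rightarrow> real^3) set" where
  "Mspace = {n. (\<forall>x. norm (n x) = 1) \<and> (\<exists>g. is_weak_grad n g) \<and>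
                integrable lebesgue (gradsq n) \<and>
                integrable lebesgue (\<lambda>x. (1 - n x $ 3)\<^sup>2)}"

definition degree :: "(real^2 \<Rightarrow> real^3) \<Rightarrow> real" where
  "degree n = 1 / (4 * pi) * (LINT x|lebesgue. n x \<bullet> cross3 (grad n 1 x) (grad n 2 x))"

definition Mdeg :: "int \<Rightarrow> (real^2 \<Rightarrow> real^3) set" where
  "Mdeg k = {n \<in> Mspace. degree n = of_int k}"

definition hsk :: "real^2 \<Rightarrow> real^3" where
  "hsk x = vector [-2 * x $ 2 / ((norm x)\<^sup>2 + 1), 2 * x $ 1 / ((norm x)\<^sup>2 + 1),
                   ((norm x)\<^sup>2 - 1) / ((norm x)\<^sup>2 + 1)]"

definition hsk_r :: "real \<Rightarrow> real^2 \<Rightarrow> real^3" where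
  "hsk_r r x = hsk ((1 / (2 * r)) *\<^sub>R x)"

definition is_minimizer :: "real \<Rightarrow> int \<Rightarrow> (real^2 \<Rightarrow> real^3) \<Rightarrow> bool" where
  "is_minimizer r k n \<longleftrightarrow> n \<in> Mdeg k \<and> Energy r n = (INF m\<in>Mdeg k. Energy r m)"

end

theory Submission
  imports Defs
begin

text \<open>
  Let \<open>a\<close>, \<open>b\<close> be the weak partial derivatives of \<open>n\<close>. Since \<open>n\<close> has unit length, both are orthogonal to \<open>n\<close>
  almost everywhere, and completing squares gives for \<open>\<sigma> = 1\<close> and \<open>\<sigma> = -1\<close> the pointwise identity that the
  energy density equals
  \<open>(1 - r^2)/2 |a + \<sigma> n \<times> b|^2 + 1/2 |r (a + n \<times> b) - G(n)|^2 + (\<sigma> (1 - r^2) + r^2) n . (a \<times> b)\<close>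
  with \<open>G(n) = (- n1 n2, 1 - n3 - n2^2, n2 (1 - n3))\<close>. Hence \<open>E \<ge> 4 \<pi> (\<sigma> (1 - r^2) + r^2) Q\<close> for both signs.
  Equality for \<open>\<sigma> = 1\<close> forces \<open>G(n) = 0\<close>, that is \<open>n = e3\<close>. Equality for \<open>\<sigma> = -1\<close> forces \<open>a = G(n) / (2 r)\<close> and
  \<open>b = - n \<times> a\<close>; then \<open>n\<close> is continuously differentiable and, unless it is \<open>e3\<close>, its stereographic coordinates are
  affine, so that \<open>n\<close> is a translate of the skyrmion. In every nonzero degree the bound with the sign of the degree is
  approached by disjoint copies of bubbles that equal \<open>e3\<close> outside a ball: truncated skyrmions for degree \<open>-1\<close>,
  shrinking conformal bubbles for degree \<open>1\<close>. A minimizer of degree other than \<open>0\<close> and \<open>-1\<close> would therefore attain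
  equality, which contradicts its degree.
\<close>

section \<open>Test functions\<close>

text \<open>The density splits into \<open>1 - r^2\<close> times the Dirichlet density and the
  density of \<open>r^2 D + r H + V\<close>. The second part is a square plus \<open>r^2\<close>
  times the degree density, with a fixed sign; the Dirichlet part can be completed to a square with
  either sign. This freedom of \<open>\<sigma>\<close> is what serves positive and negative degrees
  alike. The obstacle is regularity. Membership in \<open>Mspace\<close> provides only a weak
  gradient, and \<open>grad\<close> picks one by choice. Before any algebra can start, weak
  gradients must be unique almost everywhere and differentiating \<open>|n|^2 = 1\<close> must be
  legitimate; both rest on mollification. In the equality case the gradient is a continuous function
  of \<open>n\<close>, hence bounded, so \<open>n\<close> is Lipschitz and then continuously
  differentiable; only then is there a differential equation to solve. The skyrmion reaches
  \<open>e3\<close> only at infinity, so copies of it cannot simply be placed side by side.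
  Truncating its stereographic coordinate keeps the degree exactly and costs an energy that tends to
  zero as the radius grows.\<close>

definition expinv :: "nat \<Rightarrow> real \<Rightarrow> real" where
  "expinv k t = (if t > 0 then (1/t)^k * exp (-(1/t)) else 0)"

text \<open>With \<open>y = 1/t\<close>, a single term of the exponential series gives
  \<open>exp y \<ge> y^(k+2) / fact (k+2)\<close>. The exponent \<open>k+2\<close> is chosen so that
  \<open>t^2\<close> remains: quadratic flatness at \<open>0\<close> is what differentiability there
  requires.\<close>

lemma expinv_bound: "\<bar>expinv k t\<bar> \<le> fact (k+2) * t\<^sup>2"
proof (cases "t > 0")
  case True
  define y where "y = 1/t"
  have y: "y > 0" using True by (simp add: y_def)
  define F :: real where "F = fact (k+2)"
  have "(\<Sum>n\<in>{k+2}. y^n /\<^sub>R fact n) \<le> (\<Sum>n. y^n /\<^sub>R fact n)"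
    using y by (intro sum_le_suminf summable_exp_generic) auto
  then have "y^(k+2) / F \<le> exp y"
    by (simp add: exp_def F_def divide_inverse mult.commute)
  moreover have "F > 0" by (simp add: F_def)
  ultimately have "y^k * exp (-y) \<le> F * (1/y)\<^sup>2"
    using y by (simp add: exp_minus power_add field_simps power2_eq_square)
  then show ?thesis using True by (simp add: expinv_def y_def F_def)
next
  case False then show ?thesis by (simp add: expinv_def)
qed

lemma expinv_nonneg: "0 \<le> expinv k t"
  by (simp add: expinv_def)

lemma has_derivative_vec_nth [derivative_intros]:
  "((\<lambda>x. x $ i) has_derivative (\<lambda>v. v $ i)) F"
  by (intro bounded_linear_imp_has_derivative bounded_linear_vec_nth)

text \<open>The power \<open>k\<close> is carried so that the family
  \<open>t^(-k) exp (-1/t)\<close> is closed under differentiation up to linear combinations. At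
  \<open>t = 0\<close> the difference quotient is at most a multiple of \<open>|h|\<close> by
  \<open>expinv_bound\<close>.\<close>

lemma DERIV_expinv:
  "(expinv k has_real_derivative (expinv (k+2) t - real k * expinv (k+1) t)) (at t)"
proof -
  consider "t > 0" | "t < 0" | "t = 0" by linarith
  then show ?thesis
  proof cases
    case 1
    have "((\<lambda>t. (1/t)^k * exp (-(1/t))) has_real_derivative
            (expinv (k+2) t - real k * expinv (k+1) t)) (at t)"
    proof (cases k)
      case 0 then show ?thesis using 1
        by (auto intro!: derivative_eq_intros simp: expinv_def field_simps power2_eq_square)
    next
      case (Suc m)
      have "((\<lambda>t. (1/t)^Suc m) has_real_derivative - real (Suc m) * (1/t)^Suc (Suc m)) (at t)"
      proof -
        have "((\<lambda>t. 1/t) has_real_derivative - ((1/t)^2)) (at t)"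
          using 1 by (auto intro!: derivative_eq_intros simp: field_simps power2_eq_square)
        from DERIV_power[OF this, of "Suc m"] show ?thesis
        proof (rule DERIV_cong)
          show "real (Suc m) * (- ((1/t)^2) * (1/t)^(Suc m - Suc 0)) = - real (Suc m) * (1/t)^Suc (Suc m)"
            by (simp only: power_Suc power2_eq_square diff_Suc_Suc minus_nat.diff_0 mult_ac mult_minus_left mult_minus_right)
        qed
      qed
      moreover have "((\<lambda>t. exp (-(1/t))) has_real_derivative (1/t)^2 * exp (-(1/t))) (at t)"
        using 1 by (auto intro!: derivative_eq_intros simp: field_simps power2_eq_square)
      ultimately have "((\<lambda>t. (1/t)^Suc m * exp (-(1/t))) has_real_derivative
          - real (Suc m) * (1/t)^Suc (Suc m) * exp (-(1/t)) + (1/t)^2 * exp (-(1/t)) * (1/t)^Suc m) (at t)"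
        by (rule DERIV_mult)
      then show ?thesis unfolding Suc
      proof (rule DERIV_cong)
        define y where "y = 1/t"
        show "- real (Suc m) * (1/t)^Suc (Suc m) * exp (-(1/t)) + (1/t)^2 * exp (-(1/t)) * (1/t)^Suc m
          = expinv (Suc m + 2) t - real (Suc m) * expinv (Suc m + 1) t"
          using 1 unfolding expinv_def y_def[symmetric] by (simp add: power2_eq_square algebra_simps)
      qed
    qed
    moreover have "\<forall>\<^sub>F s in nhds t. expinv k s = (1/s)^k * exp (-(1/s))"
      using eventually_nhds_in_open[of "{0<..}" t] 1
      by (auto simp: expinv_def elim!: eventually_mono)
    ultimately show ?thesis
      by (subst DERIV_cong_ev) auto
  next
    case 2
    have "((\<lambda>t. 0) has_real_derivative (expinv (k+2) t - real k * expinv (k+1) t)) (at t)"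
      using 2 by (simp add: expinv_def)
    moreover have "\<forall>\<^sub>F s in nhds t. expinv k s = 0"
      using eventually_nhds_in_open[of "{..<0}" t] 2
      by (auto simp: expinv_def elim!: eventually_mono)
    ultimately show ?thesis
      by (subst DERIV_cong_ev) auto
  next
    case 3
    define F :: real where "F = fact (k+2)"
    have F: "\<bar>expinv k h\<bar> \<le> F * \<bar>h\<bar> * \<bar>h\<bar>" for h
      using expinv_bound[of k h] by (simp only: F_def power2_eq_square mult.assoc abs_mult_self_eq)
    have "((\<lambda>h. (expinv k (0+h) - expinv k 0)/h) \<longlongrightarrow> 0) (at 0)"
    proof (rule Lim_null_comparison)
      show "\<forall>\<^sub>F h in at 0. norm ((expinv k (0+h) - expinv k 0)/h) \<le> F * \<bar>h\<bar>"
      proof (rule eventually_at_topological[THEN iffD2], intro exI[of _ UNIV] conjI ballI impI)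
        fix h :: real assume "h \<noteq> 0"
        then show "norm ((expinv k (0+h) - expinv k 0)/h) \<le> F * \<bar>h\<bar>"
          using F[of h] by (simp add: expinv_def[of k 0] pos_divide_le_eq)
      qed auto
      show "((\<lambda>h. F * \<bar>h\<bar>) \<longlongrightarrow> (0::real)) (at 0)"
        by (auto intro!: tendsto_eq_intros)
    qed
    then show ?thesis using 3 by (simp add: DERIV_def expinv_def)
  qed
qed

text \<open>A class of functions closed under partial derivatives, which makes it a post-fixed point for
  the coinductive predicate \<^const>\<open>smooth2\<close>.\<close>

inductive bumpalg :: "(real^2 \<Rightarrow> real) \<Rightarrow> bool" where
  const: "bumpalg (\<lambda>_. c)"
| atom: "bumpalg (\<lambda>x. expinv k (a * x$i + b))"
| add: "bumpalg f \<Longrightarrow> bumpalg g \<Longrightarrow> bumpalg (\<lambda>x. f x + g x)"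
| mult: "bumpalg f \<Longrightarrow> bumpalg g \<Longrightarrow> bumpalg (\<lambda>x. f x * g x)"

lemma bumpalg_has_derivative:
  assumes "bumpalg f"
  shows "\<exists>f'. (\<forall>x. (f has_derivative f' x) (at x)) \<and> (\<forall>v. bumpalg (\<lambda>x. f' x v))"
  using assms
proof induction
  case (const c)
  show ?case by (rule exI[of _ "\<lambda>x v. 0"]) (auto intro: bumpalg.const)
next
  case (atom k a i b)
  have "((\<lambda>x::real^2. expinv k (a * x$i + b)) has_derivative
      (\<lambda>v. (expinv (k+2) (a * x$i + b) + (- real k) * expinv (k+1) (a * x$i + b)) * (a * v$i))) (at x)" for x
  proof -
    have "((\<lambda>x::real^2. a * x$i + b) has_derivative (\<lambda>v. a * v$i)) (at x)"
      by (auto intro!: derivative_eq_intros)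
    from has_derivative_compose[OF this DERIV_expinv[unfolded has_field_derivative_def]]
    show ?thesis by simp
  qed
  moreover have "bumpalg (\<lambda>x. (expinv (k+2) (a * x$i + b) + (- real k) * expinv (k+1) (a * x$i + b)) * (a * v$i))" for v
    by (intro bumpalg.intros)
  ultimately show ?case
    by (intro exI[of _ "\<lambda>x v. (expinv (k+2) (a * x$i + b) + (- real k) * expinv (k+1) (a * x$i + b)) * (a * v$i)"]) auto
next
  case (add f g)
  then obtain f' g' where
    "\<And>x. (f has_derivative f' x) (at x)" "\<And>v. bumpalg (\<lambda>x. f' x v)"
    "\<And>x. (g has_derivative g' x) (at x)" "\<And>v. bumpalg (\<lambda>x. g' x v)" by blast
  then show ?case
    by (intro exI[of _ "\<lambda>x v. f' x v + g' x v"]) (auto intro: bumpalg.add has_derivative_add)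
next
  case (mult f g)
  then obtain f' g' where
    "\<And>x. (f has_derivative f' x) (at x)" "\<And>v. bumpalg (\<lambda>x. f' x v)"
    "\<And>x. (g has_derivative g' x) (at x)" "\<And>v. bumpalg (\<lambda>x. g' x v)" by blast
  with mult show ?case
    by (intro exI[of _ "\<lambda>x v. f x * g' x v + f' x v * g x"])
      (auto intro!: bumpalg.add bumpalg.mult has_derivative_mult)
qed

lemma bumpalg_smooth2: "bumpalg f \<Longrightarrow> smooth2 f"
proof (coinduction arbitrary: f)
  case smooth2
  then obtain f' where f': "\<And>x. (f has_derivative f' x) (at x)" "\<And>v. bumpalg (\<lambda>x. f' x v)"
    using bumpalg_has_derivative by blast
  then have "frechet_derivative f (at x) = f' x" for x
    using frechet_derivative_at by metis
  with f' show ?case by (auto simp: differentiable_def)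
qed

lemma smooth2_has_derivative:
  assumes "smooth2 f"
  shows "(f has_derivative (\<lambda>v. v$1 * pd f 1 x + v$2 * pd f 2 x)) (at x)"
proof -
  from assms have "f differentiable (at x)" by (auto elim: smooth2.cases)
  then have d: "(f has_derivative frechet_derivative f (at x)) (at x)"
    by (simp add: frechet_derivative_works)
  then interpret linear "frechet_derivative f (at x)" by (rule has_derivative_linear)
  have "frechet_derivative f (at x) v = v$1 * pd f 1 x + v$2 * pd f 2 x" for v
  proof -
    have "v = v$1 *\<^sub>R axis 1 1 + v$2 *\<^sub>R axis 2 1"
      by (simp add: vec_eq_iff forall_2 axis_def)
    then have "frechet_derivative f (at x) v
       = frechet_derivative f (at x) (v$1 *\<^sub>R axis 1 1 + v$2 *\<^sub>R axis 2 1)" by simp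
    then show ?thesis by (simp add: add scale pd_def)
  qed
  then have "frechet_derivative f (at x) = (\<lambda>v. v$1 * pd f 1 x + v$2 * pd f 2 x)" by auto
  with d show ?thesis by simp
qed

lemma pd_eqI:
  assumes "(f has_derivative f') (at x)"
  shows "pd f i x = f' (axis i 1)"
  using frechet_derivative_at[OF assms, symmetric] by (simp add: pd_def)

lemma smooth2_pd: "smooth2 f \<Longrightarrow> smooth2 (pd f i)"
  by (auto elim!: smooth2.cases simp: pd_def[abs_def])

lemma smooth2_continuous: "smooth2 f \<Longrightarrow> continuous_on A f"
  by (auto intro!: continuous_at_imp_continuous_on differentiable_imp_continuous_within elim: smooth2.cases)

lemma test_fun_support:
  assumes "test_fun \<phi>"
  obtains R where "R > 0" "\<And>x. R < norm x \<Longrightarrow> \<phi> x = 0" "\<And>i x. R < norm x \<Longrightarrow> pd \<phi> i x = 0"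
proof -
  have "bounded {x. \<phi> x \<noteq> 0}"
    using assms bounded_subset[OF compact_imp_bounded closure_subset] by (auto simp: test_fun_def)
  then obtain R where R: "R > 0" "\<And>x. \<phi> x \<noteq> 0 \<Longrightarrow> norm x \<le> R"
    by (auto simp: bounded_pos)
  have "pd \<phi> i x = 0" if "R < norm x" for i x
  proof -
    have "((\<lambda>x. 0) has_derivative (\<lambda>x. 0)) (at x)" by simp
    moreover have "open {x::real^2. R < norm x}"
      by (intro open_Collect_less continuous_intros)
    ultimately have "(\<phi> has_derivative (\<lambda>x. 0)) (at x)"
      by (rule has_derivative_transform_within_open) (use that R in force)+
    then show ?thesis by (simp add: pd_eqI)
  qed
  with R show ?thesis by (intro that) force+
qed

section \<open>Compactly supported and locally integrable functions on the plane\<close>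

lemma continuous_compact_support_bounded:
  fixes f :: "real^2 \<Rightarrow> 'a::real_normed_vector"
  assumes "continuous_on UNIV f" "\<And>x. R < norm x \<Longrightarrow> f x = 0"
  obtains B where "B > 0" "\<And>x. norm (f x) \<le> B"
proof -
  have "bounded (f ` cball 0 R)"
    by (intro compact_imp_bounded compact_continuous_image continuous_on_subset[OF assms(1)]) auto
  then obtain B where "B > 0" "\<And>x. x \<in> cball 0 R \<Longrightarrow> norm (f x) \<le> B"
    by (auto simp: bounded_pos)
  moreover from this assms(2) have "norm (f x) \<le> B" for x
    by (cases "R < norm x") (auto simp: not_less)
  ultimately show ?thesis using that by blast
qed

lemma lborel_integral_translate:
  fixes f :: "'a::euclidean_space \<Rightarrow> 'b::{banach, second_countable_topology}"
  assumes "f \<in> borel_measurable borel"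
  shows "(LINT x|lborel. f (x + c)) = (LINT x|lborel. f x)"
proof -
  have "(LINT x|lborel. f x) = (LINT x|distr lborel borel ((+) c). f x)"
    by (simp add: lborel_distr_plus)
  also have "\<dots> = (LINT x|lborel. f (c + x))"
    using assms by (intro integral_distr) auto
  finally show ?thesis by (simp add: add.commute)
qed

lemma lborel_integrable_translate:
  fixes f :: "'a::euclidean_space \<Rightarrow> 'b::{banach, second_countable_topology}"
  assumes "integrable lborel f"
  shows "integrable lborel (\<lambda>x. f (x + c))"
proof -
  have "integrable (distr lborel borel ((+) c)) f" using assms by (simp add: lborel_distr_plus)
  then have "integrable lborel (\<lambda>x. f (c + x))"
    using assms by (subst (asm) integrable_distr_eq) auto
  then show ?thesis by (simp add: add.commute)
qed

lemma integrable_indicator_cball: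
  "integrable lborel (\<lambda>x. indicator (cball (c::'a::euclidean_space) R) x * (B::real))"
  by (intro integrable_mult_left integrable_real_indicator emeasure_lborel_cball_finite) simp

text \<open>Borel rather than Lebesgue measurability is demanded so that products, translates and
  double integrals stay measurable automatically; centred balls suffice to exhaust the compact
  sets.\<close>

definition locint :: "(real^2 \<Rightarrow> real) \<Rightarrow> bool" where
  "locint f \<longleftrightarrow> f \<in> borel_measurable borel \<and> (\<forall>R. integrable lborel (\<lambda>x. indicator (cball 0 R) x * f x))"

lemma locint_borel [measurable_dest]: "locint f \<Longrightarrow> f \<in> borel_measurable borel"
  by (simp add: locint_def)

lemma locint_mult:
  assumes f: "locint f" and [measurable]: "\<phi> \<in> borel_measurable borel"
    and "\<And>x. \<bar>\<phi> x\<bar> \<le> B" "\<And>x. R < norm x \<Longrightarrow> \<phi> x = 0"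
  shows "integrable lborel (\<lambda>x. \<phi> x * f x)"
proof (rule Bochner_Integration.integrable_bound)
  note [measurable] = locint_borel[OF f]
  show "integrable lborel (\<lambda>x. B * (indicator (cball 0 R) x * f x))"
    using f by (simp add: locint_def)
  show "(\<lambda>x. \<phi> x * f x) \<in> borel_measurable lborel" by measurable
  show "AE x in lborel. norm (\<phi> x * f x) \<le> norm (B * (indicator (cball 0 R) x * f x))"
  proof (rule AE_I2)
    fix x
    have "B \<ge> 0" using assms(3)[of x] by linarith
    then show "norm (\<phi> x * f x) \<le> norm (B * (indicator (cball 0 R) x * f x))"
      using assms(3)[of x] assms(4)[of x]
      by (cases "R < norm x") (auto simp: abs_mult intro!: mult_right_mono)
  qed
qed

lemma locint_bounded:
  assumes [measurable]: "f \<in> borel_measurable borel" and "\<And>x. \<bar>f x\<bar> \<le> B"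
  shows "locint f"
  unfolding locint_def
proof (intro conjI allI)
  fix R
  show "integrable lborel (\<lambda>x. indicator (cball 0 R) x * f x)"
  proof (rule Bochner_Integration.integrable_bound)
    show "integrable lborel (\<lambda>x. indicator (cball (0::real^2) R) x * B)"
      by (rule integrable_indicator_cball)
    show "AE x in lborel. norm (indicator (cball 0 R) x * f x) \<le> norm (indicator (cball 0 R) x * B)"
      using assms(2) by (intro AE_I2) (auto simp: indicator_def intro: order_trans[OF _ abs_ge_self])
      show "(\<lambda>x. indicator (cball 0 R) x * f x) \<in> borel_measurable lborel"
      using assms(1) by (intro borel_measurable_times borel_measurable_indicator) auto
  qed
qed (fact assms(1))

lemma locint_continuous:
  assumes "continuous_on UNIV f"
  shows "locint f"
  unfolding locint_def
proof (intro conjI allI)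
  show "f \<in> borel_measurable borel" using assms by (rule borel_measurable_continuous_onI)
  show "integrable lborel (\<lambda>x. indicator (cball 0 R) x * f x)" for R
    using borel_integrable_compact[OF compact_cball continuous_on_subset[OF assms], of 0 R] by simp
qed

lemma integrable_continuous_compact_support:
  fixes f :: "real^2 \<Rightarrow> real"
  assumes "continuous_on UNIV f" "\<And>x. R < norm x \<Longrightarrow> f x = 0"
  shows "integrable lborel f"
proof -
  have "integrable lborel (\<lambda>x. indicator (cball 0 R) x * f x)"
    using locint_continuous[OF assms(1)] by (simp add: locint_def)
  moreover have "(\<lambda>x. indicator (cball 0 R) x * f x) = f"
    using assms(2) by (force simp: indicator_def fun_eq_iff not_le)
  ultimately show ?thesis by simp
qed

text \<open>Each difference quotient along \<open>e\<close> has integral zero by translation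
  invariance; they are bounded by \<open>B\<close>, live in the ball of radius
  \<open>R + norm e\<close> because the steps are at most 1, and converge pointwise to
  \<open>f'\<close>. Applied to a product with a test function this is integration by parts, without
  iterated integrals.\<close>

lemma integral_directional_derivative_eq_0:
  fixes f :: "real^2 \<Rightarrow> real"
  assumes der: "\<And>x. ((\<lambda>t. f (x + t *\<^sub>R e)) has_real_derivative f' x) (at 0)"
    and [measurable]: "f \<in> borel_measurable borel"
    and bnd: "\<And>x. \<bar>f' x\<bar> \<le> B" and int: "integrable lborel f"
    and supp: "\<And>x. R < norm x \<Longrightarrow> f x = 0"
  shows "(LINT x|lborel. f' x) = 0"
proof -
  define s :: "nat \<Rightarrow> real" where "s k = 1 / Suc k" for k
  have s: "s k > 0" "s k \<le> 1" "s \<longlonglongrightarrow> 0" for k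
    using LIMSEQ_inverse_real_of_nat by (auto simp: s_def[abs_def] inverse_eq_divide)
  define q where "q k x = (f (x + s k *\<^sub>R e) - f x) / s k" for k x
  have der': "((\<lambda>t. f (x + t *\<^sub>R e)) has_real_derivative f' (x + t *\<^sub>R e)) (at t)" for x t
    using der[of "x + t *\<^sub>R e"] DERIV_shift[of "\<lambda>t. f (x + t *\<^sub>R e)" "f' (x + t *\<^sub>R e)" 0 t]
    by (simp add: algebra_simps)
  have B: "B \<ge> 0" using bnd[of 0] by linarith
  have qb: "\<bar>q k x\<bar> \<le> B" for k x
  proof -
    obtain z where "f (x + s k *\<^sub>R e) - f (x + 0 *\<^sub>R e) = (s k - 0) * f' (x + z *\<^sub>R e)"
      using MVT2[of 0 "s k" "\<lambda>t. f (x + t *\<^sub>R e)" "\<lambda>t. f' (x + t *\<^sub>R e)"] s(1)[of k] der' by blast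
    then show ?thesis using s(1)[of k] bnd by (simp add: q_def)
  qed
  have qlim: "(\<lambda>k. q k x) \<longlonglongrightarrow> f' x" for x
  proof -
    have "((\<lambda>h. (f (x + h *\<^sub>R e) - f x) / h) \<longlongrightarrow> f' x) (at 0)"
      using der[of x] by (simp add: DERIV_def)
    moreover have "filterlim s (at 0) sequentially"
      using s by (auto simp: filterlim_at intro!: always_eventually) (metis less_irrefl)
    ultimately show ?thesis unfolding q_def by (rule filterlim_compose)
  qed
  have qsupp: "q k x = 0" if "R + norm e < norm x" for k x
  proof -
    have "norm x \<le> norm (x + s k *\<^sub>R e) + norm (s k *\<^sub>R e)"
      using norm_triangle_ineq4[of "x + s k *\<^sub>R e" "s k *\<^sub>R e"] by simp
    moreover have "norm (s k *\<^sub>R e) \<le> norm e"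
      using s(1,2)[of k] by (simp add: mult_left_le_one_le)
    ultimately have "R < norm (x + s k *\<^sub>R e)" "R < norm x"
      using that norm_ge_zero[of e] by linarith+
    then show ?thesis using supp by (simp add: q_def)
  qed
  have qm [measurable]: "q k \<in> borel_measurable borel" for k
    unfolding q_def by measurable
  have [measurable]: "f' \<in> borel_measurable borel"
    by (rule borel_measurable_LIMSEQ_real[OF qlim]) (use qm in auto)
  have "(\<lambda>k. LINT x|lborel. q k x) \<longlonglongrightarrow> (LINT x|lborel. f' x)"
  proof (rule integral_dominated_convergence[where w = "\<lambda>x. indicator (cball 0 (R + norm e)) x * B"])
    show "integrable lborel (\<lambda>x. indicator (cball (0::real^2) (R + norm e)) x * B)"
      by (rule integrable_indicator_cball)
    show "AE x in lborel. norm (q k x) \<le> indicator (cball 0 (R + norm e)) x * B" for k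
      using qb qsupp by (intro AE_I2) (auto simp: indicator_def not_le)
  qed (use qlim in auto)
  moreover have "(LINT x|lborel. q k x) = 0" for k
    using lborel_integral_translate[of f "s k *\<^sub>R e"] int lborel_integrable_translate[OF int, of "s k *\<^sub>R e"]
    by (simp add: q_def)
  ultimately have "(\<lambda>k. 0) \<longlonglongrightarrow> (LINT x|lborel. f' x)" by simp
  then show ?thesis by (simp add: LIMSEQ_const_iff)
qed

section \<open>Mollification\<close>

text \<open>The support of \<open>bump d\<close> is the square of half-width \<open>d\<close>, which is why radii \<open>2 * d\<close> occur below.\<close>

definition bump :: "real \<Rightarrow> real^2 \<Rightarrow> real" where
  "bump d x = expinv 0 (d - x$1) * expinv 0 (d + x$1) * (expinv 0 (d - x$2) * expinv 0 (d + x$2))"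

definition mollifier :: "real \<Rightarrow> real^2 \<Rightarrow> real" where
  "mollifier d x = bump d x / (LINT y|lborel. bump d y)"

lemma bumpalg_bump: "bumpalg (\<lambda>y. bump d (x - y))"
proof -
  have "(\<lambda>y. bump d (x - y)) = (\<lambda>y. expinv 0 (1 * y$1 + (d - x$1)) * expinv 0 ((-1) * y$1 + (d + x$1))
     * (expinv 0 (1 * y$2 + (d - x$2)) * expinv 0 ((-1) * y$2 + (d + x$2))))"
    by (auto simp: bump_def fun_eq_iff algebra_simps)
  then show ?thesis by (simp only:) (intro bumpalg.intros)
qed

lemma bump_minus: "bump d (- x) = bump d x"
  by (simp add: bump_def)

lemma bump_nonneg: "0 \<le> bump d x"
  by (simp add: bump_def expinv_nonneg)

lemma bump_eq_0: 
  assumes "2 * d < norm x" shows "bump d x = 0"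
proof (rule ccontr)
  assume "bump d x \<noteq> 0"
  then have "\<bar>x$1\<bar> \<le> d" "\<bar>x$2\<bar> \<le> d" by (auto simp: bump_def expinv_def split: if_splits)
  then show False using norm_le_l1_cart[of x] assms by (simp add: sum_2)
qed

lemma continuous_on_bump: "continuous_on UNIV (bump d)"
  using smooth2_continuous[OF bumpalg_smooth2[OF bumpalg_bump[of d 0]]] bump_minus by simp

text \<open>A zero integral would make the continuous nonnegative bump vanish almost everywhere,
  hence on a closed set of full measure, hence at the origin, where it is positive.\<close>

lemma integral_bump_pos:
  assumes "d > 0" shows "(LINT y|lborel. bump d y) > 0"
proof -
  have int: "integrable lborel (bump d)"
    using integrable_continuous_compact_support[OF continuous_on_bump, of "2*d"] bump_eq_0 by blast
  have "(LINT y|lborel. bump d y) \<noteq> 0"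
  proof
    assume "(LINT y|lborel. bump d y) = 0"
    then have "AE y in lborel. bump d y = 0"
      using integral_nonneg_eq_0_iff_AE[OF int] bump_nonneg by simp
    then have "AE y in lebesgue. y \<in> {y. bump d y = 0}"
      by (auto dest: AE_completion)
    moreover have "closed {y. bump d y = 0}"
      by (intro closed_Collect_eq continuous_on_bump continuous_intros)
    ultimately have "bump d 0 = 0"
      using mem_closed_if_AE_lebesgue by blast
    then show False using assms by (simp add: bump_def expinv_def)
  qed
  moreover have "(LINT y|lborel. bump d y) \<ge> 0"
    by (intro integral_nonneg_AE) (simp add: bump_nonneg)
  ultimately show ?thesis by simp
qed

lemma mollifier_minus: "mollifier d (- x) = mollifier d x"
  by (simp add: mollifier_def bump_minus)

lemma mollifier_minus_commute: "mollifier d (x - y) = mollifier d (y - x)"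
  using mollifier_minus[of d "x - y"] by simp

lemma mollifier_nonneg: "0 \<le> mollifier d x"
  unfolding mollifier_def by (intro divide_nonneg_nonneg integral_nonneg_AE) (auto simp: bump_nonneg)

lemma mollifier_eq_0: "2 * d < norm x \<Longrightarrow> mollifier d x = 0"
  by (simp add: mollifier_def bump_eq_0)

lemma test_fun_mollifier: "test_fun (\<lambda>y. mollifier d (x - y))"
  unfolding test_fun_def
proof
  have "bumpalg (\<lambda>y. (1 / (LINT y|lborel. bump d y)) * bump d (x - y))"
    by (intro bumpalg.mult bumpalg.const bumpalg_bump)
  then show "smooth2 (\<lambda>y. mollifier d (x - y))"
    by (intro bumpalg_smooth2) (simp add: mollifier_def)
  have "{y. mollifier d (x - y) \<noteq> 0} \<subseteq> cball x (2 * d)"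
    using mollifier_eq_0 by (force simp: dist_norm not_le)
  then show "compact (closure {y. mollifier d (x - y) \<noteq> 0})"
    by (meson bounded_cball bounded_subset compact_closure)
qed

lemma test_fun_mollifier0: "test_fun (mollifier d)"
  using test_fun_mollifier[of d 0] by (simp add: mollifier_minus)

lemma continuous_on_mollifier: "continuous_on UNIV (mollifier d)"
  using test_fun_mollifier0 by (auto simp: test_fun_def smooth2_continuous)

lemma borel_measurable_mollifier [measurable]: "mollifier d \<in> borel_measurable borel"
  by (intro borel_measurable_continuous_onI continuous_on_mollifier)

lemma integrable_mollifier: "integrable lborel (mollifier d)"
  using integrable_continuous_compact_support[OF continuous_on_mollifier, of "2*d"] mollifier_eq_0 by blast

lemma integral_mollifier:
  assumes "d > 0" shows "(LINT y|lborel. mollifier d y) = 1"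
  using integral_bump_pos[OF assms] by (simp add: mollifier_def)

lemma integral_mollifier_translate:
  assumes "d > 0"
  shows "(LINT y|lborel. mollifier d (x - y)) = 1"
  using lborel_integral_translate[of "mollifier d" "-x"] integral_mollifier[OF assms]
  by (simp add: mollifier_minus_commute[of d x])

lemma integrable_mollifier_translate: "integrable lborel (\<lambda>y. mollifier d (x - y))"
  using lborel_integrable_translate[OF integrable_mollifier, of d "-x"]
  by (simp add: mollifier_minus_commute[of d x])

lemma nn_integral_mollifier_translate:
  assumes "d > 0"
  shows "(\<integral>\<^sup>+x. ennreal (mollifier d (x - y)) \<partial>lborel) = 1"
  using integral_mollifier_translate[OF assms, of y] nn_integral_eq_integral[OF integrable_mollifier_translate, of d y]
  by (simp add: mollifier_nonneg mollifier_minus_commute[of d y])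

definition moll :: "real \<Rightarrow> (real^2 \<Rightarrow> real) \<Rightarrow> real^2 \<Rightarrow> real" where
  "moll d u x = (LINT y|lborel. mollifier d (x - y) * u y)"

lemma mollifier_bounded: obtains B where "B > 0" "\<And>x. \<bar>mollifier d x\<bar> \<le> B"
  using continuous_compact_support_bounded[OF continuous_on_mollifier, of "2*d" d] mollifier_eq_0[of d]
  by (metis real_norm_def)

lemma mollifier_translate_eq_0: 
  assumes "norm x + 2 * d < norm y" shows "mollifier d (x - y) = 0"
  using norm_triangle_ineq2[of y x] assms by (intro mollifier_eq_0) (simp add: norm_minus_commute)

lemma integrable_moll:
  assumes "locint u"
  shows "integrable lborel (\<lambda>y. mollifier d (x - y) * u y)"
proof -
  obtain B where "\<And>x. \<bar>mollifier d x\<bar> \<le> B" using mollifier_bounded[of d] by blast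
  then show ?thesis
    using mollifier_translate_eq_0
    by (intro locint_mult[OF assms, of _ B "norm x + 2 * d"]) auto
qed

lemma borel_measurable_moll [measurable]:
  assumes [measurable]: "u \<in> borel_measurable borel"
  shows "moll d u \<in> borel_measurable borel"
  unfolding moll_def[abs_def] by measurable

text \<open>A mollification is an average with total weight 1 over the points within distance
  \<open>2 * d\<close>. The oscillation is only assumed small almost everywhere, so that continuous
  representatives can be used later.\<close>

lemma moll_near:
  assumes u: "locint u" and d: "d > 0"
    and near: "AE y in lborel. norm (x - y) \<le> 2 * d \<longrightarrow> \<bar>u y - c\<bar> \<le> \<eta>"
  shows "\<bar>moll d u x - c\<bar> \<le> \<eta>"
proof -
  have i: "integrable lborel (\<lambda>y. mollifier d (x - y) * (u y - c))"
    using integrable_moll[OF u, of d x] integrable_mollifier_translate[of d x]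
    by (auto simp: right_diff_distrib)
  have "moll d u x - c = (LINT y|lborel. mollifier d (x - y) * u y) - (LINT y|lborel. mollifier d (x - y) * c)"
    using integral_mollifier_translate[OF d, of x] by (simp add: moll_def)
  also have "\<dots> = (LINT y|lborel. mollifier d (x - y) * (u y - c))"
    using integrable_moll[OF u, of d x] integrable_mollifier_translate[of d x]
    by (simp add: right_diff_distrib)
  also have "\<bar>\<dots>\<bar> \<le> (LINT y|lborel. \<bar>mollifier d (x - y) * (u y - c)\<bar>)"
    by (rule integral_abs_bound)
  also have "\<dots> \<le> (LINT y|lborel. mollifier d (x - y) * \<eta>)"
  proof (rule integral_mono_AE)
    show "AE y in lborel. \<bar>mollifier d (x - y) * (u y - c)\<bar> \<le> mollifier d (x - y) * \<eta>"
      using near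
    proof eventually_elim
      case (elim y)
      then show ?case
        using mollifier_eq_0[of d "x - y"] mollifier_nonneg[of d "x - y"]
        by (cases "norm (x - y) \<le> 2 * d") (auto simp: abs_mult intro!: mult_left_mono)
    qed
  qed (use i integrable_mollifier_translate[of d x] in auto)
  also have "\<dots> = \<eta>"
    using integral_mollifier_translate[OF d, of x] by simp
  finally show ?thesis .
qed

lemma moll_bounded:
  assumes "locint u" "d > 0" "AE y in lborel. \<bar>u y\<bar> \<le> B"
  shows "\<bar>moll d u x\<bar> \<le> B"
proof -
  have "AE y in lborel. norm (x - y) \<le> 2 * d \<longrightarrow> \<bar>u y - 0\<bar> \<le> B"
    using assms(3) by (auto elim: eventually_mono)
  from moll_near[OF assms(1,2) this] show ?thesis by simp
qed

lemma moll_cong: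
  assumes "AE y in lborel. norm (x - y) \<le> 2 * d \<longrightarrow> u y = v y"
    "u \<in> borel_measurable borel" "v \<in> borel_measurable borel"
  shows "moll d u x = moll d v x"
  unfolding moll_def
proof (rule integral_cong_AE)
  show "AE y in lborel. mollifier d (x - y) * u y = mollifier d (x - y) * v y"
    using assms(1)
  proof eventually_elim
    case (elim y)
    then show ?case using mollifier_eq_0[of d "x - y"]
      by (cases "norm (x - y) \<le> 2 * d") auto
  qed
qed (use assms(2,3) in auto)

definition wderiv :: "2 \<Rightarrow> (real^2 \<Rightarrow> real) \<Rightarrow> (real^2 \<Rightarrow> real) \<Rightarrow> bool" where
  "wderiv i u g \<longleftrightarrow> locint u \<and> locint g \<and>
    (\<forall>\<phi>. test_fun \<phi> \<longrightarrow> (LINT x|lborel. u x * pd \<phi> i x) = - (LINT x|lborel. g x * \<phi> x))"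

lemma pd_mollifier_translate: "pd (\<lambda>y. mollifier d (x - y)) i y = - pd (mollifier d) i (x - y)"
proof -
  have "((\<lambda>y. x - y) has_derivative uminus) (at y)" by (auto intro!: derivative_eq_intros)
  from has_derivative_compose[OF this smooth2_has_derivative[of "mollifier d"]]
  have "((\<lambda>y. mollifier d (x - y)) has_derivative (\<lambda>v. (- v)$1 * pd (mollifier d) 1 (x - y) + (- v)$2 * pd (mollifier d) 2 (x - y))) (at y)"
    using test_fun_mollifier0 by (auto simp: test_fun_def)
  from pd_eqI[OF this, of i] show ?thesis
    using exhaust_2[of i] by (auto simp: axis_def)
qed

text \<open>The kernel \<open>y \<mapsto> mollifier d (x - y)\<close> is itself a test function; the
  sign from the chain rule cancels the sign in the weak derivative.\<close>

lemma moll_wderiv: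
  assumes "wderiv i u g"
  shows "moll d g x = (LINT y|lborel. pd (mollifier d) i (x - y) * u y)"
proof -
  have "(LINT y|lborel. u y * pd (\<lambda>y. mollifier d (x - y)) i y) = - (LINT y|lborel. g y * mollifier d (x - y))"
    using assms test_fun_mollifier by (auto simp: wderiv_def)
  then show ?thesis by (simp add: pd_mollifier_translate moll_def mult.commute)
qed

lemma test_fun_derivative_bound:
  assumes "test_fun \<phi>"
  obtains B where "B > 0" "\<And>i x. \<bar>pd \<phi> i x\<bar> \<le> B" "\<And>x. \<bar>\<phi> x\<bar> \<le> B" "\<And>x y. \<bar>\<phi> x - \<phi> y\<bar> \<le> B * norm (x - y)"
proof -
  have sm: "smooth2 \<phi>" using assms by (simp add: test_fun_def)
  obtain R where R: "\<And>x. R < norm x \<Longrightarrow> \<phi> x = 0" "\<And>i x. R < norm x \<Longrightarrow> pd \<phi> i x = 0"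
    using test_fun_support[OF assms] by metis
  obtain B0 where B0: "B0 > 0" "\<And>x. \<bar>\<phi> x\<bar> \<le> B0"
    using continuous_compact_support_bounded[OF smooth2_continuous[OF sm] R(1)] by (metis real_norm_def)
  have "\<exists>B>0. \<forall>x. \<bar>pd \<phi> i x\<bar> \<le> B" for i
    using continuous_compact_support_bounded[OF smooth2_continuous[OF smooth2_pd[OF sm, of i]] R(2)]
    by (metis real_norm_def)
  then obtain B where B: "\<And>i. B i > 0" "\<And>i x. \<bar>pd \<phi> i x\<bar> \<le> B i" by metis
  define C where "C = B 1 + B 2 + B0"
  have C: "C > 0" using B(1)[of 1] B(1)[of 2] B0(1) by (simp add: C_def)
  have pdC: "\<bar>pd \<phi> i x\<bar> \<le> C" for i x
    using exhaust_2[of i] B(2)[of i x] B(1)[of 1] B(1)[of 2] B0(1) by (auto simp: C_def)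
  have lip: "\<bar>\<phi> x - \<phi> y\<bar> \<le> C * norm (x - y)" for x y
  proof -
    have "norm (\<phi> x - \<phi> y) \<le> C * norm (x - y)"
    proof (rule differentiable_bound[of UNIV \<phi>])
      fix z :: "real^2"
      show "(\<phi> has_derivative (\<lambda>v. v$1 * pd \<phi> 1 z + v$2 * pd \<phi> 2 z)) (at z within UNIV)"
        using smooth2_has_derivative[OF sm] by simp
      show "onorm (\<lambda>v::real^2. v$1 * pd \<phi> 1 z + v$2 * pd \<phi> 2 z) \<le> C"
      proof (rule onorm_le)
        fix v :: "real^2"
        have "norm (v$1 * pd \<phi> 1 z + v$2 * pd \<phi> 2 z) \<le> \<bar>v$1\<bar> * B 1 + \<bar>v$2\<bar> * B 2"
          using B(2)[of 1 z] B(2)[of 2 z]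
          by (auto simp: abs_mult intro!: order_trans[OF abs_triangle_ineq] add_mono mult_left_mono)
        also have "\<dots> \<le> norm v * B 1 + norm v * B 2"
          using B(1) by (intro add_mono mult_right_mono component_le_norm_cart) (auto simp: less_imp_le)
        also have "\<dots> \<le> C * norm v" using B0(1) by (simp add: C_def algebra_simps)
        finally show "norm (v$1 * pd \<phi> 1 z + v$2 * pd \<phi> 2 z) \<le> C * norm v" by simp
      qed
    qed auto
    then show ?thesis by simp
  qed
  have "\<bar>\<phi> x\<bar> \<le> C" for x using B0(2)[of x] B(1)[of 1] B(1)[of 2] by (simp add: C_def)
  with C pdC lip show ?thesis using that by blast
qed

text \<open>Difference quotients of the kernel are bounded by its Lipschitz constant and vanish
  outside one ball, so differentiation passes under the integral; \<open>moll_wderiv\<close> then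
  moves the derivative from the kernel to the function. Derivatives along lines are enough for the
  mean value theorem.\<close>

lemma moll_has_real_derivative:
  assumes u1: "wderiv 1 u g1" and u2: "wderiv 2 u g2"
  shows "((\<lambda>t. moll d u (x + t *\<^sub>R v)) has_real_derivative
     (v$1 * moll d g1 (x + t *\<^sub>R v) + v$2 * moll d g2 (x + t *\<^sub>R v))) (at t)"
proof -
  have u: "locint u" using u1 by (simp add: wderiv_def)
  note [measurable] = locint_borel[OF u]
  have sm: "smooth2 (mollifier d)" using test_fun_mollifier0 by (simp add: test_fun_def)
  obtain B where B: "B > 0" "\<And>x y. \<bar>mollifier d x - mollifier d y\<bar> \<le> B * norm (x - y)"
    "\<And>i x. \<bar>pd (mollifier d) i x\<bar> \<le> B"
    using test_fun_derivative_bound[OF test_fun_mollifier0] by metis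
  obtain R0 where R0: "\<And>i x. R0 < norm x \<Longrightarrow> pd (mollifier d) i x = 0"
    using test_fun_support[OF test_fun_mollifier0] by metis
  have [measurable]: "pd (mollifier d) i \<in> borel_measurable borel" for i
    by (intro borel_measurable_continuous_onI smooth2_continuous smooth2_pd sm)
  have pdi: "integrable lborel (\<lambda>y. pd (mollifier d) i (z - y) * u y)" for i z
  proof (rule locint_mult[OF u, of _ B "norm z + R0"])
    show "norm z + R0 < norm y \<Longrightarrow> pd (mollifier d) i (z - y) = 0" for y
      using norm_triangle_ineq2[of y z] by (intro R0) (simp add: norm_minus_commute)
  qed (use B in auto)
  define D where "D y = v$1 * pd (mollifier d) 1 (x + t *\<^sub>R v - y) + v$2 * pd (mollifier d) 2 (x + t *\<^sub>R v - y)" for y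
  have "((\<lambda>s. (moll d u (x + s *\<^sub>R v) - moll d u (x + t *\<^sub>R v)) / (s - t)) \<longlongrightarrow> (LINT y|lborel. D y * u y)) (at t)"
    unfolding tendsto_at_iff_sequentially
  proof (intro allI impI)
    fix X :: "nat \<Rightarrow> real" assume X: "\<forall>i. X i \<in> UNIV - {t}" "X \<longlonglongrightarrow> t"
    obtain b where b: "\<And>i. \<bar>X i\<bar> \<le> b"
      using convergent_imp_Bseq[of X] X(2) by (auto simp: convergent_def Bseq_def)
    define q where "q k y = (mollifier d (x + X k *\<^sub>R v - y) - mollifier d (x + t *\<^sub>R v - y)) / (X k - t)" for k y
    have qb: "\<bar>q k y\<bar> \<le> B * norm v" for k y
    proof -
      have "\<bar>mollifier d (x + X k *\<^sub>R v - y) - mollifier d (x + t *\<^sub>R v - y)\<bar> \<le> B * norm ((X k - t) *\<^sub>R v)"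
        using B(2)[of "x + X k *\<^sub>R v - y" "x + t *\<^sub>R v - y"] by (simp add: algebra_simps)
      then show ?thesis using X(1) by (simp add: q_def divide_le_eq mult_ac)
    qed
    \<comment> \<open>A radius that works for the limit point and for all points of the sequence at
      once, since \<open>\<bar>X i\<bar> \<le> b\<close>.\<close>
    define R where "R = norm x + b * norm v + \<bar>t\<bar> * norm v + 2 * d"
    have b0: "b \<ge> 0" using b[of 0] by linarith
    have far: "mollifier d (x + s *\<^sub>R v - y) = 0" if "R < norm y" "\<bar>s\<bar> \<le> b + \<bar>t\<bar>" for s y
    proof (rule mollifier_translate_eq_0)
      have "norm (x + s *\<^sub>R v) \<le> norm x + \<bar>s\<bar> * norm v" using norm_triangle_ineq[of x "s *\<^sub>R v"] by simp
      also have "\<dots> \<le> norm x + (b + \<bar>t\<bar>) * norm v" using that(2) by (simp add: mult_right_mono)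
      finally show "norm (x + s *\<^sub>R v) + 2 * d < norm y" using that(1) by (simp add: R_def algebra_simps)
    qed
    have q0: "q k y = 0" if "R < norm y" for k y
      using far[OF that, of "X k"] far[OF that, of t] b[of k] b0 by (simp add: q_def)
    have [measurable]: "q k \<in> borel_measurable borel" for k unfolding q_def by measurable
    have qi: "integrable lborel (\<lambda>y. q k y * u y)" for k
      by (rule locint_mult[OF u, of _ "B * norm v" R]) (use qb q0 in auto)
    have "(\<lambda>k. LINT y|lborel. q k y * u y) \<longlonglongrightarrow> (LINT y|lborel. D y * u y)"
    proof (rule integral_dominated_convergence[where w = "\<lambda>y. B * norm v * \<bar>indicator (cball 0 R) y * u y\<bar>"])
      show "(\<lambda>y. D y * u y) \<in> borel_measurable lborel" unfolding D_def by measurable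
      show "integrable lborel (\<lambda>y. B * norm v * \<bar>indicator (cball 0 R) y * u y\<bar>)"
        using u by (auto simp: locint_def)
      show "AE y in lborel. norm (q k y * u y) \<le> B * norm v * \<bar>indicator (cball 0 R) y * u y\<bar>" for k
        using qb q0 by (intro AE_I2) (auto simp: indicator_def abs_mult not_le intro!: mult_right_mono)
      show "AE y in lborel. (\<lambda>k. q k y * u y) \<longlonglongrightarrow> D y * u y"
      proof (rule AE_I2)
        fix y
        have "((\<lambda>s. x + s *\<^sub>R v - y) has_derivative (\<lambda>h. h *\<^sub>R v)) (at t)"
          by (auto intro!: derivative_eq_intros)
        from has_derivative_compose[OF this smooth2_has_derivative[OF sm]]
        have "((\<lambda>s. mollifier d (x + s *\<^sub>R v - y)) has_real_derivative D y) (at t)"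
          unfolding has_field_derivative_def
          by (rule has_derivative_eq_rhs) (simp add: D_def algebra_simps fun_eq_iff)
        then have "((\<lambda>s. (mollifier d (x + s *\<^sub>R v - y) - mollifier d (x + t *\<^sub>R v - y)) / (s - t)) \<longlongrightarrow> D y) (at t)"
          by (simp add: has_field_derivative_iff)
        then have "(\<lambda>k. q k y) \<longlonglongrightarrow> D y"
          using X by (auto simp: tendsto_at_iff_sequentially q_def o_def)
        then show "(\<lambda>k. q k y * u y) \<longlonglongrightarrow> D y * u y" by (intro tendsto_intros)
      qed
    qed auto
    moreover have "(LINT y|lborel. q k y * u y) = (moll d u (x + X k *\<^sub>R v) - moll d u (x + t *\<^sub>R v)) / (X k - t)" for k
      using integrable_moll[OF u, of d]
      by (simp add: q_def moll_def left_diff_distrib diff_divide_distrib)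
    ultimately show "((\<lambda>s. (moll d u (x + s *\<^sub>R v) - moll d u (x + t *\<^sub>R v)) / (s - t)) \<circ> X) \<longlonglongrightarrow> (LINT y|lborel. D y * u y)"
      by (simp add: o_def)
  qed
  moreover have "(LINT y|lborel. D y * u y) = v$1 * moll d g1 (x + t *\<^sub>R v) + v$2 * moll d g2 (x + t *\<^sub>R v)"
    unfolding moll_wderiv[OF u1] moll_wderiv[OF u2] D_def
    using pdi by (simp add: distrib_right mult.assoc)
  ultimately show ?thesis by (simp add: has_field_derivative_iff)
qed

section \<open>Density of continuous functions and L1 convergence of mollifications\<close>

lemma pred_cball [measurable]: "Measurable.pred borel (\<lambda>x. x \<in> cball c R)"
  by (simp add: pred_def del: mem_cball)

text \<open>A Lebesgue measurable function is an almost everywhere limit of continuous ones.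
  Clipping these to \<open>[-B, B]\<close> and multiplying by a cutoff that falls from 1 to 0
  between the radii \<open>R\<close> and \<open>R + 1\<close> keeps the limit and makes dominated
  convergence applicable.\<close>

lemma integrable_approx_continuous_bounded:
  fixes f :: "real^2 \<Rightarrow> real"
  assumes [measurable]: "f \<in> borel_measurable borel" and b: "\<And>x. \<bar>f x\<bar> \<le> B"
    and supp: "\<And>x. R < norm x \<Longrightarrow> f x = 0" and "\<epsilon> > 0"
  obtains c S where "continuous_on UNIV c" "\<And>x. S < norm x \<Longrightarrow> c x = 0"
    "(LINT x|lborel. \<bar>f x - c x\<bar>) < \<epsilon>"
proof -
  have "f \<in> borel_measurable lebesgue" by (simp add: measurable_completion)
  then have "f measurable_on UNIV"
    using lebesgue_measurable_imp_measurable_on[of f UNIV] by simp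
  then obtain N g where N: "negligible N" and g: "\<And>n. continuous_on UNIV (g n)"
    and lim: "\<And>x. x \<notin> N \<Longrightarrow> (\<lambda>n. g n x) \<longlonglongrightarrow> f x"
    unfolding measurable_on_def by auto
  have [measurable]: "g n \<in> borel_measurable borel" for n
    by (intro borel_measurable_continuous_onI g)
  have B: "B \<ge> 0" using b[of 0] by linarith
  define cut where "cut x = max 0 (min 1 (R + 1 - norm x))" for x :: "real^2"
  define c where "c n x = cut x * max (- B) (min B (g n x))" for n x
  have cc: "continuous_on UNIV (c n)" for n
    unfolding c_def cut_def by (intro continuous_intros g)
  have cs: "c n x = 0" if "R + 1 < norm x" for n x
    using that by (simp add: c_def cut_def)
  have cb: "\<bar>c n x\<bar> \<le> B" for n x
  proof -
    have "\<bar>cut x\<bar> \<le> 1" "\<bar>max (- B) (min B (g n x))\<bar> \<le> B" using B by (auto simp: cut_def)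
    from mult_mono[OF this] show ?thesis by (simp add: c_def abs_mult)
  qed
  have clim: "(\<lambda>n. c n x) \<longlonglongrightarrow> f x" if "x \<notin> N" for x
  proof -
    have "(\<lambda>n. c n x) \<longlonglongrightarrow> cut x * max (- B) (min B (f x))"
      unfolding c_def by (intro tendsto_intros lim that)
    moreover have "cut x * max (- B) (min B (f x)) = f x"
      using b[of x] supp[of x] by (cases "R < norm x") (auto simp: cut_def)
    ultimately show ?thesis by simp
  qed
  have [measurable]: "c n \<in> borel_measurable borel" for n
    by (intro borel_measurable_continuous_onI cc)
  have "(\<lambda>n. LINT x|lborel. \<bar>f x - c n x\<bar>) \<longlonglongrightarrow> (LINT x|(lborel::(real^2) measure). (0::real))"
  proof (rule integral_dominated_convergence[where w = "\<lambda>x. indicator (cball 0 (R + 1)) x * (2 * B)"])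
    show "integrable lborel (\<lambda>x. indicator (cball (0::real^2) (R + 1)) x * (2 * B))"
      by (rule integrable_indicator_cball)
    show "AE x in lborel. (\<lambda>n. \<bar>f x - c n x\<bar>) \<longlonglongrightarrow> 0"
    proof -
      have "AE x in lborel. x \<notin> N"
        using AE_not_in[of N lebesgue] N AE_completion_iff[of "\<lambda>x. x \<notin> N" lborel]
        by (simp add: negligible_iff_null_sets)
      then show ?thesis
      proof eventually_elim
        case (elim x)
        have "(\<lambda>n. \<bar>f x - c n x\<bar>) \<longlonglongrightarrow> \<bar>f x - f x\<bar>" by (intro tendsto_intros clim elim)
        then show ?case by simp
      qed
    qed
    show "AE x in lborel. norm \<bar>f x - c n x\<bar> \<le> indicator (cball 0 (R + 1)) x * (2 * B)" for n
    proof (rule AE_I2)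
      fix x show "norm \<bar>f x - c n x\<bar> \<le> indicator (cball 0 (R + 1)) x * (2 * B)"
        using b[of x] cb[of n x] cs[of x n] supp[of x]
        by (cases "R + 1 < norm x") (auto simp: indicator_def)
    qed
  qed auto
  then have "\<forall>\<^sub>F n in sequentially. (LINT x|lborel. \<bar>f x - c n x\<bar>) < \<epsilon>"
    using \<open>\<epsilon> > 0\<close> by (auto dest: order_tendstoD)
  then obtain n where "(LINT x|lborel. \<bar>f x - c n x\<bar>) < \<epsilon>"
    by (auto simp: eventually_sequentially)
  with cc cs show ?thesis using that by blast
qed

text \<open>Reduced to the bounded case by truncating values and support at the same level
  \<open>n\<close>; the truncations converge to \<open>f\<close> in L1 since they agree with it from
  some \<open>n\<close> on at each point.\<close>

lemma integrable_approx_continuous: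
  fixes f :: "real^2 \<Rightarrow> real"
  assumes f: "integrable lborel f" and "\<epsilon> > 0"
  obtains c S where "continuous_on UNIV c" "\<And>x. S < norm x \<Longrightarrow> c x = 0"
    "(LINT x|lborel. \<bar>f x - c x\<bar>) < \<epsilon>"
proof -
  have [measurable]: "f \<in> borel_measurable borel" using f by simp
  define h where "h n x = indicator (cball 0 (real n)) x * max (- real n) (min (real n) (f x))" for n :: nat and x
  have [measurable]: "h n \<in> borel_measurable borel" for n unfolding h_def by measurable
  have hb: "\<bar>h n x\<bar> \<le> \<bar>f x\<bar>" for n x by (auto simp: h_def indicator_def)
  have hn: "\<bar>h n x\<bar> \<le> real n" for n x by (auto simp: h_def indicator_def)
  have "(\<lambda>n. LINT x|lborel. \<bar>f x - h n x\<bar>) \<longlonglongrightarrow> (LINT x|(lborel::(real^2) measure). (0::real))"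
  proof (rule integral_dominated_convergence[where w = "\<lambda>x. 2 * \<bar>f x\<bar>"])
    show "AE x in lborel. (\<lambda>n. \<bar>f x - h n x\<bar>) \<longlonglongrightarrow> 0"
    proof (rule AE_I2, rule tendsto_eventually)
      fix x
      show "\<forall>\<^sub>F n in sequentially. \<bar>f x - h n x\<bar> = 0"
        using eventually_ge_at_top[of "nat \<lceil>max (norm x) \<bar>f x\<bar>\<rceil>"]
      proof eventually_elim
        case (elim n)
        then have "norm x \<le> real n" "\<bar>f x\<bar> \<le> real n" by linarith+
        then show ?case by (auto simp: h_def)
      qed
    qed
    show "AE x in lborel. norm \<bar>f x - h n x\<bar> \<le> 2 * \<bar>f x\<bar>" for n
      using hb[of n] by (intro AE_I2) (smt (verit) real_norm_def)
  qed (use f in auto)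
  then have "\<forall>\<^sub>F n in sequentially. (LINT x|lborel. \<bar>f x - h n x\<bar>) < \<epsilon> / 2"
    using \<open>\<epsilon> > 0\<close> by (intro order_tendstoD(2)[where y = 0]) auto
  then obtain n where n: "(LINT x|lborel. \<bar>f x - h n x\<bar>) < \<epsilon> / 2"
    by (auto simp: eventually_sequentially)
  obtain c S where c: "continuous_on UNIV c" "\<And>x. S < norm x \<Longrightarrow> c x = 0"
    "(LINT x|lborel. \<bar>h n x - c x\<bar>) < \<epsilon> / 2"
  proof (rule integrable_approx_continuous_bounded[of "h n" "real n" "real n" "\<epsilon> / 2"])
    show "h n x = 0" if "real n < norm x" for x using that by (simp add: h_def)
  qed (use hn \<open>\<epsilon> > 0\<close> in auto)
  have hi: "integrable lborel (h n)"
    using f by (rule Bochner_Integration.integrable_bound) (use hb in auto)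
  have ci: "integrable lborel c" by (rule integrable_continuous_compact_support[OF c(1,2)])
  have "(LINT x|lborel. \<bar>f x - c x\<bar>) \<le> (LINT x|lborel. \<bar>f x - h n x\<bar> + \<bar>h n x - c x\<bar>)"
    using f hi ci by (intro integral_mono) auto
  also have "\<dots> = (LINT x|lborel. \<bar>f x - h n x\<bar>) + (LINT x|lborel. \<bar>h n x - c x\<bar>)"
    using f hi ci by (intro Bochner_Integration.integral_add) auto
  also have "\<dots> < \<epsilon>" using n c(3) by linarith
  finally show ?thesis using that c by blast
qed

lemma locint_integrable: "integrable lborel f \<Longrightarrow> locint f"
  unfolding locint_def by (auto intro!: integrable_mult_indicator[where 'b=real, simplified])

text \<open>The L1 case of Young's inequality: exchange the integrals and use that the kernel also
  has integral 1 in its first variable.\<close>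

lemma nn_integral_moll_le:
  assumes u: "integrable lborel u" and d: "d > 0"
  shows "(\<integral>\<^sup>+x. ennreal \<bar>moll d u x\<bar> \<partial>lborel) \<le> (\<integral>\<^sup>+x. ennreal \<bar>u x\<bar> \<partial>lborel)"
proof -
  have [measurable]: "u \<in> borel_measurable borel" using u by simp
  have "(\<integral>\<^sup>+x. ennreal \<bar>moll d u x\<bar> \<partial>lborel)
      \<le> (\<integral>\<^sup>+x. (\<integral>\<^sup>+y. ennreal \<bar>mollifier d (x - y) * u y\<bar> \<partial>lborel) \<partial>lborel)"
  proof (rule nn_integral_mono)
    fix x
    show "ennreal \<bar>moll d u x\<bar> \<le> (\<integral>\<^sup>+y. ennreal \<bar>mollifier d (x - y) * u y\<bar> \<partial>lborel)"
      using integral_norm_bound_ennreal[OF integrable_moll[OF locint_integrable[OF u]], of d x]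
      by (simp add: moll_def)
  qed
  also have "\<dots> = (\<integral>\<^sup>+y. (\<integral>\<^sup>+x. ennreal \<bar>mollifier d (x - y) * u y\<bar> \<partial>lborel) \<partial>lborel)"
    by (rule lborel_pair.Fubini'[symmetric]) simp
  also have "\<dots> = (\<integral>\<^sup>+y. (\<integral>\<^sup>+x. ennreal (mollifier d (x - y)) \<partial>lborel) * ennreal \<bar>u y\<bar> \<partial>lborel)"
    by (simp add: abs_mult mollifier_nonneg ennreal_mult nn_integral_multc)
  also have "\<dots> = (\<integral>\<^sup>+x. ennreal \<bar>u x\<bar> \<partial>lborel)"
    by (simp add: nn_integral_mollifier_translate[OF d])
  finally show ?thesis .
qed

lemma moll_integrable:
  assumes u: "integrable lborel u" and d: "d > 0"
  shows "integrable lborel (moll d u)"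
    and "(LINT x|lborel. \<bar>moll d u x\<bar>) \<le> (LINT x|lborel. \<bar>u x\<bar>)"
proof -
  have [measurable]: "u \<in> borel_measurable borel" using u by simp
  have e: "(\<integral>\<^sup>+x. ennreal \<bar>u x\<bar> \<partial>lborel) = ennreal (LINT x|lborel. \<bar>u x\<bar>)"
    using u by (intro nn_integral_eq_integral) auto
  show i: "integrable lborel (moll d u)"
    unfolding integrable_iff_bounded
    using nn_integral_moll_le[OF u d] e by (auto simp: top.not_eq_extremum[symmetric] top_unique)
  have "(\<integral>\<^sup>+x. ennreal \<bar>moll d u x\<bar> \<partial>lborel) = ennreal (LINT x|lborel. \<bar>moll d u x\<bar>)"
    using i by (intro nn_integral_eq_integral) auto
  then show "(LINT x|lborel. \<bar>moll d u x\<bar>) \<le> (LINT x|lborel. \<bar>u x\<bar>)"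
    using nn_integral_moll_le[OF u d] e by (simp add: ennreal_le_iff)
qed

lemma moll_diff:
  assumes "locint u" "locint v"
  shows "moll d (\<lambda>x. u x - v x) x = moll d u x - moll d v x"
  using assms[THEN integrable_moll, of d x] by (simp add: moll_def right_diff_distrib)

definition mscale :: "nat \<Rightarrow> real" where "mscale k = 1 / (real k + 1)"

lemma mscale: "0 < mscale k" "mscale k \<le> 1" by (auto simp: mscale_def)

lemma mscale_tendsto: "mscale \<longlonglongrightarrow> 0"
  using LIMSEQ_inverse_real_of_nat by (simp add: mscale_def[abs_def] inverse_eq_divide add.commute)

text \<open>Uniform continuity on the ball of radius \<open>S + 2\<close>. If
  \<open>norm x \<le> S + 1\<close>, points within distance 1 stay in that ball; otherwise
  \<open>x\<close> and all these points lie outside the support.\<close>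

lemma moll_tendsto_uniform:
  assumes c: "continuous_on UNIV c" and supp: "\<And>x. S < norm x \<Longrightarrow> c x = 0" and "\<eta> > 0"
  shows "\<forall>\<^sub>F k in sequentially. \<forall>x. \<bar>moll (mscale k) c x - c x\<bar> \<le> \<eta>"
proof -
  have "uniformly_continuous_on (cball 0 (S + 2)) c"
    by (intro compact_uniformly_continuous continuous_on_subset[OF c]) auto
  then obtain \<delta> where \<delta>: "\<delta> > 0" "\<And>x y. x \<in> cball 0 (S+2) \<Longrightarrow> y \<in> cball 0 (S+2) \<Longrightarrow> dist y x < \<delta> \<Longrightarrow> dist (c y) (c x) < \<eta>"
    using \<open>\<eta> > 0\<close> unfolding uniformly_continuous_on_def by metis
  have "\<forall>\<^sub>F k in sequentially. 2 * mscale k < min \<delta> 1"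
    using \<delta>(1) tendsto_mult_right_zero[OF mscale_tendsto, of 2] by (intro order_tendstoD(2)) auto
  then show ?thesis
  proof eventually_elim
    case (elim k)
    show ?case
    proof (intro allI moll_near locint_continuous c mscale AE_I2 impI)
      fix x y :: "real^2" assume xy: "norm (x - y) \<le> 2 * mscale k"
      then have d: "dist y x < \<delta>" "norm (x - y) \<le> 1" using elim by (auto simp: dist_norm norm_minus_commute)
      show "\<bar>c y - c x\<bar> \<le> \<eta>"
      proof (cases "norm x \<le> S + 1")
        case True
        then have "norm y \<le> S + 2" using d(2) norm_triangle_ineq2[of y x] by (simp add: norm_minus_commute)
        then show ?thesis using \<delta>(2)[of x y] True d by (auto simp: dist_real_def)
      next
        case False
        then have "S < norm y" using d(2) norm_triangle_ineq2[of x y] by simp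
        then show ?thesis using False supp[of x] supp[of y] \<open>\<eta> > 0\<close> by simp
      qed
    qed
  qed
qed

lemma moll_eq_0:
  assumes "\<And>x. S < norm x \<Longrightarrow> u x = 0" "S + 2 * d < norm x"
  shows "moll d u x = 0"
proof -
  have "mollifier d (x - y) * u y = 0" for y
    using assms mollifier_eq_0[of d "x - y"] norm_triangle_ineq2[of x y]
    by (cases "S < norm y") auto
  then show ?thesis unfolding moll_def by (simp only: integral_zero)
qed

lemma moll_tendsto_L1:
  assumes u: "integrable lborel u"
  shows "(\<lambda>k. LINT x|lborel. \<bar>moll (mscale k) u x - u x\<bar>) \<longlonglongrightarrow> 0"
proof (rule LIMSEQ_I)
  fix \<epsilon> :: real assume \<epsilon>: "\<epsilon> > 0"
  obtain c S where c: "continuous_on UNIV c" "\<And>x. S < norm x \<Longrightarrow> c x = 0"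
    "(LINT x|lborel. \<bar>u x - c x\<bar>) < \<epsilon> / 3"
    using integrable_approx_continuous[OF u, of "\<epsilon> / 3"] \<epsilon> by auto
  have ci: "integrable lborel c" by (rule integrable_continuous_compact_support[OF c(1,2)])
  \<comment> \<open>For scales at most 1 the mollification of \<open>c\<close> is supported in the
    ball of radius \<open>S + 2\<close>; its area turns the uniform error into an L1 error. The
    other two thirds of the budget are the approximation of \<open>u\<close> by \<open>c\<close> and
    its mollification, which is a contraction.\<close>
  define V where "V = measure lborel (cball (0::real^2) (S + 2))"
  have V: "V \<ge> 0" by (simp add: V_def)
  define \<eta> where "\<eta> = \<epsilon> / (3 * (V + 1))"
  have \<eta>: "\<eta> > 0" "\<eta> * V < \<epsilon> / 3" using \<epsilon> V by (auto simp: \<eta>_def field_simps)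
  have "\<forall>\<^sub>F k in sequentially. \<forall>x. \<bar>moll (mscale k) c x - c x\<bar> \<le> \<eta>"
    by (rule moll_tendsto_uniform[OF c(1,2) \<eta>(1)])
  then obtain K where K: "\<And>k x. k \<ge> K \<Longrightarrow> \<bar>moll (mscale k) c x - c x\<bar> \<le> \<eta>"
    unfolding eventually_sequentially by blast
  show "\<exists>no. \<forall>k\<ge>no. norm ((LINT x|lborel. \<bar>moll (mscale k) u x - u x\<bar>) - 0) < \<epsilon>"
  proof (intro exI[of _ K] allI impI)
    fix k assume k: "k \<ge> K"
    let ?d = "mscale k"
    have uc: "integrable lborel (\<lambda>x. u x - c x)" using u ci by simp
    have mc: "integrable lborel (moll ?d c)" by (rule moll_integrable[OF ci mscale(1)])
    have mu: "integrable lborel (moll ?d u)" by (rule moll_integrable[OF u mscale(1)])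
    have "(LINT x|lborel. \<bar>moll ?d u x - u x\<bar>) \<le>
        (LINT x|lborel. \<bar>moll ?d (\<lambda>x. u x - c x) x\<bar> + \<bar>moll ?d c x - c x\<bar> + \<bar>u x - c x\<bar>)"
      using moll_diff[OF locint_integrable[OF u] locint_integrable[OF ci], of ?d]
        moll_integrable[OF uc mscale(1), of k] u ci mc mu
      by (intro integral_mono) auto
    also have "\<dots> = (LINT x|lborel. \<bar>moll ?d (\<lambda>x. u x - c x) x\<bar>) + (LINT x|lborel. \<bar>moll ?d c x - c x\<bar>)
        + (LINT x|lborel. \<bar>u x - c x\<bar>)"
      using moll_integrable[OF uc mscale(1), of k] u ci mc mu by simp
    also have "(LINT x|lborel. \<bar>moll ?d (\<lambda>x. u x - c x) x\<bar>) \<le> (LINT x|lborel. \<bar>u x - c x\<bar>)"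
      by (rule moll_integrable[OF uc mscale(1)])
    also have "(LINT x|lborel. \<bar>moll ?d c x - c x\<bar>) \<le> (LINT x|lborel. indicator (cball (0::real^2) (S+2)) x * \<eta>)"
    proof (rule integral_mono)
      fix x
      show "\<bar>moll ?d c x - c x\<bar> \<le> indicator (cball 0 (S+2)) x * \<eta>"
        using K[OF k, of x] c(2)[of x] moll_eq_0[of S c ?d x, OF c(2)] mscale(2)[of k]
        by (cases "S + 2 < norm x") (auto simp: indicator_def)
    qed (use mc ci integrable_indicator_cball in auto)
    also have "\<dots> = \<eta> * V" by (simp add: V_def)
    finally have "(LINT x|lborel. \<bar>moll ?d u x - u x\<bar>) < \<epsilon>" using \<eta>(2) c(3) by linarith
    then show "norm ((LINT x|lborel. \<bar>moll ?d u x - u x\<bar>) - 0) < \<epsilon>" by simp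
  qed
qed

text \<open>On the ball of radius \<open>R\<close> the mollification sees \<open>u\<close> only up
  to radius \<open>R + 2\<close>, so \<open>u\<close> may be cut off there and the integrable case
  applies.\<close>

lemma moll_tendsto_L1_local:
  assumes u: "locint u"
  shows "(\<lambda>k. LINT x|lborel. indicator (cball 0 R) x * \<bar>moll (mscale k) u x - u x\<bar>) \<longlonglongrightarrow> 0" (is "?I \<longlonglongrightarrow> 0")
    and "integrable lborel (\<lambda>x. indicator (cball 0 R) x * \<bar>moll (mscale k) u x - u x\<bar>)"
proof -
  define v where "v x = indicator (cball 0 (R + 2)) x * u x" for x
  have [measurable]: "u \<in> borel_measurable borel" using u by (rule locint_borel)
  have v: "integrable lborel v" using u by (simp add: v_def[abs_def] locint_def)
  then have [measurable]: "v \<in> borel_measurable borel" by simp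
  have eq: "indicator (cball 0 R) x * \<bar>moll (mscale k) u x - u x\<bar> = indicator (cball 0 R) x * \<bar>moll (mscale k) v x - v x\<bar>" for k x
  proof (cases "norm x \<le> R")
    case True
    have "moll (mscale k) u x = moll (mscale k) v x"
    proof (rule moll_cong)
      show "AE y in lborel. norm (x - y) \<le> 2 * mscale k \<longrightarrow> u y = v y"
      proof (intro AE_I2 impI)
        fix y assume "norm (x - y) \<le> 2 * mscale k"
        then have "norm y \<le> R + 2"
          using True mscale(2)[of k] norm_triangle_ineq2[of y x] by (simp add: norm_minus_commute)
        then show "u y = v y" by (simp add: v_def)
      qed
    qed auto
    with True show ?thesis by (simp add: v_def)
  qed simp
  have i: "integrable lborel (\<lambda>x. \<bar>moll (mscale k) v x - v x\<bar>)" for k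
    using v moll_integrable[OF v mscale(1)] by auto
  show int: "integrable lborel (\<lambda>x. indicator (cball 0 R) x * \<bar>moll (mscale k) u x - u x\<bar>)" for k
    unfolding eq using i[of k] by (rule integrable_mult_indicator[where 'b=real, simplified, rotated]) auto
  show "?I \<longlonglongrightarrow> 0"
  proof (rule tendsto_sandwich[OF _ _ tendsto_const moll_tendsto_L1[OF v]])
    show "\<forall>\<^sub>F k in sequentially. 0 \<le> ?I k"
      by (intro always_eventually allI integral_nonneg_AE AE_I2) auto
    show "\<forall>\<^sub>F k in sequentially. ?I k \<le> (LINT x|lborel. \<bar>moll (mscale k) v x - v x\<bar>)"
      using int i unfolding eq
      by (intro always_eventually allI integral_mono) (auto simp: indicator_def)
  qed
qed

lemma moll_AE_subseq:
  assumes u: "locint u"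
  obtains r where "strict_mono r" "AE x in lborel. norm x \<le> R \<longrightarrow> (\<lambda>k. moll (mscale (r k)) u x) \<longlonglongrightarrow> u x"
proof -
  have "\<exists>r::nat\<Rightarrow>nat. strict_mono r \<and> (AE x in lborel. (\<lambda>k. indicator (cball 0 R) x * \<bar>moll (mscale (r k)) u x - u x\<bar>) \<longlonglongrightarrow> 0)"
    by (rule tendsto_L1_AE_subseq) (use moll_tendsto_L1_local[OF u, of R] in \<open>auto simp: abs_mult\<close>)
  then obtain r where r: "strict_mono r"
    "AE x in lborel. (\<lambda>k. indicator (cball 0 R) x * \<bar>moll (mscale (r k)) u x - u x\<bar>) \<longlonglongrightarrow> 0" by blast
  from r(2) have "AE x in lborel. norm x \<le> R \<longrightarrow> (\<lambda>k. moll (mscale (r k)) u x) \<longlonglongrightarrow> u x"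
    by eventually_elim (auto simp: tendsto_rabs_zero_iff LIM_zero_iff)
  with r(1) show ?thesis using that by blast
qed

section \<open>Weak derivatives\<close>

lemma wderiv_locint: "wderiv i u g \<Longrightarrow> locint u" "wderiv i u g \<Longrightarrow> locint g"
  by (auto simp: wderiv_def)

lemma test_fun_borel:
  assumes "test_fun \<phi>" shows "\<phi> \<in> borel_measurable borel" "pd \<phi> i \<in> borel_measurable borel"
  using assms by (auto simp: test_fun_def intro!: borel_measurable_continuous_onI smooth2_continuous smooth2_pd)

lemma integrable_mult_test_fun:
  assumes "locint u" "test_fun \<phi>"
  shows "integrable lborel (\<lambda>x. u x * \<phi> x)" "integrable lborel (\<lambda>x. u x * pd \<phi> i x)"
proof -
  obtain B where B: "\<And>i x. \<bar>pd \<phi> i x\<bar> \<le> B" "\<And>x. \<bar>\<phi> x\<bar> \<le> B"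
    using test_fun_derivative_bound[OF assms(2)] by metis
  obtain R where R: "\<And>x. R < norm x \<Longrightarrow> \<phi> x = 0" "\<And>i x. R < norm x \<Longrightarrow> pd \<phi> i x = 0"
    using test_fun_support[OF assms(2)] by metis
  note [measurable] = test_fun_borel[OF assms(2)]
  have "integrable lborel (\<lambda>x. \<phi> x * u x)"
    by (rule locint_mult[OF assms(1)]) (use B R in auto)
  then show "integrable lborel (\<lambda>x. u x * \<phi> x)" by (simp add: mult.commute)
  have "integrable lborel (\<lambda>x. pd \<phi> i x * u x)"
    by (rule locint_mult[OF assms(1)]) (use B R in auto)
  then show "integrable lborel (\<lambda>x. u x * pd \<phi> i x)" by (simp add: mult.commute)
qed

lemma locint_diff: "locint u \<Longrightarrow> locint v \<Longrightarrow> locint (\<lambda>x. u x - v x)"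
  by (auto simp: locint_def right_diff_distrib)

lemma locint_add: "locint u \<Longrightarrow> locint v \<Longrightarrow> locint (\<lambda>x. u x + v x)"
  by (auto simp: locint_def distrib_left)

lemma wderiv_add:
  assumes "wderiv i u g" "wderiv i v h"
  shows "wderiv i (\<lambda>x. u x + v x) (\<lambda>x. g x + h x)"
  using assms integrable_mult_test_fun
  by (simp add: wderiv_def locint_add distrib_right)

lemma AE_cball_nat:
  assumes "\<And>R::nat. AE x in lborel. norm x \<le> real R \<longrightarrow> P (x::real^2)"
  shows "AE x in lborel. P x"
proof -
  have "AE x in lborel. \<forall>R::nat. norm x \<le> real R \<longrightarrow> P x"
    using assms by (intro AE_all_countable[THEN iffD2] allI)
  then show ?thesis
  proof eventually_elim
    case (elim x)
    obtain R :: nat where "norm x \<le> real R" using real_arch_simple by blast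
    with elim show ?case by blast
  qed
qed

text \<open>The fundamental lemma of the calculus of variations: mollification kernels are test
  functions, so all mollifications of \<open>f\<close> vanish, and a subsequence of them converges
  to \<open>f\<close> almost everywhere on each ball.\<close>

lemma locint_eq_0_AE:
  assumes f: "locint f" and 0: "\<And>\<phi>. test_fun \<phi> \<Longrightarrow> (LINT x|lborel. f x * \<phi> x) = 0"
  shows "AE x in lborel. f x = 0"
proof (rule AE_cball_nat)
  fix R :: nat
  have m: "moll d f x = 0" for d x
    using 0[OF test_fun_mollifier, of d x] by (simp add: moll_def mult.commute)
  obtain r where "AE x in lborel. norm x \<le> real R \<longrightarrow> (\<lambda>k. moll (mscale (r k)) f x) \<longlonglongrightarrow> f x"
    by (rule moll_AE_subseq[OF f, of "real R"]) blast
  then show "AE x in lborel. norm x \<le> real R \<longrightarrow> f x = 0"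
    unfolding m by eventually_elim (simp add: LIMSEQ_const_iff)
qed

lemma wderiv_unique:
  assumes "wderiv i u g" "wderiv i v h" "AE x in lborel. u x = v x"
  shows "AE x in lborel. g x = h x"
proof -
  note l = assms(1,2)[THEN wderiv_locint(2)] assms(1,2)[THEN wderiv_locint(1)]
  note [measurable] = l[THEN locint_borel]
  have "AE x in lborel. g x - h x = 0"
  proof (rule locint_eq_0_AE[OF locint_diff[OF l(1,2)]])
    fix \<phi> assume t: "test_fun \<phi>"
    note [measurable] = test_fun_borel[OF t]
    have "(LINT x|lborel. u x * pd \<phi> i x) = (LINT x|lborel. v x * pd \<phi> i x)"
      using assms(3) by (intro integral_cong_AE) auto
    then show "(LINT x|lborel. (g x - h x) * \<phi> x) = 0"
      using assms t integrable_mult_test_fun[OF _ t] l by (simp add: wderiv_def left_diff_distrib)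
  qed
  then show ?thesis by simp
qed

lemma smooth2_pd_axis:
  assumes "smooth2 f"
  shows "((\<lambda>t. f (x + t *\<^sub>R axis i 1)) has_real_derivative pd f i x) (at 0)"
proof -
  have "((\<lambda>s. x + s *\<^sub>R axis i 1) has_derivative (\<lambda>h. h *\<^sub>R axis i 1)) (at 0)"
    by (auto intro!: derivative_eq_intros)
  moreover have "(f has_derivative (\<lambda>v. v$1 * pd f 1 x + v$2 * pd f 2 x)) (at (x + 0 *\<^sub>R axis i 1))"
    using smooth2_has_derivative[OF assms] by simp
  ultimately have "((\<lambda>t. f (x + t *\<^sub>R axis i 1)) has_derivative
      (\<lambda>h. (h *\<^sub>R axis i 1 :: real^2)$1 * pd f 1 x + (h *\<^sub>R axis i 1 :: real^2)$2 * pd f 2 x)) (at 0)"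
    by (rule has_derivative_compose)
  then show ?thesis
    unfolding has_field_derivative_def
    by (rule has_derivative_eq_rhs) (use exhaust_2[of i] in \<open>auto simp: axis_def fun_eq_iff\<close>)
qed

lemma wderiv_const: "wderiv i (\<lambda>_. c) (\<lambda>_. 0)"
  unfolding wderiv_def
proof (intro conjI allI impI locint_continuous continuous_intros)
  fix \<phi> assume t: "test_fun \<phi>"
  then have sm: "smooth2 \<phi>" by (simp add: test_fun_def)
  obtain B where B: "\<And>i x. \<bar>pd \<phi> i x\<bar> \<le> B" using test_fun_derivative_bound[OF t] by metis
  obtain R where R: "\<And>x. R < norm x \<Longrightarrow> \<phi> x = 0" using test_fun_support[OF t] by metis
  have "(LINT x|lborel. pd \<phi> i x) = 0"
  proof (rule integral_directional_derivative_eq_0[where B = B and R = R and e = "axis i 1"])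
    fix x
    show "((\<lambda>t. \<phi> (x + t *\<^sub>R axis i 1)) has_real_derivative pd \<phi> i x) (at 0)"
      using smooth2_pd_axis[OF sm] .
    show "integrable lborel \<phi>"
      using integrable_mult_test_fun(1)[OF locint_continuous[OF continuous_on_const] t, of 1] by simp
  qed (use B R test_fun_borel[OF t] in auto)
  then show "(LINT x|lborel. c * pd \<phi> i x) = - (LINT x|lborel. 0 * \<phi> x)" by simp
qed

text \<open>The identity holds classically for the mollified function; only \<open>L\<^sup>1\<close> convergence of the mollified
  derivative is available, so the uniform bound on the function is used to pass to the limit.\<close>

lemma wderiv_square:
  assumes w: "\<And>i. wderiv i u (g i)" and b: "\<And>x. \<bar>u x\<bar> \<le> B"
  shows "wderiv i (\<lambda>x. (u x)\<^sup>2) (\<lambda>x. 2 * u x * g i x)"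
proof -
  have u: "locint u" and g: "locint (g i)" using w wderiv_locint by blast+
  note [measurable] = u[THEN locint_borel] g[THEN locint_borel]
  have B: "B \<ge> 0" using b[of 0] by linarith
  have lu: "locint (\<lambda>x. (u x)\<^sup>2)"
    by (rule locint_bounded[of _ "B\<^sup>2"]) (use b in \<open>auto simp: abs_le_square_iff intro: power2_le_iff_abs_le[THEN iffD2] B\<close>)
  have lg: "locint (\<lambda>x. 2 * u x * g i x)"
    unfolding locint_def
  proof (intro conjI allI)
    fix R
    show "integrable lborel (\<lambda>x. indicator (cball 0 R) x * (2 * u x * g i x))"
    proof (rule Bochner_Integration.integrable_bound)
      show "integrable lborel (\<lambda>x. 2 * B * (indicator (cball 0 R) x * g i x))"
        using g by (simp add: locint_def)
      show "AE x in lborel. norm (indicator (cball 0 R) x * (2 * u x * g i x))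
          \<le> norm (2 * B * (indicator (cball 0 R) x * g i x))"
        using b B by (intro AE_I2) (auto simp: indicator_def abs_mult intro!: mult_right_mono)
    qed measurable
  qed measurable
  show ?thesis unfolding wderiv_def
  proof (intro conjI allI impI lu lg)
    fix \<phi> assume t: "test_fun \<phi>"
    note [measurable] = test_fun_borel[OF t]
    have sm: "smooth2 \<phi>" using t by (simp add: test_fun_def)
    obtain C where C: "C > 0" "\<And>i x. \<bar>pd \<phi> i x\<bar> \<le> C" "\<And>x. \<bar>\<phi> x\<bar> \<le> C"
      using test_fun_derivative_bound[OF t] by metis
    obtain R where R: "\<And>x. R < norm x \<Longrightarrow> \<phi> x = 0" "\<And>i x. R < norm x \<Longrightarrow> pd \<phi> i x = 0"
      using test_fun_support[OF t] by metis
    obtain r where r: "strict_mono r" "AE x in lborel. norm x \<le> R \<longrightarrow> (\<lambda>k. moll (mscale (r k)) u x) \<longlonglongrightarrow> u x"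
      using moll_AE_subseq[OF u] by blast
    define U where "U k = moll (mscale (r k)) u" for k
    define H where "H k = moll (mscale (r k)) (g i)" for k
    have [measurable]: "U k \<in> borel_measurable borel" "H k \<in> borel_measurable borel" for k
      by (auto simp: U_def H_def)
    have Ub: "\<bar>U k x\<bar> \<le> B" for k x
      unfolding U_def by (rule moll_bounded[OF u mscale(1)]) (use b in auto)
    have Ub2: "\<bar>(U k x)\<^sup>2\<bar> \<le> B\<^sup>2" for k x
      using Ub[of k x] B abs_le_square_iff[of "U k x" B] by simp
    have Hint: "integrable lborel (\<lambda>x. indicator (cball 0 R) x * \<bar>H k x - g i x\<bar>)" for k
      unfolding H_def by (rule moll_tendsto_L1_local[OF g])
    have Hlim: "(\<lambda>k. LINT x|lborel. indicator (cball 0 R) x * \<bar>H k x - g i x\<bar>) \<longlonglongrightarrow> 0"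
      using LIMSEQ_subseq_LIMSEQ[OF moll_tendsto_L1_local(1)[OF g, of R] r(1)]
      by (simp add: H_def o_def)
    \<comment> \<open>The bound may depend on \<open>k\<close>: it only makes integration by parts
      available for each single mollification and never enters a limit.\<close>
    obtain D where D: "\<And>k x. norm x \<le> R \<Longrightarrow> \<bar>H k x\<bar> \<le> D k"
    proof -
      have "\<exists>D. \<forall>x. norm x \<le> R \<longrightarrow> \<bar>H k x\<bar> \<le> D" for k
      proof -
        obtain E where E: "\<And>x. \<bar>mollifier (mscale (r k)) x\<bar> \<le> E" "E > 0" using mollifier_bounded[of "mscale (r k)"] by blast
        have "\<bar>H k x\<bar> \<le> (LINT y|lborel. E * \<bar>indicator (cball 0 (R + 2)) y * g i y\<bar>)" if "norm x \<le> R" for x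
        proof -
          have "\<bar>H k x\<bar> \<le> (LINT y|lborel. \<bar>mollifier (mscale (r k)) (x - y) * g i y\<bar>)"
            unfolding H_def moll_def by (rule integral_abs_bound)
          also have "\<dots> \<le> (LINT y|lborel. E * \<bar>indicator (cball 0 (R + 2)) y * g i y\<bar>)"
          proof (rule integral_mono)
            show "integrable lborel (\<lambda>y. \<bar>mollifier (mscale (r k)) (x - y) * g i y\<bar>)"
              using integrable_moll[OF g] by simp
            show "integrable lborel (\<lambda>y. E * \<bar>indicator (cball 0 (R + 2)) y * g i y\<bar>)"
              using g by (simp add: locint_def)
            fix y
            show "\<bar>mollifier (mscale (r k)) (x - y) * g i y\<bar> \<le> E * \<bar>indicator (cball 0 (R + 2)) y * g i y\<bar>"
            proof (cases "norm y \<le> R + 2")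
              case True
              then show ?thesis using E(1)[of "x - y"] by (simp add: abs_mult mult_right_mono)
            next
              case False
              then show ?thesis
                using mollifier_translate_eq_0[of x "mscale (r k)" y] mscale(2)[of "r k"] that E(2) by simp
            qed
          qed
          finally show ?thesis .
        qed
        then show ?thesis by blast
      qed
      then show ?thesis using that by metis
    qed
    have ibp: "(LINT x|lborel. (U k x)\<^sup>2 * pd \<phi> i x + 2 * U k x * H k x * \<phi> x) = 0" for k
    proof (rule integral_directional_derivative_eq_0[where f = "\<lambda>x. (U k x)\<^sup>2 * \<phi> x" and e = "axis i 1" and R = R])
      fix x
      note p = smooth2_pd_axis[OF sm, of x i]
      have "((\<lambda>t. U k (x + t *\<^sub>R axis i 1)) has_real_derivative H k x) (at 0)"
        using moll_has_real_derivative[OF w[of 1] w[of 2], of "mscale (r k)" x "axis i 1" 0] exhaust_2[of i]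
        by (auto simp: U_def H_def axis_def)
      from DERIV_mult[OF DERIV_power[OF this, of 2] p]
      show "((\<lambda>t. (U k (x + t *\<^sub>R axis i 1))\<^sup>2 * \<phi> (x + t *\<^sub>R axis i 1)) has_real_derivative
          (U k x)\<^sup>2 * pd \<phi> i x + 2 * U k x * H k x * \<phi> x) (at 0)"
        by (rule DERIV_cong) (simp add: algebra_simps)
    next
      fix x
      show "\<bar>(U k x)\<^sup>2 * pd \<phi> i x + 2 * U k x * H k x * \<phi> x\<bar> \<le> B\<^sup>2 * C + 2 * B * \<bar>D k\<bar> * C"
      proof (cases "norm x \<le> R")
        case True
        have "\<bar>(U k x)\<^sup>2 * pd \<phi> i x\<bar> \<le> B\<^sup>2 * C"
          using Ub2[of k x] C by (simp only: abs_mult) (intro mult_mono; simp)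
        moreover have "\<bar>2 * U k x * H k x * \<phi> x\<bar> \<le> 2 * B * \<bar>D k\<bar> * C"
          using Ub[of k x] C D[OF True, of k] B by (simp only: abs_mult) (intro mult_mono; simp)
        ultimately show ?thesis by linarith
      qed (use R[of x] C B in simp)
    next
      show "integrable lborel (\<lambda>x. (U k x)\<^sup>2 * \<phi> x)"
        by (intro integrable_mult_test_fun(1)[OF _ t] locint_bounded[of _ "B\<^sup>2"]) (use Ub2 in auto)
    qed (use R in auto)
    have iL: "integrable lborel (\<lambda>x. (U k x)\<^sup>2 * pd \<phi> i x)" for k
      by (intro integrable_mult_test_fun(2)[OF _ t] locint_bounded[of _ "B\<^sup>2"]) (use Ub2 in auto)
    have gi: "integrable lborel (\<lambda>x. 2 * B * C * \<bar>indicator (cball 0 R) x * g i x\<bar>)"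
      using g by (simp add: locint_def)
    have bR1: "\<bar>2 * U k x * g i x * \<phi> x\<bar> \<le> 2 * B * C * \<bar>indicator (cball 0 R) x * g i x\<bar>" for k x
    proof (cases "norm x \<le> R")
      case True
      have "\<bar>U k x\<bar> * \<bar>\<phi> x\<bar> * \<bar>g i x\<bar> \<le> B * C * \<bar>g i x\<bar>"
        using Ub[of k x] C B by (intro mult_mono mult_right_mono) auto
      then show ?thesis using True by (simp add: abs_mult mult_ac)
    qed (use R[of x] in simp)
    have iR1: "integrable lborel (\<lambda>x. 2 * U k x * g i x * \<phi> x)" for k
      by (rule Bochner_Integration.integrable_bound[OF gi])
        (use bR1[of k] in \<open>auto intro: order_trans[OF _ abs_ge_self]\<close>)
    have bR2: "\<bar>2 * U k x * (H k x - g i x) * \<phi> x\<bar> \<le> 2 * B * C * (indicator (cball 0 R) x * \<bar>H k x - g i x\<bar>)" for k x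
    proof (cases "norm x \<le> R")
      case True
      have "\<bar>U k x\<bar> * \<bar>\<phi> x\<bar> * \<bar>H k x - g i x\<bar> \<le> B * C * \<bar>H k x - g i x\<bar>"
        using Ub[of k x] C B by (intro mult_mono mult_right_mono) auto
      then show ?thesis using True by (simp add: abs_mult mult_ac)
    qed (use R[of x] in simp)
    have iR2: "integrable lborel (\<lambda>x. 2 * U k x * (H k x - g i x) * \<phi> x)" for k
      by (rule Bochner_Integration.integrable_bound[OF integrable_mult_right[OF Hint[of k], of "2 * B * C"]])
        (use bR2[of k] in \<open>auto intro: order_trans[OF _ abs_ge_self]\<close>)
    \<comment> \<open>\<open>H k\<close> is split into \<open>g i\<close> and an error. The first
      part converges by domination with \<open>g i\<close>; in the second, a uniformly bounded
      factor meets an error that tends to zero in L1.\<close>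
    have eq: "(LINT x|lborel. (U k x)\<^sup>2 * pd \<phi> i x) = - (LINT x|lborel. 2 * U k x * g i x * \<phi> x)
       - (LINT x|lborel. 2 * U k x * (H k x - g i x) * \<phi> x)" for k
    proof -
      have "(LINT x|lborel. (U k x)\<^sup>2 * pd \<phi> i x + 2 * U k x * H k x * \<phi> x)
        = (LINT x|lborel. (U k x)\<^sup>2 * pd \<phi> i x + (2 * U k x * g i x * \<phi> x + 2 * U k x * (H k x - g i x) * \<phi> x))"
        by (intro Bochner_Integration.integral_cong) (auto simp: algebra_simps)
      also have "\<dots> = (LINT x|lborel. (U k x)\<^sup>2 * pd \<phi> i x) + ((LINT x|lborel. 2 * U k x * g i x * \<phi> x) + (LINT x|lborel. 2 * U k x * (H k x - g i x) * \<phi> x))"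
        by (simp only: Bochner_Integration.integral_add[OF iL Bochner_Integration.integrable_add[OF iR1 iR2]]
            Bochner_Integration.integral_add[OF iR1 iR2])
      finally show ?thesis using ibp[of k] by linarith
    qed
    have lim1: "(\<lambda>k. LINT x|lborel. (U k x)\<^sup>2 * pd \<phi> i x) \<longlonglongrightarrow> (LINT x|lborel. (u x)\<^sup>2 * pd \<phi> i x)"
    proof (rule integral_dominated_convergence[where w = "\<lambda>x. indicator (cball 0 R) x * (B\<^sup>2 * C)"])
      show "AE x in lborel. (\<lambda>k. (U k x)\<^sup>2 * pd \<phi> i x) \<longlonglongrightarrow> (u x)\<^sup>2 * pd \<phi> i x"
        using r(2)
      proof eventually_elim
        case (elim x)
        then show ?case using R(2)[of x i]
          by (cases "norm x \<le> R") (auto simp: U_def intro!: tendsto_intros)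
      qed
      show "AE x in lborel. norm ((U k x)\<^sup>2 * pd \<phi> i x) \<le> indicator (cball 0 R) x * (B\<^sup>2 * C)" for k
      proof (rule AE_I2)
        fix x show "norm ((U k x)\<^sup>2 * pd \<phi> i x) \<le> indicator (cball 0 R) x * (B\<^sup>2 * C)"
          using mult_mono[OF Ub2[of k x] C(2)[of i x]] R(2)[of x i]
          by (cases "norm x \<le> R") (auto simp: abs_mult)
      qed
    qed (use integrable_indicator_cball in auto)
    have lim2: "(\<lambda>k. LINT x|lborel. 2 * U k x * g i x * \<phi> x) \<longlonglongrightarrow> (LINT x|lborel. 2 * u x * g i x * \<phi> x)"
    proof (rule integral_dominated_convergence[OF _ _ gi])
      show "AE x in lborel. (\<lambda>k. 2 * U k x * g i x * \<phi> x) \<longlonglongrightarrow> 2 * u x * g i x * \<phi> x"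
        using r(2)
      proof eventually_elim
        case (elim x)
        then show ?case using R(1)[of x]
          by (cases "norm x \<le> R") (auto simp: U_def intro!: tendsto_intros)
      qed
      show "AE x in lborel. norm (2 * U k x * g i x * \<phi> x) \<le> 2 * B * C * \<bar>indicator (cball 0 R) x * g i x\<bar>" for k
        using bR1 by simp
    qed auto
    have lim3: "(\<lambda>k. LINT x|lborel. 2 * U k x * (H k x - g i x) * \<phi> x) \<longlonglongrightarrow> 0"
    proof (rule Lim_null_comparison)
      show "(\<lambda>k. 2 * B * C * (LINT x|lborel. indicator (cball 0 R) x * \<bar>H k x - g i x\<bar>)) \<longlonglongrightarrow> 0"
        using tendsto_mult_right_zero[OF Hlim] by blast
      show "\<forall>\<^sub>F k in sequentially. norm (LINT x|lborel. 2 * U k x * (H k x - g i x) * \<phi> x)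
          \<le> 2 * B * C * (LINT x|lborel. indicator (cball 0 R) x * \<bar>H k x - g i x\<bar>)"
      proof (intro always_eventually allI)
        fix k
        have "norm (LINT x|lborel. 2 * U k x * (H k x - g i x) * \<phi> x) \<le> (LINT x|lborel. \<bar>2 * U k x * (H k x - g i x) * \<phi> x\<bar>)"
          by (simp add: integral_abs_bound)
        also have "\<dots> \<le> (LINT x|lborel. 2 * B * C * (indicator (cball 0 R) x * \<bar>H k x - g i x\<bar>))"
          by (intro integral_mono bR2 integrable_abs iR2 integrable_mult_right Hint)
        also have "\<dots> = 2 * B * C * (LINT x|lborel. indicator (cball 0 R) x * \<bar>H k x - g i x\<bar>)"
          by (rule integral_mult_right_zero)
        finally show "norm (LINT x|lborel. 2 * U k x * (H k x - g i x) * \<phi> x)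
          \<le> 2 * B * C * (LINT x|lborel. indicator (cball 0 R) x * \<bar>H k x - g i x\<bar>)" .
      qed
    qed
    have "(\<lambda>k. LINT x|lborel. (U k x)\<^sup>2 * pd \<phi> i x) \<longlonglongrightarrow> - (LINT x|lborel. 2 * u x * g i x * \<phi> x) - 0"
      unfolding eq by (intro tendsto_intros lim2 lim3)
    from LIMSEQ_unique[OF lim1 this]
    show "(LINT x|lborel. (u x)\<^sup>2 * pd \<phi> i x) = - (LINT x|lborel. 2 * u x * g i x * \<phi> x)" by simp
  qed
qed

section \<open>Functions with bounded or continuous weak derivatives\<close>

lemma moll_mean_value:
  assumes u1: "wderiv 1 u g1" and u2: "wderiv 2 u g2"
  obtains s where "0 < s" "s < 1" "moll d u y - moll d u x =
     (y - x)$1 * moll d g1 (x + s *\<^sub>R (y - x)) + (y - x)$2 * moll d g2 (x + s *\<^sub>R (y - x))"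
proof -
  have "\<exists>s. 0 < s \<and> s < 1 \<and> moll d u (x + 1 *\<^sub>R (y - x)) - moll d u (x + 0 *\<^sub>R (y - x)) =
     (1 - 0) * ((y - x)$1 * moll d g1 (x + s *\<^sub>R (y - x)) + (y - x)$2 * moll d g2 (x + s *\<^sub>R (y - x)))"
    by (rule MVT2[where f = "\<lambda>t. moll d u (x + t *\<^sub>R (y - x))"])
      (rule moll_has_real_derivative[OF u1 u2] zero_less_one)+
  then show ?thesis using that by auto
qed

text \<open>All mollifications share the Lipschitz constant \<open>2 * C\<close>, one
  \<open>C\<close> per coordinate direction. The bound survives at the points where they converge;
  these have full measure, so they are dense and the function extends. The convergent subsequence
  depends on the ball, so two points are compared on a ball containing both.\<close>

lemma wderiv_bounded_lipschitz:
  assumes u1: "wderiv 1 u g1" and u2: "wderiv 2 u g2"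
    and b1: "AE x in lborel. \<bar>g1 x\<bar> \<le> C" and b2: "AE x in lborel. \<bar>g2 x\<bar> \<le> C" and C: "C \<ge> 0"
  obtains N where "(2 * C)-lipschitz_on UNIV N" "AE x in lborel. u x = N x"
proof -
  have u: "locint u" using u1 by (rule wderiv_locint)
  have ml: "\<bar>moll (mscale k) u y - moll (mscale k) u x\<bar> \<le> 2 * C * dist y x" for k x y
  proof -
    obtain s where s: "moll (mscale k) u y - moll (mscale k) u x =
     (y - x)$1 * moll (mscale k) g1 (x + s *\<^sub>R (y - x)) + (y - x)$2 * moll (mscale k) g2 (x + s *\<^sub>R (y - x))"
      by (rule moll_mean_value[OF u1 u2])
    have "\<bar>moll (mscale k) u y - moll (mscale k) u x\<bar> \<le> \<bar>(y - x)$1\<bar> * \<bar>moll (mscale k) g1 (x + s *\<^sub>R (y - x))\<bar>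
        + \<bar>(y - x)$2\<bar> * \<bar>moll (mscale k) g2 (x + s *\<^sub>R (y - x))\<bar>"
      unfolding s abs_mult[symmetric] by (rule abs_triangle_ineq)
    also have "\<dots> \<le> norm (y - x) * C + norm (y - x) * C"
      by (intro add_mono mult_mono component_le_norm_cart
          moll_bounded[OF wderiv_locint(2)[OF u1] mscale(1) b1] moll_bounded[OF wderiv_locint(2)[OF u2] mscale(1) b2]) auto
    finally show ?thesis by (simp add: dist_norm)
  qed
  have "\<forall>R::nat. \<exists>r. AE x in lborel. norm x \<le> real R \<longrightarrow> (\<lambda>k. moll (mscale (r k)) u x) \<longlonglongrightarrow> u x"
    by (rule allI, rule_tac R = "real R" in moll_AE_subseq[OF u]) blast
  from choice[OF this] obtain r where
    r: "\<And>R::nat. AE x in lborel. norm x \<le> real R \<longrightarrow> (\<lambda>k. moll (mscale (r R k)) u x) \<longlonglongrightarrow> u x"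
    by blast
  define G where "G = {x. \<forall>R::nat. norm x \<le> real R \<longrightarrow> (\<lambda>k. moll (mscale (r R k)) u x) \<longlonglongrightarrow> u x}"
  have G: "AE x in lborel. x \<in> G"
    using r by (simp only: G_def mem_Collect_eq AE_all_countable simp_thms)
  have "(2 * C)-lipschitz_on G u"
  proof (rule lipschitz_onI)
    fix x y assume xy: "x \<in> G" "y \<in> G"
    obtain R :: nat where "max (norm x) (norm y) \<le> real R" using real_arch_simple by blast
    then have "(\<lambda>k. moll (mscale (r R k)) u x) \<longlonglongrightarrow> u x" "(\<lambda>k. moll (mscale (r R k)) u y) \<longlonglongrightarrow> u y"
      using xy by (auto simp: G_def)
    then have "(\<lambda>k. \<bar>moll (mscale (r R k)) u x - moll (mscale (r R k)) u y\<bar>) \<longlonglongrightarrow> \<bar>u x - u y\<bar>"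
      by (intro tendsto_intros)
    then have "\<bar>u x - u y\<bar> \<le> 2 * C * dist x y"
      by (rule LIMSEQ_le_const2) (intro exI allI impI ml)
    then show "dist (u x) (u y) \<le> 2 * C * dist x y" by (simp add: dist_real_def)
  qed (use C in simp)
  then obtain N where N: "(2 * C)-lipschitz_on (closure G) N" "\<forall>x\<in>G. N x = u x"
    using lipschitz_extend_closure[of "2 * C" G u] by auto
  have "AE x in lebesgue. x \<in> closure G"
    using AE_completion[OF G] by eventually_elim (rule subsetD[OF closure_subset])
  then have "x \<in> closure G" for x
    by (rule mem_closed_if_AE_lebesgue[OF closed_closure])
  then have cl: "closure G = UNIV" by blast
  show ?thesis
  proof (rule that)
    show "(2 * C)-lipschitz_on UNIV N" using N(1) by (simp add: cl)
    show "AE x in lborel. u x = N x" using G by eventually_elim (use N(2) in simp)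
  qed
qed

text \<open>By the mean value theorem an increment of a mollification involves mollified derivatives
  at a point near \<open>x\<close>, which are averages of \<open>G1\<close> and \<open>G2\<close>
  close to \<open>x\<close> and hence near \<open>G1 x\<close> and \<open>G2 x\<close>, uniformly in
  small scales. Since \<open>N\<close> is continuous, the mollifications of \<open>u\<close>
  converge to it at every point.\<close>

lemma wderiv_continuous_has_derivative:
  assumes u1: "wderiv 1 u g1" and u2: "wderiv 2 u g2"
    and N: "AE x in lborel. u x = N x" "continuous_on UNIV N"
    and G1: "AE x in lborel. g1 x = G1 x" "continuous_on UNIV G1"
    and G2: "AE x in lborel. g2 x = G2 x" "continuous_on UNIV G2"
  shows "(N has_derivative (\<lambda>v. v$1 * G1 x + v$2 * G2 x)) (at x)"
proof -
  note l = wderiv_locint(1)[OF u1] wderiv_locint(2)[OF u1] wderiv_locint(2)[OF u2]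
  have near: "\<forall>\<^sub>F k in sequentially. \<bar>moll (mscale k) f z - F z\<bar> \<le> \<eta>"
    if h: "locint f" "AE x in lborel. f x = F x" "continuous_on UNIV F" "\<eta> > 0" for f F z \<eta>
  proof -
    obtain \<delta> where \<delta>: "\<delta> > 0" "\<And>y. dist y z < \<delta> \<Longrightarrow> dist (F y) (F z) < \<eta>"
      using h(3,4) unfolding continuous_on_iff by (metis UNIV_I)
    have "\<forall>\<^sub>F k in sequentially. 2 * mscale k < \<delta>"
      using \<delta>(1) tendsto_mult_right_zero[OF mscale_tendsto, of 2] by (intro order_tendstoD(2)) auto
    then show ?thesis
    proof eventually_elim
      case (elim k)
      have "AE y in lborel. norm (z - y) \<le> 2 * mscale k \<longrightarrow> \<bar>f y - F z\<bar> \<le> \<eta>"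
        using h(2)
      proof eventually_elim
        case (elim y)
        then show ?case
          using \<open>2 * mscale k < \<delta>\<close> \<delta>(2)[of y] by (auto simp: dist_norm norm_minus_commute)
      qed
      from moll_near[OF h(1) mscale(1) this] show ?case .
    qed
  qed
  have lim: "(\<lambda>k. moll (mscale k) u z) \<longlonglongrightarrow> N z" for z
  proof (rule LIMSEQ_I)
    fix e :: real assume "e > 0"
    from near[OF l(1) N, of "e/2" z] this
    have "\<forall>\<^sub>F k in sequentially. \<bar>moll (mscale k) u z - N z\<bar> \<le> e/2" by simp
    then have "\<forall>\<^sub>F k in sequentially. norm (moll (mscale k) u z - N z) < e"
      by eventually_elim (use \<open>e > 0\<close> in auto)
    then show "\<exists>no. \<forall>n\<ge>no. norm (moll (mscale n) u z - N z) < e"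
      by (simp add: eventually_sequentially)
  qed
  show ?thesis
    unfolding has_derivative_at_alt
  proof (intro conjI allI impI)
    show "bounded_linear (\<lambda>v. v$1 * G1 x + v$2 * G2 x)"
      by (intro bounded_linear_add bounded_linear_mult_left[THEN bounded_linear_compose] bounded_linear_vec_nth)
    fix e :: real assume e: "e > 0"
    obtain \<delta>1 where \<delta>1: "\<delta>1 > 0" "\<And>y. dist y x < \<delta>1 \<Longrightarrow> dist (G1 y) (G1 x) < e/2"
      using G1(2) e unfolding continuous_on_iff by (metis UNIV_I half_gt_zero)
    obtain \<delta>2 where \<delta>2: "\<delta>2 > 0" "\<And>y. dist y x < \<delta>2 \<Longrightarrow> dist (G2 y) (G2 x) < e/2"
      using G2(2) e unfolding continuous_on_iff by (metis UNIV_I half_gt_zero)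
    define \<delta> where "\<delta> = min \<delta>1 \<delta>2"
    have \<delta>: "\<delta> > 0" using \<delta>1 \<delta>2 by (simp add: \<delta>_def)
    show "\<exists>d>0. \<forall>y. norm (y - x) < d \<longrightarrow>
      norm (N y - N x - ((y - x)$1 * G1 x + (y - x)$2 * G2 x)) \<le> e * norm (y - x)"
    \<comment> \<open>Half of \<open>\<delta>\<close> is for the intermediate point of the mean
      value theorem, the other half for the averaging radius \<open>2 * mscale k\<close>.\<close>
    proof (intro exI[of _ "\<delta>/2"] conjI allI impI)
      show "0 < \<delta>/2" using \<delta> by simp
      fix y assume y: "norm (y - x) < \<delta>/2"
      let ?L = "(y - x)$1 * G1 x + (y - x)$2 * G2 x"
      have "(\<lambda>k. \<bar>moll (mscale k) u y - moll (mscale k) u x - ?L\<bar>) \<longlonglongrightarrow> \<bar>N y - N x - ?L\<bar>"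
        by (intro tendsto_intros lim)
      moreover have "\<forall>\<^sub>F k in sequentially. 2 * mscale k < \<delta>/2"
        using \<delta> tendsto_mult_right_zero[OF mscale_tendsto, of 2] by (intro order_tendstoD(2)[where y = 0]) auto
      then have "\<forall>\<^sub>F k in sequentially. \<bar>moll (mscale k) u y - moll (mscale k) u x - ?L\<bar> \<le> e * norm (y - x)"
      proof eventually_elim
        case (elim k)
        obtain s where s: "0 < s" "s < 1" and e1: "moll (mscale k) u y - moll (mscale k) u x =
           (y - x)$1 * moll (mscale k) g1 (x + s *\<^sub>R (y - x)) + (y - x)$2 * moll (mscale k) g2 (x + s *\<^sub>R (y - x))"
          by (rule moll_mean_value[OF u1 u2])
        define z where "z = x + s *\<^sub>R (y - x)"
        have z: "norm (z - x) < \<delta>/2"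
        proof -
          have "norm (z - x) = s * norm (y - x)" using s by (simp add: z_def)
          also have "\<dots> \<le> norm (y - x)" using s by (simp add: mult_left_le_one_le)
          finally show ?thesis using y by simp
        qed
        have close: "dist w x < \<delta>" if "norm (z - w) \<le> 2 * mscale k" for w
          using that elim z norm_triangle_ineq[of "z - x" "w - z"] by (simp add: dist_norm norm_minus_commute)
        have m1: "\<bar>moll (mscale k) g1 z - G1 x\<bar> \<le> e/2"
        proof (rule moll_near[OF l(2) mscale(1)])
          show "AE w in lborel. norm (z - w) \<le> 2 * mscale k \<longrightarrow> \<bar>g1 w - G1 x\<bar> \<le> e/2"
            using G1(1)
          proof eventually_elim
            case (elim w)
            then show ?case using \<delta>1(2)[of w] close[of w] by (auto simp: \<delta>_def dist_real_def)
          qed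
        qed
        have m2: "\<bar>moll (mscale k) g2 z - G2 x\<bar> \<le> e/2"
        proof (rule moll_near[OF l(3) mscale(1)])
          show "AE w in lborel. norm (z - w) \<le> 2 * mscale k \<longrightarrow> \<bar>g2 w - G2 x\<bar> \<le> e/2"
            using G2(1)
          proof eventually_elim
            case (elim w)
            then show ?case using \<delta>2(2)[of w] close[of w] by (auto simp: \<delta>_def dist_real_def)
          qed
        qed
        have "moll (mscale k) u y - moll (mscale k) u x - ?L
            = (y - x)$1 * (moll (mscale k) g1 z - G1 x) + (y - x)$2 * (moll (mscale k) g2 z - G2 x)"
          unfolding e1 z_def by (simp add: algebra_simps)
        also have "\<bar>\<dots>\<bar> \<le> \<bar>(y - x)$1\<bar> * \<bar>moll (mscale k) g1 z - G1 x\<bar> + \<bar>(y - x)$2\<bar> * \<bar>moll (mscale k) g2 z - G2 x\<bar>"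
          unfolding abs_mult[symmetric] by (rule abs_triangle_ineq)
        also have "\<dots> \<le> norm (y - x) * (e/2) + norm (y - x) * (e/2)"
          by (intro add_mono mult_mono component_le_norm_cart m1 m2) auto
        finally show ?case by simp
      qed
      ultimately have "\<bar>N y - N x - ?L\<bar> \<le> e * norm (y - x)"
        by (rule tendsto_upperbound) simp
      then show "norm (N y - N x - ?L) \<le> e * norm (y - x)" by simp
    qed
  qed
qed

section \<open>The Bogomolny identity\<close>

lemma inner3: "x \<bullet> y = x$1 * y$1 + x$2 * y$2 + x$3 * y$3" for x y :: "real^3"
  by (simp add: inner_vec_def sum_3)

lemma norm3_sq: "(norm x)\<^sup>2 = (x$1)\<^sup>2 + (x$2)\<^sup>2 + (x$3)\<^sup>2" for x :: "real^3"
  unfolding power2_norm_eq_inner inner3 by (simp add: power2_eq_square)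

lemma cross3_nth: "cross3 x y $ 1 = x$2 * y$3 - x$3 * y$2" "cross3 x y $ 2 = x$3 * y$1 - x$1 * y$3"
    "cross3 x y $ 3 = x$1 * y$2 - x$2 * y$1"
  by (simp_all add: cross3_def)

definition jac :: "real^3 \<Rightarrow> real^3 \<Rightarrow> real^3 \<Rightarrow> real" where
  "jac n a b = n \<bullet> cross3 a b"

text \<open>The integrand of the helicity: \<open>a\<close> and \<open>b\<close> stand for the two partial derivatives of \<open>n\<close>.\<close>

definition heldens :: "real^3 \<Rightarrow> real^3 \<Rightarrow> real^3 \<Rightarrow> real" where
  "heldens n a b = (n - e3) \<bullet> vector [b$3, - (a$3), a$2 - b$1]"

definition edens :: "real \<Rightarrow> real^3 \<Rightarrow> real^3 \<Rightarrow> real^3 \<Rightarrow> real" where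
  "edens r n a b = ((norm a)\<^sup>2 + (norm b)\<^sup>2) / 2 + r * heldens n a b + (1 - n$3)\<^sup>2 / 2"

text \<open>For unit \<open>n\<close> this is the tangential field
  \<open>(e_2 - n_2 n) - n x e_1\<close>: its inner product with \<open>a + n x b\<close> is minus
  the helicity density, and its length is \<open>1 - n_3\<close>, so it encodes helicity and
  potential together.\<close>

definition hfield :: "real^3 \<Rightarrow> real^3" where
  "hfield n = vector [- (n$1 * n$2), 1 - n$3 - (n$2)\<^sup>2, n$2 * (1 - n$3)]"

text \<open>For derivatives \<open>a\<close>, \<open>b\<close> of a sphere-valued map, \<open>conf 1\<close> and \<open>conf (-1)\<close> are the two Cauchy-Riemann
  operators; \<open>bdefect r = 0\<close> is the Bogomolny equation of the rescaled critical energy.\<close>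

definition conf :: "real \<Rightarrow> real^3 \<Rightarrow> real^3 \<Rightarrow> real^3 \<Rightarrow> real^3" where
  "conf \<sigma> n a b = a + \<sigma> *\<^sub>R cross3 n b"

definition bdefect :: "real \<Rightarrow> real^3 \<Rightarrow> real^3 \<Rightarrow> real^3 \<Rightarrow> real^3" where
  "bdefect r n a b = r *\<^sub>R conf 1 n a b - hfield n"

lemma jac_eq: "jac n a b = n$1 * (a$2 * b$3 - a$3 * b$2) + n$2 * (a$3 * b$1 - a$1 * b$3) + n$3 * (a$1 * b$2 - a$2 * b$1)"
  by (simp add: jac_def inner3 cross3_nth)

lemma heldens_eq: "heldens n a b = n$1 * b$3 - n$2 * a$3 + (n$3 - 1) * (a$2 - b$1)"
  by (simp add: heldens_def inner3 e3_def axis_def algebra_simps)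

lemma hfield_nth: "hfield n $ 1 = - (n$1 * n$2)" "hfield n $ 2 = 1 - n$3 - (n$2)\<^sup>2" "hfield n $ 3 = n$2 * (1 - n$3)"
  by (simp_all add: hfield_def)

lemma conf_nth: "conf \<sigma> n a b $ 1 = a$1 + \<sigma> * (n$2 * b$3 - n$3 * b$2)"
    "conf \<sigma> n a b $ 2 = a$2 + \<sigma> * (n$3 * b$1 - n$1 * b$3)"
    "conf \<sigma> n a b $ 3 = a$3 + \<sigma> * (n$1 * b$2 - n$2 * b$1)"
  by (simp_all add: conf_def cross3_nth)

lemma norm_hfield:
  assumes "norm n = 1" shows "(norm (hfield n))\<^sup>2 = (1 - n$3)\<^sup>2"
proof -
  have "(n$1)\<^sup>2 + (n$2)\<^sup>2 + (n$3)\<^sup>2 = 1" using norm3_sq[of n] assms by simp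
  then show ?thesis unfolding norm3_sq hfield_nth by algebra
qed

text \<open>Since \<open>b\<close> is tangential, \<open>n x b\<close> has the length of
  \<open>b\<close>, and the mixed term is \<open>a . (n x b) = - n . (a x b)\<close>.\<close>

lemma norm_conf:
  assumes "norm n = 1" "n \<bullet> a = 0" "n \<bullet> b = 0" "\<sigma>\<^sup>2 = 1"
  shows "(norm (conf \<sigma> n a b))\<^sup>2 = (norm a)\<^sup>2 + (norm b)\<^sup>2 - 2 * \<sigma> * jac n a b"
proof -
  have "(n$1)\<^sup>2 + (n$2)\<^sup>2 + (n$3)\<^sup>2 = 1" using norm3_sq[of n] assms by simp
  moreover have "n$1 * b$1 + n$2 * b$2 + n$3 * b$3 = 0" using assms(3) by (simp add: inner3)
  ultimately show ?thesis using assms(4) unfolding norm3_sq conf_nth jac_eq by algebra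
qed

lemma conf_inner_hfield:
  assumes "norm n = 1" "n \<bullet> a = 0" "n \<bullet> b = 0"
  shows "conf 1 n a b \<bullet> hfield n = - heldens n a b"
proof -
  have "(n$1)\<^sup>2 + (n$2)\<^sup>2 + (n$3)\<^sup>2 = 1" using norm3_sq[of n] assms by simp
  moreover have "n$1 * b$1 + n$2 * b$2 + n$3 * b$3 = 0" "n$1 * a$1 + n$2 * a$2 + n$3 * a$3 = 0"
    using assms(2,3) by (simp_all add: inner3)
  ultimately show ?thesis unfolding inner3 conf_nth hfield_nth heldens_eq by algebra
qed

text \<open>Half the second square expands to
  \<open>r^2/2 |conf 1|^2 + r heldens + (1 - n_3)^2 / 2\<close>. By \<open>norm_conf\<close> the
  gradient terms then have total weight \<open>(1 - r^2) + r^2 = 1\<close>, and each square leaves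
  its own multiple of \<open>jac\<close>.\<close>

lemma bogomolny_identity:
  assumes "norm n = 1" "n \<bullet> a = 0" "n \<bullet> b = 0" "\<sigma>\<^sup>2 = 1"
  shows "edens r n a b = (1 - r\<^sup>2) / 2 * (norm (conf \<sigma> n a b))\<^sup>2
     + (norm (bdefect r n a b))\<^sup>2 / 2 + (\<sigma> * (1 - r\<^sup>2) + r\<^sup>2) * jac n a b"
proof -
  have "(norm (bdefect r n a b))\<^sup>2
     = r\<^sup>2 * (norm (conf 1 n a b))\<^sup>2 - 2 * r * (conf 1 n a b \<bullet> hfield n) + (norm (hfield n))\<^sup>2"
    unfolding power2_norm_eq_inner bdefect_def by (simp add: algebra_simps inner_commute power2_eq_square)
  then show ?thesis
    using conf_inner_hfield[OF assms(1-3)] norm_hfield[OF assms(1)] norm_conf[OF assms] norm_conf[OF assms(1-3), of 1]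
    by (simp add: edens_def) (simp add: field_simps power2_eq_square)
qed

text \<open>Serves twice: it makes the second square integrable for finite energy, and it shows that
  this square is small on a shrinking bubble.\<close>

lemma bdefect_le:
  assumes "norm n = 1" "0 \<le> r"
  shows "(norm (bdefect r n a b))\<^sup>2 \<le> 2 * r\<^sup>2 * (norm (conf 1 n a b))\<^sup>2 + 2 * (1 - n$3)\<^sup>2"
proof -
  let ?c = "conf 1 n a b"
  have "(norm (bdefect r n a b))\<^sup>2 \<le> (r * norm ?c + norm (hfield n))\<^sup>2"
    unfolding bdefect_def using norm_triangle_ineq4[of "r *\<^sub>R ?c" "hfield n"] assms(2)
    by (intro power_mono) auto
  also have "\<dots> \<le> 2 * (r * norm ?c)\<^sup>2 + 2 * (norm (hfield n))\<^sup>2"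
    using sum_squares_bound[of "r * norm ?c" "norm (hfield n)"] by (simp add: power2_sum)
  finally show ?thesis by (simp add: norm_hfield[OF assms(1)] power_mult_distrib)
qed

lemma abs_jac_le:
  assumes "norm n = 1"
  shows "\<bar>jac n a b\<bar> \<le> ((norm a)\<^sup>2 + (norm b)\<^sup>2) / 2"
proof -
  have "\<bar>jac n a b\<bar> \<le> norm (cross3 a b)"
    using Cauchy_Schwarz_ineq2[of n "cross3 a b"] assms by (simp add: jac_def)
  also have "\<dots> \<le> norm a * norm b"
    by (rule power2_le_imp_le) (use norm_cross[of a b] in \<open>auto simp: power_mult_distrib\<close>)
  also have "\<dots> \<le> ((norm a)\<^sup>2 + (norm b)\<^sup>2) / 2"
    using sum_squares_bound[of "norm a" "norm b"] by simp
  finally show ?thesis .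
qed

text \<open>Weak gradients are given with Lebesgue measurability only, whereas the mollification
  theory works with Borel functions. Each component is replaced by a Borel representative, which
  changes none of the defining integrals.\<close>

lemma weak_grad_components:
  assumes w: "is_weak_grad n g" and n1: "\<And>x. norm (n x) = 1"
  shows "\<exists>u \<gamma>. (\<forall>j x. \<bar>u j x\<bar> \<le> 1) \<and> (\<forall>j. AE x in lborel. n x $ j = u j x) \<and>
    (\<forall>i j. AE x in lborel. g i x $ j = \<gamma> i j x) \<and> (\<forall>i j. wderiv i (u j) (\<gamma> i j))"
proof -
  have nm: "(\<lambda>x. n x $ j) \<in> borel_measurable lebesgue" for j
  proof -
    have "(\<lambda>x. n x \<bullet> axis j 1) \<in> borel_measurable lebesgue"
      using w by (intro borel_measurable_inner borel_measurable_const) (auto simp: is_weak_grad_def)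
    then show ?thesis by (simp add: inner_axis)
  qed
  have gm: "(\<lambda>x. g i x $ j) \<in> borel_measurable lebesgue" for i j
  proof -
    have "(\<lambda>x. g i x \<bullet> axis j 1) \<in> borel_measurable lebesgue"
      using w by (intro borel_measurable_inner borel_measurable_const) (auto simp: is_weak_grad_def)
    then show ?thesis by (simp add: inner_axis)
  qed
  have "\<exists>v. v \<in> borel_measurable borel \<and> (AE x in lborel. n x $ j = v x)" for j
    using completion_ex_borel_measurable_real[OF nm] by auto
  then obtain v where v: "\<And>j. v j \<in> borel_measurable borel" "\<And>j. AE x in lborel. n x $ j = v j x"
    by metis
  have "\<exists>v. v \<in> borel_measurable borel \<and> (AE x in lborel. g i x $ j = v x)" for i j
    using completion_ex_borel_measurable_real[OF gm] by auto
  then obtain \<gamma> where \<gamma>: "\<And>i j. \<gamma> i j \<in> borel_measurable borel" "\<And>i j. AE x in lborel. g i x $ j = \<gamma> i j x"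
    by metis
  \<comment> \<open>Clipping changes the representative only on a null set, because \<open>n\<close>
    has unit length, and makes the bound hold at every point, as \<open>wderiv_square\<close>
    demands.\<close>
  define u where "u j x = max (-1) (min 1 (v j x))" for j x
  note [measurable] = v(1) \<gamma>(1)
  have um [measurable]: "u j \<in> borel_measurable borel" for j unfolding u_def by measurable
  have ub: "\<bar>u j x\<bar> \<le> 1" for j x by (auto simp: u_def)
  have un: "AE x in lborel. n x $ j = u j x" for j
    using v(2)[of j]
  proof eventually_elim
    case (elim x)
    have "\<bar>n x $ j\<bar> \<le> 1" using component_le_norm_cart[of "n x" j] n1 by simp
    with elim show ?case by (auto simp: u_def)
  qed
  have "wderiv i (u j) (\<gamma> i j)" for i j
    unfolding wderiv_def
  proof (intro conjI allI impI)
    show lu: "locint (u j)" by (rule locint_bounded[OF um ub])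
    show lg: "locint (\<gamma> i j)"
      unfolding locint_def
    proof (intro conjI allI \<gamma>(1))
      fix R
      have "integrable lebesgue (\<lambda>x. indicator (cball 0 R) x * (norm (g i x))\<^sup>2)"
        using w by (auto simp: is_weak_grad_def set_integrable_def)
      then have "integrable lebesgue (\<lambda>x. indicator (cball 0 R) x * (\<gamma> i j x)\<^sup>2)"
      proof (rule Bochner_Integration.integrable_bound)
        show "(\<lambda>x. indicator (cball 0 R) x * (\<gamma> i j x)\<^sup>2) \<in> borel_measurable lebesgue"
          by (intro measurable_completion) measurable
        show "AE x in lebesgue. norm (indicator (cball 0 R) x * (\<gamma> i j x)\<^sup>2) \<le> norm (indicator (cball 0 R) x * (norm (g i x))\<^sup>2)"
          using AE_completion[OF \<gamma>(2)[of i j]]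
        proof eventually_elim
          case (elim x)
          have "(\<gamma> i j x)\<^sup>2 \<le> (norm (g i x))\<^sup>2"
            using component_le_norm_cart[of "g i x" j] elim abs_le_square_iff[of "\<gamma> i j x" "norm (g i x)"] by simp
          then show ?case by (simp add: indicator_def)
        qed
      qed
      then have "integrable lborel (\<lambda>x. indicator (cball 0 R) x * (\<gamma> i j x)\<^sup>2)"
        by (subst (asm) integrable_completion) measurable
      \<comment> \<open>Local square integrability implies local integrability through
        \<open>\<bar>\<gamma>\<bar> \<le> 1 + \<gamma>^2\<close> on the ball.\<close>
      then have "integrable lborel (\<lambda>x. indicator (cball 0 R) x * 1 + indicator (cball 0 R) x * (\<gamma> i j x)\<^sup>2)"
        using integrable_indicator_cball[of "0::real^2" R 1] by (intro Bochner_Integration.integrable_add) auto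
      then show "integrable lborel (\<lambda>x. indicator (cball 0 R) x * \<gamma> i j x)"
      proof (rule Bochner_Integration.integrable_bound)
        show "AE x in lborel. norm (indicator (cball 0 R) x * \<gamma> i j x)
          \<le> norm (indicator (cball 0 R) x * 1 + indicator (cball 0 R) x * (\<gamma> i j x)\<^sup>2)"
        proof (rule AE_I2)
          fix x
          have "2 * \<bar>\<gamma> i j x\<bar> \<le> 1 + (\<gamma> i j x)\<^sup>2" using sum_squares_bound[of 1 "\<bar>\<gamma> i j x\<bar>"] by simp
          then have "\<bar>\<gamma> i j x\<bar> \<le> 1 + (\<gamma> i j x)\<^sup>2" by linarith
          then show "norm (indicator (cball 0 R) x * \<gamma> i j x)
            \<le> norm (indicator (cball 0 R) x * 1 + indicator (cball 0 R) x * (\<gamma> i j x)\<^sup>2)"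
            by (simp add: indicator_def)
        qed
      qed measurable
    qed
    fix \<phi> assume t: "test_fun \<phi>"
    note tm [measurable] = test_fun_borel[OF t]
    have tm': "\<phi> \<in> borel_measurable lebesgue" "pd \<phi> i \<in> borel_measurable lebesgue"
      "u j \<in> borel_measurable lebesgue" "\<gamma> i j \<in> borel_measurable lebesgue"
      using tm um \<gamma>(1) by (auto intro!: measurable_completion)
    have "(LINT x|lborel. u j x * pd \<phi> i x) = (LINT x|lebesgue. u j x * pd \<phi> i x)"
      by (rule integral_completion[symmetric]) measurable
    also have "\<dots> = (LINT x|lebesgue. n x $ j * pd \<phi> i x)"
      using AE_completion[OF un[of j]] by (intro integral_cong_AE borel_measurable_times tm' nm) (auto elim: eventually_mono)
    also have "\<dots> = - (LINT x|lebesgue. g i x $ j * \<phi> x)" using w t by (auto simp: is_weak_grad_def)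
    also have "(LINT x|lebesgue. g i x $ j * \<phi> x) = (LINT x|lebesgue. \<gamma> i j x * \<phi> x)"
      using AE_completion[OF \<gamma>(2)[of i j]] by (intro integral_cong_AE borel_measurable_times tm' gm) (auto elim: eventually_mono)
    also have "\<dots> = (LINT x|lborel. \<gamma> i j x * \<phi> x)"
      by (rule integral_completion) measurable
    finally show "(LINT x|lborel. u j x * pd \<phi> i x) = - (LINT x|lborel. \<gamma> i j x * \<phi> x)" .
  qed
  with ub un \<gamma>(2) show ?thesis by blast
qed

text \<open>Connects the gradient selected by \<open>grad\<close> with any explicitly known weak
  gradient.\<close>

lemma weak_grad_unique:
  assumes "is_weak_grad n g" "is_weak_grad n h" and n1: "\<And>x. norm (n x) = 1"
  shows "AE x in lebesgue. g i x = h i x"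
proof -
  obtain u \<gamma> where u: "\<And>j. AE x in lborel. n x $ j = u j x"
    "\<And>i j. AE x in lborel. g i x $ j = \<gamma> i j x" "\<And>i j. wderiv i (u j) (\<gamma> i j)"
    using weak_grad_components[OF assms(1) n1] by blast
  obtain v \<eta> where v: "\<And>j. AE x in lborel. n x $ j = v j x"
    "\<And>i j. AE x in lborel. h i x $ j = \<eta> i j x" "\<And>i j. wderiv i (v j) (\<eta> i j)"
    using weak_grad_components[OF assms(2) n1] by blast
  have "AE x in lborel. g i x $ j = h i x $ j" for j
  proof -
    have "AE x in lborel. u j x = v j x" using u(1)[of j] v(1)[of j] by eventually_elim simp
    from wderiv_unique[OF u(3) v(3) this, of i] u(2)[of i j] v(2)[of i j]
    show ?thesis by eventually_elim simp
  qed
  from this[of 1] this[of 2] this[of 3] have "AE x in lborel. g i x = h i x"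
    by eventually_elim (simp add: vec_eq_iff forall_3)
  then show ?thesis by (rule AE_completion)
qed

text \<open>The sum of the squared components is the constant 1, whose weak derivative is zero; by
  \<open>wderiv_square\<close> this derivative is also \<open>2 n . g i\<close>.\<close>

lemma weak_grad_orthogonal:
  assumes w: "is_weak_grad n g" and n1: "\<And>x. norm (n x) = 1"
  shows "AE x in lebesgue. n x \<bullet> g i x = 0"
proof -
  obtain u \<gamma> where ub: "\<And>j x. \<bar>u j x\<bar> \<le> 1" and un: "\<And>j. AE x in lborel. n x $ j = u j x"
    and ug: "\<And>i j. AE x in lborel. g i x $ j = \<gamma> i j x" and uw: "\<And>i j. wderiv i (u j) (\<gamma> i j)"
    using weak_grad_components[OF w n1] by blast
  note sq = wderiv_square[where u = "u j" and g = "\<lambda>i. \<gamma> i j" and B = 1 for j, OF uw ub]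
  have "AE x in lborel. 2 * u 1 x * \<gamma> i 1 x + 2 * u 2 x * \<gamma> i 2 x + 2 * u 3 x * \<gamma> i 3 x = 0"
  proof (rule wderiv_unique[OF wderiv_add[OF wderiv_add[OF sq sq] sq] wderiv_const])
    show "AE x in lborel. (u 1 x)\<^sup>2 + (u 2 x)\<^sup>2 + (u 3 x)\<^sup>2 = 1"
      using un[of 1] un[of 2] un[of 3]
    proof eventually_elim
      case (elim x)
      then show ?case using norm3_sq[of "n x"] n1 by simp
    qed
  qed
  then have "AE x in lborel. n x \<bullet> g i x = 0"
    using un[of 1] un[of 2] un[of 3] ug[of i 1] ug[of i 2] ug[of i 3]
    by eventually_elim (simp add: inner3)
  then show ?thesis by (rule AE_completion)
qed

section \<open>The energy as weighted squares plus a topological term, and the equality case\<close>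

lemma lebesgue_component:
  fixes f :: "'a::euclidean_space \<Rightarrow> real^'n"
  assumes "f \<in> borel_measurable lebesgue"
  shows "(\<lambda>x. f x $ j) \<in> borel_measurable lebesgue"
proof -
  have "(\<lambda>x. f x \<bullet> axis j 1) \<in> borel_measurable lebesgue"
    using assms by (intro borel_measurable_inner borel_measurable_const)
  then show ?thesis by (simp add: inner_axis)
qed

text \<open>Stated for an arbitrary weak gradient \<open>g\<close> in place of
  \<open>grad n\<close>, so that explicit maps can be evaluated with their classical
  derivatives.\<close>

lemma energy_formula:
  assumes w: "is_weak_grad n g" and n1: "\<And>x. norm (n x) = 1"
    and D: "integrable lebesgue (\<lambda>x. (norm (g 1 x))\<^sup>2 + (norm (g 2 x))\<^sup>2)"
    and V: "integrable lebesgue (\<lambda>x. (1 - n x $ 3)\<^sup>2)"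
    and r: "0 < r" and \<sigma>: "\<sigma>\<^sup>2 = 1"
  shows "n \<in> Mspace"
    and "degree n = 1 / (4 * pi) * (LINT x|lebesgue. jac (n x) (g 1 x) (g 2 x))"
    and "integrable lebesgue (\<lambda>x. (norm (conf \<sigma> (n x) (g 1 x) (g 2 x)))\<^sup>2)"
    and "integrable lebesgue (\<lambda>x. (norm (bdefect r (n x) (g 1 x) (g 2 x)))\<^sup>2)"
    and "Energy r n = (1 - r\<^sup>2) / 2 * (LINT x|lebesgue. (norm (conf \<sigma> (n x) (g 1 x) (g 2 x)))\<^sup>2)
      + (LINT x|lebesgue. (norm (bdefect r (n x) (g 1 x) (g 2 x)))\<^sup>2) / 2
      + (\<sigma> * (1 - r\<^sup>2) + r\<^sup>2) * (4 * pi * degree n)"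
    and "Energy r n = (LINT x|lebesgue. edens r (n x) (g 1 x) (g 2 x))"
proof -
  have wg: "is_weak_grad n (grad n)" unfolding grad_def using w by (rule someI[of "is_weak_grad n"])
  note un = weak_grad_unique[OF wg w n1]
  have [measurable]: "(\<lambda>x. n x $ j) \<in> borel_measurable lebesgue" "(\<lambda>x. g i x $ j) \<in> borel_measurable lebesgue"
     "(\<lambda>x. grad n i x $ j) \<in> borel_measurable lebesgue" for i j
    using w wg by (auto simp: is_weak_grad_def intro!: lebesgue_component)
  let ?a = "g 1" and ?b = "g 2"
  define J where "J x = jac (n x) (?a x) (?b x)" for x
  define E1 where "E1 s x = (norm (conf s (n x) (?a x) (?b x)))\<^sup>2" for s x
  define E2 where "E2 x = (norm (bdefect r (n x) (?a x) (?b x)))\<^sup>2" for x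
  have mJ [measurable]: "J \<in> borel_measurable lebesgue" unfolding J_def jac_eq by measurable
  have mE1 [measurable]: "E1 s \<in> borel_measurable lebesgue" for s
    unfolding E1_def norm3_sq conf_nth by measurable
  have mE2 [measurable]: "E2 \<in> borel_measurable lebesgue"
    unfolding E2_def bdefect_def norm3_sq vector_minus_component vector_scaleR_component conf_nth hfield_nth by measurable
  have orth: "AE x in lebesgue. n x \<bullet> ?a x = 0 \<and> n x \<bullet> ?b x = 0"
    using weak_grad_orthogonal[OF w n1, of 1] weak_grad_orthogonal[OF w n1, of 2] by eventually_elim simp
  have iJ: "integrable lebesgue J"
  proof (rule Bochner_Integration.integrable_bound[OF D mJ], rule AE_I2)
    fix x
    show "norm (J x) \<le> norm ((norm (?a x))\<^sup>2 + (norm (?b x))\<^sup>2)"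
      using abs_jac_le[OF n1, of x "?a x" "?b x"] by (simp add: J_def)
  qed
  have iE1: "integrable lebesgue (E1 s)" if s: "s\<^sup>2 = 1" for s
  proof -
    have "integrable lebesgue (\<lambda>x. ((norm (?a x))\<^sup>2 + (norm (?b x))\<^sup>2) - 2 * s * J x)"
      using D iJ by simp
    then show ?thesis
    proof (rule integrable_cong_AE_imp[OF _ mE1])
      show "AE x in lebesgue. (norm (?a x))\<^sup>2 + (norm (?b x))\<^sup>2 - 2 * s * J x = E1 s x"
        using orth by eventually_elim (simp add: E1_def J_def norm_conf[OF n1 _ _ s])
    qed
  qed
  have iE2: "integrable lebesgue E2"
  proof (rule Bochner_Integration.integrable_bound)
    show "integrable lebesgue (\<lambda>x. 2 * r\<^sup>2 * E1 1 x + 2 * (1 - n x $ 3)\<^sup>2)"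
      using iE1[of 1] V by simp
    show "AE x in lebesgue. norm (E2 x) \<le> norm (2 * r\<^sup>2 * E1 1 x + 2 * (1 - n x $ 3)\<^sup>2)"
      using bdefect_le[OF n1, of r] r by (intro AE_I2) (simp add: E1_def E2_def)
  qed measurable
  define e where "e x = edens r (n x) (?a x) (?b x)" for x
  have me [measurable]: "e \<in> borel_measurable lebesgue"
    unfolding e_def edens_def norm3_sq heldens_eq by measurable
  have ae: "AE x in lebesgue. (1 - r\<^sup>2) / 2 * E1 \<sigma> x + E2 x / 2 + (\<sigma> * (1 - r\<^sup>2) + r\<^sup>2) * J x = e x"
    using orth by eventually_elim (simp add: E1_def E2_def J_def e_def bogomolny_identity[OF n1 _ _ \<sigma>])
  have i0: "integrable lebesgue (\<lambda>x. (1 - r\<^sup>2) / 2 * E1 \<sigma> x + E2 x / 2 + (\<sigma> * (1 - r\<^sup>2) + r\<^sup>2) * J x)"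
    using iE1[OF \<sigma>] iE2 iJ by simp
  have ie: "integrable lebesgue e" by (rule integrable_cong_AE_imp[OF i0 me ae])
  define h where "h x = heldens (n x) (?a x) (?b x)" for x
  \<comment> \<open>No separate estimate of the helicity is made: the full density is integrable by
    the pointwise identity, and subtracting the Dirichlet and potential densities leaves the
    helicity density.\<close>
  have ih: "integrable lebesgue (\<lambda>x. r * h x)"
  proof -
    have "(\<lambda>x. r * h x) = (\<lambda>x. e x - ((norm (?a x))\<^sup>2 + (norm (?b x))\<^sup>2) / 2 - (1 - n x $ 3)\<^sup>2 / 2)"
      by (auto simp: e_def h_def edens_def)
    then show ?thesis using ie D V by simp
  qed
  have Dir_eq: "Dir n = (1/2) * (LINT x|lebesgue. (norm (?a x))\<^sup>2 + (norm (?b x))\<^sup>2)"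
  proof -
    have "(LINT x|lebesgue. gradsq n x) = (LINT x|lebesgue. (norm (?a x))\<^sup>2 + (norm (?b x))\<^sup>2)"
    proof (rule integral_cong_AE)
      show "AE x in lebesgue. gradsq n x = (norm (?a x))\<^sup>2 + (norm (?b x))\<^sup>2"
        using un[of 1] un[of 2] by eventually_elim (simp add: gradsq_def)
    qed (unfold gradsq_def norm3_sq, measurable)
    then show ?thesis by (simp add: Dir_def)
  qed
  have Hel_eq: "Hel n = (LINT x|lebesgue. h x)"
    unfolding Hel_def
  proof (rule integral_cong_AE)
    have curl: "(n x - e3) \<bullet> curl n x = heldens (n x) (grad n 1 x) (grad n 2 x)" for x
      by (simp add: heldens_def curl_def)
    show "AE x in lebesgue. (n x - e3) \<bullet> curl n x = h x"
      unfolding curl using un[of 1] un[of 2] by eventually_elim (simp add: h_def)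
    show "(\<lambda>x. (n x - e3) \<bullet> curl n x) \<in> borel_measurable lebesgue"
      unfolding curl heldens_eq by measurable
    show "h \<in> borel_measurable lebesgue" unfolding h_def heldens_eq by measurable
  qed
  show dg: "degree n = 1 / (4 * pi) * (LINT x|lebesgue. jac (n x) (g 1 x) (g 2 x))"
  proof -
    have "(LINT x|lebesgue. n x \<bullet> cross3 (grad n 1 x) (grad n 2 x)) = (LINT x|lebesgue. J x)"
      unfolding jac_def[symmetric]
    proof (rule integral_cong_AE)
      show "AE x in lebesgue. jac (n x) (grad n 1 x) (grad n 2 x) = J x"
        using un[of 1] un[of 2] by eventually_elim (simp add: J_def)
    qed (unfold jac_eq, measurable)
    then show ?thesis by (simp add: degree_def J_def)
  qed
  show "n \<in> Mspace"
  proof -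
    have "integrable lebesgue (gradsq n)"
      using D
    proof (rule integrable_cong_AE_imp)
      show "gradsq n \<in> borel_measurable lebesgue" unfolding gradsq_def norm3_sq by measurable
      show "AE x in lebesgue. (norm (?a x))\<^sup>2 + (norm (?b x))\<^sup>2 = gradsq n x"
        using un[of 1] un[of 2] by eventually_elim (simp add: gradsq_def)
    qed
    then show ?thesis using n1 w V by (auto simp: Mspace_def)
  qed
  show "integrable lebesgue (\<lambda>x. (norm (conf \<sigma> (n x) (g 1 x) (g 2 x)))\<^sup>2)"
    using iE1[OF \<sigma>] by (simp add: E1_def[abs_def])
  show "integrable lebesgue (\<lambda>x. (norm (bdefect r (n x) (g 1 x) (g 2 x)))\<^sup>2)"
    using iE2 by (simp add: E2_def[abs_def])
  have "(LINT x|lebesgue. e x) = (LINT x|lebesgue. ((norm (?a x))\<^sup>2 + (norm (?b x))\<^sup>2) / 2 + r * h x + (1 - n x $ 3)\<^sup>2 / 2)"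
    by (simp add: e_def h_def edens_def)
  also have "\<dots> = Energy r n"
    using D V ih by (simp add: Energy_def Dir_eq Hel_eq Vpot_def)
  finally have Ee: "Energy r n = (LINT x|lebesgue. e x)" by simp
  then show "Energy r n = (LINT x|lebesgue. edens r (n x) (g 1 x) (g 2 x))" by (simp add: e_def)
  have "Energy r n = (LINT x|lebesgue. e x)" by (rule Ee)
  also have "\<dots> = (LINT x|lebesgue. (1 - r\<^sup>2) / 2 * E1 \<sigma> x + E2 x / 2 + (\<sigma> * (1 - r\<^sup>2) + r\<^sup>2) * J x)"
    using ae by (intro integral_cong_AE) (auto elim: eventually_mono)
  also have "\<dots> = (1 - r\<^sup>2) / 2 * (LINT x|lebesgue. E1 \<sigma> x) + (LINT x|lebesgue. E2 x) / 2
      + (\<sigma> * (1 - r\<^sup>2) + r\<^sup>2) * (LINT x|lebesgue. J x)"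
    using iE1[OF \<sigma>] iE2 iJ by simp
  also have "(LINT x|lebesgue. J x) = 4 * pi * degree n"
    unfolding dg J_def by simp
  finally show "Energy r n = (1 - r\<^sup>2) / 2 * (LINT x|lebesgue. (norm (conf \<sigma> (n x) (g 1 x) (g 2 x)))\<^sup>2)
      + (LINT x|lebesgue. (norm (bdefect r (n x) (g 1 x) (g 2 x)))\<^sup>2) / 2
      + (\<sigma> * (1 - r\<^sup>2) + r\<^sup>2) * (4 * pi * degree n)"
    by (simp add: E1_def E2_def)
qed

lemma MspaceD:
  assumes "n \<in> Mspace"
  shows "is_weak_grad n (grad n)" "\<And>x. norm (n x) = 1"
    "integrable lebesgue (\<lambda>x. (norm (grad n 1 x))\<^sup>2 + (norm (grad n 2 x))\<^sup>2)"
    "integrable lebesgue (\<lambda>x. (1 - n x $ 3)\<^sup>2)"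
proof -
  show "is_weak_grad n (grad n)"
    unfolding grad_def using assms by (auto simp: Mspace_def intro: someI[of "is_weak_grad n"])
qed (use assms in \<open>auto simp: Mspace_def gradsq_def[abs_def]\<close>)

lemma energy_lower_bound:
  assumes n: "n \<in> Mspace" and r: "0 < r" "r < 1" and \<sigma>: "\<sigma>\<^sup>2 = 1"
  shows "(\<sigma> * (1 - r\<^sup>2) + r\<^sup>2) * (4 * pi * degree n) \<le> Energy r n"
proof -
  have "r\<^sup>2 < 1" using r by (simp add: power_less_one_iff)
  then have "0 \<le> (1 - r\<^sup>2) / 2 * (LINT x|lebesgue. (norm (conf \<sigma> (n x) (grad n 1 x) (grad n 2 x)))\<^sup>2)"
    by (intro mult_nonneg_nonneg integral_nonneg_AE) auto
  moreover have "0 \<le> (LINT x|lebesgue. (norm (bdefect r (n x) (grad n 1 x) (grad n 2 x)))\<^sup>2) / 2"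
    by (intro divide_nonneg_pos integral_nonneg_AE) auto
  ultimately show ?thesis
    using energy_formula(5)[OF MspaceD[OF n] r(1) \<sigma>] by linarith
qed

text \<open>For \<open>r < 1\<close> both squares carry a positive weight, so attaining the bound
  annihilates both integrals and hence both integrands almost everywhere.\<close>

lemma energy_equality:
  assumes n: "n \<in> Mspace" and r: "0 < r" "r < 1" and \<sigma>: "\<sigma>\<^sup>2 = 1"
    and le: "Energy r n \<le> (\<sigma> * (1 - r\<^sup>2) + r\<^sup>2) * (4 * pi * degree n)"
  shows "AE x in lebesgue. conf \<sigma> (n x) (grad n 1 x) (grad n 2 x) = 0 \<and>
    r *\<^sub>R conf 1 (n x) (grad n 1 x) (grad n 2 x) = hfield (n x)"
proof -
  note ef = energy_formula[OF MspaceD[OF n] r(1) \<sigma>]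
  have r2: "r\<^sup>2 < 1" using r by (simp add: power_less_one_iff)
  let ?I1 = "LINT x|lebesgue. (norm (conf \<sigma> (n x) (grad n 1 x) (grad n 2 x)))\<^sup>2"
  let ?I2 = "LINT x|lebesgue. (norm (bdefect r (n x) (grad n 1 x) (grad n 2 x)))\<^sup>2"
  have nn: "?I1 \<ge> 0" "?I2 \<ge> 0" by (intro integral_nonneg_AE; simp)+
  have s: "(1 - r\<^sup>2) / 2 * ?I1 + ?I2 / 2 \<le> 0" using ef(5) le by linarith
  have "(1 - r\<^sup>2) / 2 * ?I1 \<ge> 0" using nn r2 by simp
  with s nn have "?I2 = 0" "(1 - r\<^sup>2) / 2 * ?I1 = 0" by linarith+
  then have "?I1 = 0" "?I2 = 0" using r2 by auto
  then have "AE x in lebesgue. (norm (conf \<sigma> (n x) (grad n 1 x) (grad n 2 x)))\<^sup>2 = 0"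
    "AE x in lebesgue. (norm (bdefect r (n x) (grad n 1 x) (grad n 2 x)))\<^sup>2 = 0"
    using integral_nonneg_eq_0_iff_AE[OF ef(3)] integral_nonneg_eq_0_iff_AE[OF ef(4)] by simp_all
  then show ?thesis by eventually_elim (simp add: bdefect_def)
qed

lemma hfield_eq_0:
  assumes "norm n = 1" "hfield n = 0" shows "n = e3"
proof -
  have 3: "n$3 = 1" using norm_hfield[OF assms(1)] assms(2) by simp
  have "(n$1)\<^sup>2 + (n$2)\<^sup>2 + (n$3)\<^sup>2 = 1" using norm3_sq[of n] assms by simp
  then have "(n$1)\<^sup>2 + (n$2)\<^sup>2 = 0" using 3 by simp
  then have "n$1 = 0" "n$2 = 0" by (auto simp: sum_power2_eq_zero_iff)
  with 3 show ?thesis by (simp add: vec_eq_iff forall_3 e3_def axis_def)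
qed

lemma energy_equality_pos:
  assumes n: "n \<in> Mspace" and r: "0 < r" "r < 1"
    and le: "Energy r n \<le> 4 * pi * degree n"
  shows "AE x in lebesgue. n x = e3"
proof -
  have "AE x in lebesgue. conf 1 (n x) (grad n 1 x) (grad n 2 x) = 0 \<and>
    r *\<^sub>R conf 1 (n x) (grad n 1 x) (grad n 2 x) = hfield (n x)"
    by (rule energy_equality[OF n r]) (use le in auto)
  then show ?thesis
    by eventually_elim (metis MspaceD(2)[OF n] hfield_eq_0 scaleR_zero_right)
qed

text \<open>A bootstrap: \<open>F\<close> is bounded on the compact sphere, so the components have
  bounded weak derivatives and Lipschitz representatives; then \<open>F\<close> composed with these
  is continuous, and the weak derivatives become classical.\<close>

lemma weak_grad_regular:
  assumes w: "is_weak_grad n g" and n1: "\<And>x. norm (n x) = 1"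
    and g: "\<And>i. AE x in lebesgue. g i x = F i (n x)" and F: "\<And>i. continuous_on UNIV (F i)"
  shows "\<exists>N. (\<forall>x. norm (N x) = 1) \<and> (AE x in lebesgue. n x = N x) \<and>
    (\<forall>x j. ((\<lambda>x. N x $ j) has_derivative (\<lambda>v. v$1 * F 1 (N x) $ j + v$2 * F 2 (N x) $ j)) (at x))"
proof -
  obtain u \<gamma> where un: "\<And>j. AE x in lborel. n x $ j = u j x"
    and ug: "\<And>i j. AE x in lborel. g i x $ j = \<gamma> i j x" and uw: "\<And>i j. wderiv i (u j) (\<gamma> i j)"
    using weak_grad_components[OF w n1] by blast
  have "\<exists>C. \<forall>y. norm y = 1 \<longrightarrow> norm (F i y) \<le> C" for i
  proof -
    have "compact (F i ` sphere 0 1)"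
      by (intro compact_continuous_image continuous_on_subset[OF F]) auto
    from compact_imp_bounded[OF this] obtain c where "\<forall>y\<in>sphere 0 1. norm (F i y) \<le> c"
      by (auto simp: bounded_iff)
    then show ?thesis by (intro exI[of _ c]) simp
  qed
  then obtain C where C: "\<And>i y. norm y = 1 \<Longrightarrow> norm (F i y) \<le> C i" by metis
  define B where "B = \<bar>C 1\<bar> + \<bar>C 2\<bar>"
  have B: "norm (F i y) \<le> B" if "norm y = 1" for i y
    using C[OF that, of i] exhaust_2[of i] by (auto simp: B_def)
  have g': "AE x in lborel. g i x = F i (n x)" for i
    using g[of i] by (simp add: AE_completion_iff)
  have gb: "AE x in lborel. \<bar>\<gamma> i j x\<bar> \<le> B" for i j
    using ug[of i j] g'[of i]
  proof eventually_elim
    case (elim x)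
    then show ?case using component_le_norm_cart[of "F i (n x)" j] B[OF n1, of i x] by simp
  qed
  have "\<exists>N. continuous_on UNIV N \<and> (AE x in lborel. u j x = N x)" for j
  proof -
    obtain N where "(2 * B)-lipschitz_on UNIV N" "AE x in lborel. u j x = N x"
      by (rule wderiv_bounded_lipschitz[OF uw[of 1 j] uw[of 2 j] gb gb]) (auto simp: B_def)
    then show ?thesis using lipschitz_on_continuous_on by blast
  qed
  then obtain N' where N': "\<And>j. continuous_on UNIV (N' j)" "\<And>j. AE x in lborel. u j x = N' j x" by metis
  define N :: "real^2 \<Rightarrow> real^3" where "N x = (\<chi> j. N' j x)" for x
  have Nc: "continuous_on UNIV N" unfolding N_def by (intro continuous_on_vec_lambda N')
  have nN: "AE x in lborel. n x = N x"
    using un[of 1] un[of 2] un[of 3] N'(2)[of 1] N'(2)[of 2] N'(2)[of 3]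
    by eventually_elim (simp add: N_def vec_eq_iff forall_3)
  \<comment> \<open>The unit length condition defines a closed set for the continuous
    \<open>N\<close>; having full measure, it is the whole plane.\<close>
  have "AE x in lebesgue. x \<in> {x. norm (N x) = 1}"
    using AE_completion[OF nN] by eventually_elim (use n1 in \<open>metis mem_Collect_eq\<close>)
  moreover have "closed {x. norm (N x) = 1}"
    by (intro closed_Collect_eq continuous_intros Nc)
  ultimately have N1: "norm (N x) = 1" for x
    using mem_closed_if_AE_lebesgue by blast
  have FN: "continuous_on UNIV (\<lambda>x. F i (N x) $ j)" for i j
    by (intro continuous_on_component continuous_on_compose2[OF F Nc]) auto
  have gF: "AE x in lborel. \<gamma> i j x = F i (N x) $ j" for i j
    using ug[of i j] g'[of i] nN by eventually_elim simp
  have "((\<lambda>x. N x $ j) has_derivative (\<lambda>v. v$1 * F 1 (N x) $ j + v$2 * F 2 (N x) $ j)) (at x)" for x j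
  proof -
    have "(N' j has_derivative (\<lambda>v. v$1 * F 1 (N x) $ j + v$2 * F 2 (N x) $ j)) (at x)"
      by (rule wderiv_continuous_has_derivative[OF uw[of 1 j] uw[of 2 j] N'(2) N'(1) gF FN gF FN])
    then show ?thesis by (simp add: N_def)
  qed
  with N1 AE_completion[OF nN] show ?thesis by blast
qed

section \<open>The equality case of negative degree\<close>

lemma norm2_sq: "(norm x)\<^sup>2 = (x$1)\<^sup>2 + (x$2)\<^sup>2" for x :: "real^2"
  unfolding power2_norm_eq_inner by (simp add: inner_vec_def sum_2 power2_eq_square)

lemma hsk_nth: "hsk x $ 1 = - 2 * x$2 / ((norm x)\<^sup>2 + 1)" "hsk x $ 2 = 2 * x$1 / ((norm x)\<^sup>2 + 1)"
  "hsk x $ 3 = ((norm x)\<^sup>2 - 1) / ((norm x)\<^sup>2 + 1)"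
  by (simp_all add: hsk_def)

text \<open>With \<open>d = 1 - n_3\<close> the sphere equation reads
  \<open>d^2 |y|^2 + (1 - d)^2 = 1\<close>, so \<open>d = 2 / (|y|^2 + 1)\<close> once the root
  \<open>d = 0\<close>, the pole, is excluded. The rotated pair \<open>(- y_2, y_1)\<close> is the
  stereographic coordinate of \<open>hsk y\<close>.\<close>

lemma stereographic_inverse:
  assumes n: "norm n = 1" and n3: "n$3 \<noteq> 1"
    and p: "n$1 / (1 - n$3) = - y$2" and q: "n$2 / (1 - n$3) = y$1"
  shows "n = hsk y"
proof -
  define d where "d = 1 - n$3"
  have d: "d \<noteq> 0" "n$3 = 1 - d" using n3 by (auto simp: d_def)
  have n12: "n$1 = - y$2 * d" "n$2 = y$1 * d"
    using p q d by (auto simp: d_def[symmetric] field_simps)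
  have "(n$1)\<^sup>2 + (n$2)\<^sup>2 + (n$3)\<^sup>2 = 1" using norm3_sq[of n] n by simp
  then have "d * (d * ((norm y)\<^sup>2 + 1)) = d * 2"
    unfolding n12 d(2) norm2_sq by algebra
  then have "d * ((norm y)\<^sup>2 + 1) = 2" using d(1) by simp
  moreover have pos: "(norm y)\<^sup>2 + 1 \<noteq> 0" using zero_le_power2[of "norm y"] by linarith
  ultimately have dd: "d = 2 / ((norm y)\<^sup>2 + 1)" by (simp add: field_simps)
  have "n$3 = ((norm y)\<^sup>2 - 1) / ((norm y)\<^sup>2 + 1)"
    unfolding d(2) dd using pos by (simp add: field_simps)
  then show ?thesis
    using n12 by (simp add: vec_eq_iff forall_3 hsk_nth dd)
qed

text \<open>Along every line \<open>1 - N$3\<close> solves a linear equation, so it vanishes everywhere or nowhere. In the latter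
  case the stereographic coordinates \<open>N$1 / (1 - N$3)\<close> and \<open>N$2 / (1 - N$3)\<close> have constant derivative.\<close>

lemma bogomolny_ode_solution:
  fixes N :: "real^2 \<Rightarrow> real^3"
  assumes N1: "\<And>x. norm (N x) = 1" and r: "r > 0"
    and der: "\<And>x j. ((\<lambda>x. N x $ j) has_derivative (\<lambda>v. v$1 * ((1 / (2 * r)) *\<^sub>R hfield (N x)) $ j
        + v$2 * (- ((1 / (2 * r)) *\<^sub>R cross3 (N x) (hfield (N x)))) $ j)) (at x)"
  shows "(\<forall>x. N x = e3) \<or> (\<exists>x0. \<forall>x. N x = hsk_r r (x - x0))"
proof -
  define c where "c = 1 / (2 * r)"
  have c: "c > 0" using r by (simp add: c_def)
  have sq: "(N x $ 1)\<^sup>2 + (N x $ 2)\<^sup>2 + (N x $ 3)\<^sup>2 = 1" for x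
    using norm3_sq[of "N x"] N1 by simp
  have cr: "cross3 (N x) (hfield (N x)) $ 3 = N x $ 1 * (1 - N x $ 3)"
    "cross3 (N x) (hfield (N x)) $ 1 = 1 - N x $ 3 - (N x $ 1)\<^sup>2"
    "cross3 (N x) (hfield (N x)) $ 2 = - (N x $ 1 * N x $ 2)" for x
    subgoal unfolding cross3_nth hfield_nth by (simp add: algebra_simps power2_eq_square)
    subgoal using sq[of x] unfolding cross3_nth hfield_nth by algebra
    subgoal unfolding cross3_nth hfield_nth by (simp add: algebra_simps power2_eq_square)
    done
  have d3: "((\<lambda>x. N x $ 3) has_derivative (\<lambda>v. c * (1 - N x $ 3) * (v$1 * N x $ 2 - v$2 * N x $ 1))) (at x)" for x
    by (rule has_derivative_eq_rhs[OF der[folded c_def, of 3 x]])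
      (simp add: cr hfield_nth fun_eq_iff algebra_simps)
  have d1: "((\<lambda>x. N x $ 1) has_derivative (\<lambda>v. c * (- v$1 * N x $ 1 * N x $ 2 - v$2 * (1 - N x $ 3 - (N x $ 1)\<^sup>2)))) (at x)" for x
    by (rule has_derivative_eq_rhs[OF der[folded c_def, of 1 x]])
      (simp add: cr hfield_nth fun_eq_iff algebra_simps)
  have d2: "((\<lambda>x. N x $ 2) has_derivative (\<lambda>v. c * (v$1 * (1 - N x $ 3 - (N x $ 2)\<^sup>2) + v$2 * N x $ 1 * N x $ 2))) (at x)" for x
    by (rule has_derivative_eq_rhs[OF der[folded c_def, of 2 x]])
      (simp add: cr hfield_nth fun_eq_iff algebra_simps)
  have le1: "\<bar>N x $ j\<bar> \<le> 1" for x j using component_le_norm_cart[of "N x" j] N1 by simp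
  show ?thesis
  proof (cases "\<exists>x. N x $ 3 = 1")
    case True
    then obtain x0 where x0: "N x0 $ 3 = 1" by blast
    have "N y $ 3 = 1" for y
    proof -
      define v where "v = y - x0"
      \<comment> \<open>A Gronwall argument on the segment from \<open>x0\<close> to
        \<open>y\<close>: \<open>K\<close> dominates the rate in the linear equation for
        \<open>1 - N_3\<close>, so with the weight \<open>exp (- K t)\<close> this quantity is
        nonincreasing. It starts at 0 and \<open>1 - N_3\<close> is never negative.\<close>
      define K where "K = c * (\<bar>v$1\<bar> + \<bar>v$2\<bar>)"
      define f where "f t = (1 - N (x0 + t *\<^sub>R v) $ 3) * exp (- (K * t))" for t
      define f' where "f' t = - ((1 - N (x0 + t *\<^sub>R v) $ 3) * (K + c * (v$1 * N (x0 + t *\<^sub>R v) $ 2 - v$2 * N (x0 + t *\<^sub>R v) $ 1))) * exp (- (K * t))" for t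
      have fd: "(f has_real_derivative f' t) (at t)" for t
      proof -
        have "((\<lambda>t. x0 + t *\<^sub>R v) has_derivative (\<lambda>h. h *\<^sub>R v)) (at t)"
          by (auto intro!: derivative_eq_intros)
        from has_derivative_compose[OF this d3]
        have "((\<lambda>t. N (x0 + t *\<^sub>R v) $ 3) has_real_derivative
           c * (1 - N (x0 + t *\<^sub>R v) $ 3) * (v$1 * N (x0 + t *\<^sub>R v) $ 2 - v$2 * N (x0 + t *\<^sub>R v) $ 1)) (at t)"
          unfolding has_field_derivative_def
          by (rule has_derivative_eq_rhs) (simp add: fun_eq_iff algebra_simps)
        then show ?thesis unfolding f_def f'_def
          by (auto intro!: derivative_eq_intros simp: algebra_simps)
      qed
      have "f' t \<le> 0" for t
      proof -
        let ?m = "N (x0 + t *\<^sub>R v)"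
        have "\<bar>v$1 * ?m $ 2 - v$2 * ?m $ 1\<bar> \<le> \<bar>v$1\<bar> * \<bar>?m $ 2\<bar> + \<bar>v$2\<bar> * \<bar>?m $ 1\<bar>"
          unfolding abs_mult[symmetric] by (rule abs_triangle_ineq4)
        also have "\<dots> \<le> \<bar>v$1\<bar> * 1 + \<bar>v$2\<bar> * 1"
          by (intro add_mono mult_left_mono le1) auto
        finally have "- (\<bar>v$1\<bar> + \<bar>v$2\<bar>) \<le> v$1 * ?m $ 2 - v$2 * ?m $ 1" by linarith
        then have "c * (- (\<bar>v$1\<bar> + \<bar>v$2\<bar>)) \<le> c * (v$1 * ?m $ 2 - v$2 * ?m $ 1)"
          using c by (intro mult_left_mono) auto
        then have "- (c * (\<bar>v$1\<bar> + \<bar>v$2\<bar>)) \<le> c * (v$1 * ?m $ 2 - v$2 * ?m $ 1)"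
          by (simp only: mult_minus_right)
        then have "0 \<le> K + c * (v$1 * ?m $ 2 - v$2 * ?m $ 1)" unfolding K_def by linarith
        moreover have "0 \<le> 1 - ?m $ 3" using le1[of "x0 + t *\<^sub>R v" 3] by linarith
        ultimately show ?thesis by (simp add: f'_def)
      qed
      then have "\<exists>y. (f has_real_derivative y) (at t) \<and> y \<le> 0" for t using fd by blast
      then have "f 1 \<le> f 0" by (rule DERIV_nonpos_imp_nonincreasing[OF zero_le_one])
      moreover have "x0 + 1 *\<^sub>R v = y" "x0 + 0 *\<^sub>R v = x0" by (simp_all add: v_def)
      ultimately have "(1 - N y $ 3) * exp (- K) \<le> 0" by (simp only: f_def x0) simp
      then have "1 - N y $ 3 \<le> 0" by (simp add: mult_le_0_iff)
      then show ?thesis using le1[of y 3] by linarith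
    qed
    moreover have "N y = e3" if "N y $ 3 = 1" for y
    proof -
      have "(N y $ 1)\<^sup>2 + (N y $ 2)\<^sup>2 = 0" using sq[of y] that by simp
      then have "N y $ 1 = 0" "N y $ 2 = 0" by (auto simp: sum_power2_eq_zero_iff)
      with that show ?thesis by (simp add: vec_eq_iff forall_3 e3_def axis_def)
    qed
    ultimately show ?thesis by blast
  next
    case False
    define p where "p x = N x $ 1 / (1 - N x $ 3)" for x
    define q where "q x = N x $ 2 / (1 - N x $ 3)" for x
    have nz: "1 - N x $ 3 \<noteq> 0" for x using False by (metis eq_iff_diff_eq_0)
    have dD: "((\<lambda>x. 1 - N x $ 3) has_derivative (\<lambda>v. - (c * (1 - N x $ 3) * (v$1 * N x $ 2 - v$2 * N x $ 1)))) (at x)" for x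
      by (rule has_derivative_eq_rhs[OF has_derivative_diff[OF has_derivative_const d3]]) simp
    have pd: "((\<lambda>x. p x + c * x$2) has_derivative (\<lambda>v. 0)) (at x)" for x
    proof -
      define D where "D = 1 - N x $ 3"
      have "(c * (- v$1 * N x $ 1 * N x $ 2 - v$2 * (D - (N x $ 1)\<^sup>2)) * D
          - N x $ 1 * - (c * D * (v$1 * N x $ 2 - v$2 * N x $ 1))) / (D * D) + c * v$2 = 0" for v :: "real^2"
      proof -
        have "c * (- v$1 * N x $ 1 * N x $ 2 - v$2 * (D - (N x $ 1)\<^sup>2)) * D
          - N x $ 1 * - (c * D * (v$1 * N x $ 2 - v$2 * N x $ 1)) = - (c * v$2) * (D * D)" by algebra
        then show ?thesis using nz[of x] by (simp add: D_def[symmetric])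
      qed
      then show ?thesis
        unfolding p_def
        by (intro has_derivative_eq_rhs[OF has_derivative_add[OF has_derivative_divide'[OF d1 dD nz]
              has_derivative_mult_right[OF has_derivative_vec_nth]]]) (simp add: D_def fun_eq_iff)
    qed
    have qd: "((\<lambda>x. q x - c * x$1) has_derivative (\<lambda>v. 0)) (at x)" for x
    proof -
      define D where "D = 1 - N x $ 3"
      have "(c * (v$1 * (D - (N x $ 2)\<^sup>2) + v$2 * N x $ 1 * N x $ 2) * D
          - N x $ 2 * - (c * D * (v$1 * N x $ 2 - v$2 * N x $ 1))) / (D * D) - c * v$1 = 0" for v :: "real^2"
      proof -
        have "c * (v$1 * (D - (N x $ 2)\<^sup>2) + v$2 * N x $ 1 * N x $ 2) * D
          - N x $ 2 * - (c * D * (v$1 * N x $ 2 - v$2 * N x $ 1)) = (c * v$1) * (D * D)" by algebra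
        then show ?thesis using nz[of x] by (simp add: D_def[symmetric])
      qed
      then show ?thesis
        unfolding q_def
        by (intro has_derivative_eq_rhs[OF has_derivative_diff[OF has_derivative_divide'[OF d2 dD nz]
              has_derivative_mult_right[OF has_derivative_vec_nth]]]) (simp add: D_def fun_eq_iff)
    qed
    obtain P where P: "\<And>x. p x + c * x$2 = P"
      using has_derivative_zero_constant[OF convex_UNIV, of "\<lambda>x. p x + c * x$2"] pd by blast
    obtain Q where Q: "\<And>x. q x - c * x$1 = Q"
      using has_derivative_zero_constant[OF convex_UNIV, of "\<lambda>x. q x - c * x$1"] qd by blast
    \<comment> \<open>The two integration constants are absorbed into a translation:
      \<open>p x = - c (x_2 - P/c)\<close> and \<open>q x = c (x_1 + Q/c)\<close>.\<close>
    define x0 :: "real^2" where "x0 = vector [- Q / c, P / c]"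
    have "N x = hsk_r r (x - x0)" for x
      unfolding hsk_r_def c_def[symmetric]
    proof (rule stereographic_inverse[OF N1])
      show "N x $ 3 \<noteq> 1" using nz[of x] by simp
      show "N x $ 1 / (1 - N x $ 3) = - (c *\<^sub>R (x - x0)) $ 2"
        using P[of x] c by (simp add: p_def x0_def field_simps)
      show "N x $ 2 / (1 - N x $ 3) = (c *\<^sub>R (x - x0)) $ 1"
        using Q[of x] c by (simp add: q_def x0_def field_simps)
    qed
    then show ?thesis by blast
  qed
qed

lemma energy_equality_neg:
  assumes n: "n \<in> Mspace" and r: "0 < r" "r < 1"
    and le: "Energy r n \<le> (2 * r\<^sup>2 - 1) * (4 * pi * degree n)"
  shows "(AE x in lebesgue. n x = e3) \<or> (\<exists>x0. AE x in lebesgue. n x = hsk_r r (x - x0))"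
proof -
  note M = MspaceD[OF n]
  have eq: "AE x in lebesgue. conf (-1) (n x) (grad n 1 x) (grad n 2 x) = 0 \<and>
    r *\<^sub>R conf 1 (n x) (grad n 1 x) (grad n 2 x) = hfield (n x)"
    by (rule energy_equality[OF n r]) (use le in \<open>auto simp: algebra_simps\<close>)
  define F :: "2 \<Rightarrow> real^3 \<Rightarrow> real^3" where
    "F i m = (if i = 1 then (1 / (2 * r)) *\<^sub>R hfield m else - ((1 / (2 * r)) *\<^sub>R cross3 m (hfield m)))" for i m
  have hc: "continuous_on UNIV hfield"
    unfolding continuous_on_componentwise[of UNIV hfield] 
    by (auto simp: Basis_vec_def inner_axis forall_3 hfield_nth intro!: continuous_intros)
  have Fc: "continuous_on UNIV (F i)" for i
    unfolding F_def using exhaust_2[of i] by (auto intro!: continuous_intros continuous_on_cross hc)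
  have alg: "a = (1 / (2 * r)) *\<^sub>R hfield m \<and> b = - ((1 / (2 * r)) *\<^sub>R cross3 m (hfield m))"
    if "norm m = 1" "m \<bullet> b = 0" "conf (-1) m a b = 0" "r *\<^sub>R conf 1 m a b = hfield m" for m a b
  proof -
    \<comment> \<open>Vanishing of \<open>conf (-1)\<close> doubles \<open>conf 1\<close> to
      \<open>2 a\<close>; this is the origin of the factor \<open>1 / (2 * r)\<close> and of the
      scale of the skyrmion.\<close>
    have a: "a = cross3 m b" using that(3) by (simp add: conf_def)
    have "hfield m = (2 * r) *\<^sub>R a"
      using that(4) a by (simp add: conf_def scaleR_2[symmetric] algebra_simps)
    then have h: "a = (1 / (2 * r)) *\<^sub>R hfield m" using r by simp
    have "(m$1)\<^sup>2 + (m$2)\<^sup>2 + (m$3)\<^sup>2 = 1" using norm3_sq[of m] that by simp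
    moreover have "m$1 * b$1 + m$2 * b$2 + m$3 * b$3 = 0" using that(2) by (simp add: inner3)
    ultimately have "cross3 m (cross3 m b) = - b"
      unfolding vec_eq_iff forall_3 cross3_nth vector_uminus_component by algebra
    then have "b = - cross3 m a" using a by simp
    also have "cross3 m a = (1 / (2 * r)) *\<^sub>R cross3 m (hfield m)"
      unfolding h by (simp add: cross_mult_right)
    finally show ?thesis using h by blast
  qed
  have "AE x in lebesgue. grad n 1 x = F 1 (n x) \<and> grad n 2 x = F 2 (n x)"
    using eq weak_grad_orthogonal[OF M(1,2), of 2]
    by eventually_elim (use alg M(2) in \<open>auto simp: F_def\<close>)
  then have g: "AE x in lebesgue. grad n i x = F i (n x)" for i
    using exhaust_2[of i] by (auto elim: eventually_mono)
  from weak_grad_regular[OF M(1,2) g Fc] obtain N where N: "\<And>x. norm (N x) = 1" "AE x in lebesgue. n x = N x"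
    "\<And>x j. ((\<lambda>x. N x $ j) has_derivative (\<lambda>v. v$1 * F 1 (N x) $ j + v$2 * F 2 (N x) $ j)) (at x)"
    by blast
  have "(\<forall>x. N x = e3) \<or> (\<exists>x0. \<forall>x. N x = hsk_r r (x - x0))"
    by (rule bogomolny_ode_solution[OF N(1) r(1)]) (use N(3)[unfolded F_def] in simp)
  then consider "\<And>x. N x = e3" | x0 where "\<And>x. N x = hsk_r r (x - x0)"
    by blast
  then show ?thesis
  proof cases
    case 1 with N(2) show ?thesis by simp
  next
    case (2 x0)
    have "AE x in lebesgue. n x = hsk_r r (x - x0)" using N(2) by (simp only: 2)
    then show ?thesis by blast
  qed
qed

section \<open>Gluing maps that are constant near infinity\<close>

lemma integral_lebesgue_borel:
  fixes f :: "'a::euclidean_space \<Rightarrow> real"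
  assumes "f \<in> borel_measurable borel"
  shows "(LINT x|lebesgue. f x) = (LINT x|lborel. f x)"
  using assms by (intro integral_completion) simp

lemma integrable_lebesgue_borel:
  fixes f :: "'a::euclidean_space \<Rightarrow> real"
  assumes "integrable lborel f"
  shows "integrable lebesgue f"
  using assms by (subst integrable_completion) auto

definition jointgrad :: "(real^2 \<Rightarrow> real^3) \<Rightarrow> (real^2 \<Rightarrow> real^3) \<Rightarrow> 2 \<Rightarrow> real^2 \<Rightarrow> real^3" where
  "jointgrad a b i = (if i = 1 then a else b)"

lemma jointgrad_simps [simp]: "jointgrad a b 1 = a" "jointgrad a b 2 = b"
  by (simp_all add: jointgrad_def)

definition C1_sphere_map :: "(real^2 \<Rightarrow> real^3) \<Rightarrow> (real^2 \<Rightarrow> real^3) \<Rightarrow> (real^2 \<Rightarrow> real^3) \<Rightarrow> bool" where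
  "C1_sphere_map n a b \<longleftrightarrow> (\<forall>x. norm (n x) = 1) \<and> continuous_on UNIV a \<and> continuous_on UNIV b \<and>
    (\<forall>x. (n has_derivative (\<lambda>v. v$1 *\<^sub>R a x + v$2 *\<^sub>R b x)) (at x))"

lemma C1_sphere_map_continuous: "C1_sphere_map n a b \<Longrightarrow> continuous_on UNIV n"
  unfolding C1_sphere_map_def
  by (intro continuous_at_imp_continuous_on ballI) (blast intro: has_derivative_continuous)

text \<open>A component of \<open>n\<close> times a test function is continuously differentiable
  with compact support, so its directional derivatives integrate to zero.\<close>

lemma C1_sphere_map_weak_grad:
  assumes C: "C1_sphere_map n a b"
  shows "is_weak_grad n (jointgrad a b)"
proof -
  have nc: "continuous_on UNIV n" using C by (rule C1_sphere_map_continuous)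
  have gc: "continuous_on UNIV (jointgrad a b i)" for i
    using C exhaust_2[of i] by (auto simp: C1_sphere_map_def)
  have nm: "n \<in> borel_measurable borel" and gm: "jointgrad a b i \<in> borel_measurable borel" for i
    by (auto intro!: borel_measurable_continuous_onI nc gc)
  show ?thesis
    unfolding is_weak_grad_def
  proof (intro conjI allI impI)
    show "n \<in> borel_measurable lebesgue" "jointgrad a b i \<in> borel_measurable lebesgue" for i
      using nm gm by (auto intro: measurable_completion)
    show "set_integrable lebesgue K (\<lambda>x. (norm (jointgrad a b i x))\<^sup>2)" if "compact K" for i K
      unfolding set_integrable_def
      by (intro integrable_lebesgue_borel borel_integrable_compact that continuous_intros continuous_on_subset[OF gc]) auto
    fix \<phi> i j assume t: "test_fun \<phi>"
    have sm: "smooth2 \<phi>" using t by (simp add: test_fun_def)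
    obtain R where R: "\<And>x. R < norm x \<Longrightarrow> \<phi> x = 0" "\<And>i x. R < norm x \<Longrightarrow> pd \<phi> i x = 0"
      using test_fun_support[OF t] by metis
    have c: "continuous_on UNIV \<phi>" "continuous_on UNIV (pd \<phi> i)"
      using smooth2_continuous[OF sm] smooth2_continuous[OF smooth2_pd[OF sm]] by auto
    define f' where "f' x = n x $ j * pd \<phi> i x + jointgrad a b i x $ j * \<phi> x" for x
    have c1: "continuous_on UNIV (\<lambda>x. n x $ j * pd \<phi> i x)" and c2: "continuous_on UNIV (\<lambda>x. jointgrad a b i x $ j * \<phi> x)"
      and c3: "continuous_on UNIV (\<lambda>x. n x $ j * \<phi> x)"
      by (intro continuous_intros nc gc c)+
    have i1: "integrable lborel (\<lambda>x. n x $ j * pd \<phi> i x)" and i2: "integrable lborel (\<lambda>x. jointgrad a b i x $ j * \<phi> x)"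
      and i3: "integrable lborel (\<lambda>x. n x $ j * \<phi> x)"
      by (rule integrable_continuous_compact_support[where R = R]; use c1 c2 c3 R in simp)+
    have f'c: "continuous_on UNIV f'" unfolding f'_def using c1 c2 by (rule continuous_on_add)
    have f'0: "f' x = 0" if "R < norm x" for x using R that by (simp add: f'_def)
    obtain B where "\<And>x. norm (f' x) \<le> B"
      using continuous_compact_support_bounded[OF f'c f'0] by blast
    then have B: "\<bar>f' x\<bar> \<le> B" for x by simp
    have "(LINT x|lborel. f' x) = 0"
    proof (rule integral_directional_derivative_eq_0[where f = "\<lambda>x. n x $ j * \<phi> x" and e = "axis i 1" and B = B and R = R])
      fix x :: "real^2"
      have "((\<lambda>s. x + s *\<^sub>R axis i 1) has_derivative (\<lambda>h. h *\<^sub>R axis i 1)) (at 0)"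
        by (auto intro!: derivative_eq_intros)
      moreover have "(n has_derivative (\<lambda>v. v$1 *\<^sub>R a x + v$2 *\<^sub>R b x)) (at (x + 0 *\<^sub>R axis i 1))"
        using C by (simp add: C1_sphere_map_def)
      ultimately have "((\<lambda>t. n (x + t *\<^sub>R axis i 1)) has_derivative
          (\<lambda>h. (h *\<^sub>R axis i 1 :: real^2)$1 *\<^sub>R a x + (h *\<^sub>R axis i 1 :: real^2)$2 *\<^sub>R b x)) (at 0)"
        by (rule has_derivative_compose)
      from bounded_linear.has_derivative[OF bounded_linear_vec_nth this, of j]
      have "((\<lambda>t. n (x + t *\<^sub>R axis i 1) $ j) has_real_derivative jointgrad a b i x $ j) (at 0)"
        unfolding has_field_derivative_def
        by (rule has_derivative_eq_rhs) (use exhaust_2[of i] in \<open>auto simp: axis_def fun_eq_iff\<close>)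
      from DERIV_mult[OF this smooth2_pd_axis[OF sm]]
      show "((\<lambda>t. n (x + t *\<^sub>R axis i 1) $ j * \<phi> (x + t *\<^sub>R axis i 1)) has_real_derivative f' x) (at 0)"
        by (rule DERIV_cong) (simp add: f'_def algebra_simps)
      show "\<bar>f' x\<bar> \<le> B" by (rule B)
    qed (use i3 R in auto)
    then have "(LINT x|lborel. n x $ j * pd \<phi> i x) = - (LINT x|lborel. jointgrad a b i x $ j * \<phi> x)"
      unfolding f'_def using Bochner_Integration.integral_add[OF i1 i2] by simp
    then show "(LINT x|lebesgue. n x $ j * pd \<phi> i x) = - (LINT x|lebesgue. jointgrad a b i x $ j * \<phi> x)"
      using i1 i2 by (simp add: integral_lebesgue_borel)
  qed
qed

lemma C1_sphere_map_continuous_dens: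
  assumes C: "C1_sphere_map n a b"
  shows "continuous_on UNIV (\<lambda>x. edens r (n x) (a x) (b x))"
    "continuous_on UNIV (\<lambda>x. jac (n x) (a x) (b x))"
    "continuous_on UNIV (\<lambda>x. (norm (a x))\<^sup>2 + (norm (b x))\<^sup>2)"
    "continuous_on UNIV (\<lambda>x. (1 - n x $ 3)\<^sup>2)"
  using C1_sphere_map_continuous[OF C] C unfolding C1_sphere_map_def edens_def heldens_eq jac_eq
  by (auto intro!: continuous_intros)

text \<open>The derivatives are carried as explicit data, since \<open>grad\<close> is determined
  only almost everywhere. Being exactly \<open>e3\<close> outside a ball, not just asymptotically,
  is what makes gluing additive.\<close>

definition bubble :: "(real^2 \<Rightarrow> real^3) \<Rightarrow> (real^2 \<Rightarrow> real^3) \<Rightarrow> (real^2 \<Rightarrow> real^3) \<Rightarrow> real \<Rightarrow> bool" where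
  "bubble n a b R \<longleftrightarrow> C1_sphere_map n a b \<and> (\<forall>x. R < norm x \<longrightarrow> n x = e3 \<and> a x = 0 \<and> b x = 0)"

lemma e3_nth: "e3 $ 1 = 0" "e3 $ 2 = 0" "e3 $ 3 = 1"
  by (simp_all add: e3_def axis_def)

lemma norm_e3: "norm e3 = 1"
  by (simp add: e3_def)

lemma dens_e3: "edens r e3 0 0 = 0" "jac e3 0 0 = 0"
  by (simp_all add: edens_def heldens_eq jac_eq e3_nth)

lemma bubble_integrable:
  assumes "bubble n a b R"
  shows "integrable lborel (\<lambda>x. edens r (n x) (a x) (b x))"
    "integrable lborel (\<lambda>x. jac (n x) (a x) (b x))"
    "integrable lborel (\<lambda>x. (norm (a x))\<^sup>2 + (norm (b x))\<^sup>2)"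
    "integrable lborel (\<lambda>x. (1 - n x $ 3)\<^sup>2)"
  using assms C1_sphere_map_continuous_dens[of n a b] unfolding bubble_def
  by (auto intro!: integrable_continuous_compact_support[where R = R] simp: dens_e3 e3_nth)

lemma bubble_Mspace:
  assumes B: "bubble n a b R" and r: "0 < r"
  shows "n \<in> Mspace" "4 * pi * degree n = (LINT x|lborel. jac (n x) (a x) (b x))"
    "Energy r n = (LINT x|lborel. edens r (n x) (a x) (b x))"
proof -
  have C: "C1_sphere_map n a b" using B by (simp add: bubble_def)
  note w = C1_sphere_map_weak_grad[OF C]
  note i = bubble_integrable[OF B]
  have n1: "norm (n x) = 1" for x using C by (simp add: C1_sphere_map_def)
  have D: "integrable lebesgue (\<lambda>x. (norm (jointgrad a b 1 x))\<^sup>2 + (norm (jointgrad a b 2 x))\<^sup>2)"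
    using integrable_lebesgue_borel[OF i(3)] by simp
  note f = energy_formula[OF w n1 D integrable_lebesgue_borel[OF i(4)] r power_one[of 2]]
  show "n \<in> Mspace" by (rule f(1))
  show "4 * pi * degree n = (LINT x|lborel. jac (n x) (a x) (b x))"
    using f(2) i(2) by (simp add: integral_lebesgue_borel)
  show "Energy r n = (LINT x|lborel. edens r (n x) (a x) (b x))"
    using f(6) i(1) by (simp add: integral_lebesgue_borel)
qed

lemma bubble_trivial: "bubble (\<lambda>_. e3) (\<lambda>_. 0) (\<lambda>_. 0) R"
  by (simp add: bubble_def C1_sphere_map_def norm_e3)

lemma C1_sphere_map_translate:
  assumes "C1_sphere_map n a b"
  shows "C1_sphere_map (\<lambda>x. n (x - c)) (\<lambda>x. a (x - c)) (\<lambda>x. b (x - c))"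
proof -
  have "((\<lambda>x. n (x - c)) has_derivative (\<lambda>v. v$1 *\<^sub>R a (x - c) + v$2 *\<^sub>R b (x - c))) (at x)" for x
  proof -
    have "((\<lambda>x. x - c) has_derivative (\<lambda>v. v)) (at x)" by (auto intro!: derivative_eq_intros)
    from has_derivative_compose[OF this, of n] show ?thesis using assms by (auto simp: C1_sphere_map_def)
  qed
  moreover have "continuous_on UNIV (\<lambda>x. a (x - c))" "continuous_on UNIV (\<lambda>x. b (x - c))"
    using assms by (auto simp: C1_sphere_map_def intro!: continuous_on_compose2[of UNIV a] continuous_on_compose2[of UNIV b] continuous_intros)
  ultimately show ?thesis using assms by (simp add: C1_sphere_map_def)
qed

text \<open>The shift \<open>\<bar>R\<bar> + \<bar>R'\<bar> + 1\<close> separates the two balls, so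
  at each point at least one map equals \<open>e3\<close> with zero derivatives. The sum minus
  \<open>e3\<close> is then the other map there, and the densities add pointwise because they vanish
  on the trivial map.\<close>

lemma bubble_glue:
  assumes B: "bubble n a b R" and B': "bubble n' a' b' R'"
  shows "\<exists>m u v S. bubble m u v S \<and>
    (LINT x|lborel. edens r (m x) (u x) (v x)) = (LINT x|lborel. edens r (n x) (a x) (b x)) + (LINT x|lborel. edens r (n' x) (a' x) (b' x)) \<and>
    (LINT x|lborel. jac (m x) (u x) (v x)) = (LINT x|lborel. jac (n x) (a x) (b x)) + (LINT x|lborel. jac (n' x) (a' x) (b' x))"
proof -
  define c :: "real^2" where "c = (\<bar>R\<bar> + \<bar>R'\<bar> + 1) *\<^sub>R axis 1 1"
  have nc: "norm c = \<bar>R\<bar> + \<bar>R'\<bar> + 1" by (simp add: c_def)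
  define m where "m x = n x + n' (x - c) - e3" for x
  define u where "u x = a x + a' (x - c)" for x
  define v where "v x = b x + b' (x - c)" for x
  have C: "C1_sphere_map n a b" and C': "C1_sphere_map (\<lambda>x. n' (x - c)) (\<lambda>x. a' (x - c)) (\<lambda>x. b' (x - c))"
    using B B' C1_sphere_map_translate by (auto simp: bubble_def)
  have cases: "(n x = e3 \<and> a x = 0 \<and> b x = 0) \<or> (n' (x - c) = e3 \<and> a' (x - c) = 0 \<and> b' (x - c) = 0)" for x
  proof (cases "R < norm x")
    case False
    then have "R' < norm (x - c)" using nc norm_triangle_ineq2[of c x] by (simp add: norm_minus_commute)
    then show ?thesis using B' by (simp add: bubble_def)
  qed (use B in \<open>simp add: bubble_def\<close>)
  have "C1_sphere_map m u v"
    unfolding C1_sphere_map_def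
  proof (intro conjI allI)
    fix x
    show "norm (m x) = 1"
      using cases[of x] C C' by (auto simp: m_def C1_sphere_map_def)
    have d1: "(n has_derivative (\<lambda>v. v$1 *\<^sub>R a x + v$2 *\<^sub>R b x)) (at x)"
      and d2: "((\<lambda>x. n' (x - c)) has_derivative (\<lambda>v. v$1 *\<^sub>R a' (x - c) + v$2 *\<^sub>R b' (x - c))) (at x)"
      using C C' by (auto simp: C1_sphere_map_def)
    show "(m has_derivative (\<lambda>w. w$1 *\<^sub>R u x + w$2 *\<^sub>R v x)) (at x)"
      unfolding m_def u_def v_def
      by (rule has_derivative_eq_rhs[OF has_derivative_diff[OF has_derivative_add[OF d1 d2] has_derivative_const]])
        (simp add: fun_eq_iff algebra_simps)
  next
    show "continuous_on UNIV u" "continuous_on UNIV v"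
      unfolding u_def v_def using C C' by (auto simp: C1_sphere_map_def intro!: continuous_on_add)
  qed
  moreover have "m x = e3 \<and> u x = 0 \<and> v x = 0" if "\<bar>R\<bar> + \<bar>R'\<bar> + norm c < norm x" for x
  proof -
    have "R < norm x" "R' < norm (x - c)"
      using that nc norm_triangle_ineq2[of x c] by simp_all
    then show ?thesis using B B' by (simp add: bubble_def m_def u_def v_def)
  qed
  ultimately have bub: "bubble m u v (\<bar>R\<bar> + \<bar>R'\<bar> + norm c)" by (simp add: bubble_def)
  have e: "edens r (m x) (u x) (v x) = edens r (n x) (a x) (b x) + edens r (n' (x - c)) (a' (x - c)) (b' (x - c))"
    and j: "jac (m x) (u x) (v x) = jac (n x) (a x) (b x) + jac (n' (x - c)) (a' (x - c)) (b' (x - c))" for x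
    using cases[of x] by (auto simp: m_def u_def v_def dens_e3)
  note i = bubble_integrable[OF B] and i' = bubble_integrable[OF B']
  have "(LINT x|lborel. edens r (m x) (u x) (v x)) = (LINT x|lborel. edens r (n x) (a x) (b x)) + (LINT x|lborel. edens r (n' x) (a' x) (b' x))"
    unfolding e
    using i(1)[of r] lborel_integrable_translate[OF i'(1)[of r], of "- c"]
      lborel_integral_translate[of "\<lambda>x. edens r (n' x) (a' x) (b' x)" "- c"] i'(1)[of r]
    by simp
  moreover have "(LINT x|lborel. jac (m x) (u x) (v x)) = (LINT x|lborel. jac (n x) (a x) (b x)) + (LINT x|lborel. jac (n' x) (a' x) (b' x))"
    unfolding j
    using i(2) lborel_integrable_translate[OF i'(2), of "- c"]
      lborel_integral_translate[of "\<lambda>x. jac (n' x) (a' x) (b' x)" "- c"] i'(2)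
    by simp
  ultimately show ?thesis using bub by blast
qed

lemma bubble_copies:
  assumes B: "bubble n a b R"
  shows "\<exists>m u v S. bubble m u v S \<and>
    (LINT x|lborel. edens r (m x) (u x) (v x)) = real k * (LINT x|lborel. edens r (n x) (a x) (b x)) \<and>
    (LINT x|lborel. jac (m x) (u x) (v x)) = real k * (LINT x|lborel. jac (n x) (a x) (b x))"
proof (induction k)
  case 0
  have "bubble (\<lambda>_. e3) (\<lambda>_. 0) (\<lambda>_. 0) 0" by (rule bubble_trivial)
  then show ?case
    by (intro exI[of _ "\<lambda>_. e3"] exI[of _ "\<lambda>_. 0"] exI[of _ 0]) (simp add: dens_e3)
next
  case (Suc k)
  then obtain m u v S where m: "bubble m u v S"
    "(LINT x|lborel. edens r (m x) (u x) (v x)) = real k * (LINT x|lborel. edens r (n x) (a x) (b x))"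
    "(LINT x|lborel. jac (m x) (u x) (v x)) = real k * (LINT x|lborel. jac (n x) (a x) (b x))" by blast
  show ?case using bubble_glue[OF m(1) B, of r] m(2,3) by (simp add: algebra_simps)
qed

section \<open>Radial maps\<close>

text \<open>The disc \<open>|x|^2 \<le> c\<close> has area \<open>pi * c\<close>, linear in
  \<open>c\<close>. Using the squared radius in place of the radius therefore avoids any Jacobian
  factor, and half-lines generate the Borel sets.\<close>

lemma distr_norm_sq:
  "distr lborel borel (\<lambda>x::real^2. (norm x)\<^sup>2) = density lborel (\<lambda>t. ennreal pi * indicator {0..} t)"
proof (rule measure_eqI_generator_eq[where E = "range atMost" and \<Omega> = UNIV and A = "\<lambda>n. {.. real n}"])
  show "Int_stable (range (atMost :: real \<Rightarrow> _))"
    by (auto simp: Int_stable_def)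
  show "sets (distr lborel borel (\<lambda>x::real^2. (norm x)\<^sup>2)) = sigma_sets UNIV (range atMost)"
    "sets (density lborel (\<lambda>t. ennreal pi * indicator {0..} t)) = sigma_sets UNIV (range (atMost :: real \<Rightarrow> _))"
    by (simp_all add: borel_eq_atMost sets_measure_of)
  have em: "emeasure (distr lborel borel (\<lambda>x::real^2. (norm x)\<^sup>2)) {..c} = ennreal (pi * max 0 c)" for c
  proof -
    have "emeasure (distr lborel borel (\<lambda>x::real^2. (norm x)\<^sup>2)) {..c} = emeasure lborel {x::real^2. (norm x)\<^sup>2 \<le> c}"
      by (subst emeasure_distr) (auto intro!: arg_cong2[where f = emeasure])
    also have "\<dots> = ennreal (pi * max 0 c)"
    proof (cases "c \<ge> 0")
      case True
      then have "{x::real^2. (norm x)\<^sup>2 \<le> c} = cball 0 (sqrt c)"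
        by (auto simp: real_le_rsqrt sqrt_ge_absD)
      then show ?thesis using True emeasure_cball[of "sqrt c" "0::real^2"] by (simp add: unit_ball_vol_2)
    next
      case False
      then have "{x::real^2. (norm x)\<^sup>2 \<le> c} = {}" using zero_le_power2 order_trans by blast
      then show ?thesis using False by simp
    qed
    finally show ?thesis .
  qed
  show "emeasure (distr lborel borel (\<lambda>x::real^2. (norm x)\<^sup>2)) X = emeasure (density lborel (\<lambda>t. ennreal pi * indicator {0..} t)) X"
    if X: "X \<in> range atMost" for X
  proof -
    obtain c where c: "X = {..c}" using X by auto
    have "emeasure (density lborel (\<lambda>t. ennreal pi * indicator {0..} t)) {..c}
      = (\<integral>\<^sup>+t. ennreal pi * indicator {0..c} t \<partial>lborel)"
      by (subst emeasure_density) (auto intro!: nn_integral_cong simp: indicator_def)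
    also have "\<dots> = ennreal (pi * max 0 c)"
      by (cases "0 \<le> c") (simp_all add: nn_integral_cmult ennreal_mult)
    finally show ?thesis using em c by simp
  qed
  show "emeasure (distr lborel borel (\<lambda>x::real^2. (norm x)\<^sup>2)) {..real i} \<noteq> \<infinity>" for i
    by (simp add: em)
  show "(\<Union>i. {..real i}) = UNIV" using real_arch_simple by auto
qed auto

text \<open>For a nonnegative integrand the fundamental theorem on the half-line gives finiteness
  and value at once; \<open>G\<close> is a primitive in the variable
  \<open>t = |x|^2\<close>.\<close>

lemma radial_integral:
  fixes F :: "real \<Rightarrow> real"
  assumes [measurable]: "F \<in> borel_measurable borel" and nonneg: "\<And>t. 0 \<le> t \<Longrightarrow> 0 \<le> F t"
    and der: "\<And>t. 0 \<le> t \<Longrightarrow> (G has_real_derivative F t) (at t)" and lim: "(G \<longlongrightarrow> l) at_top"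
  shows "integrable lborel (\<lambda>x::real^2. F ((norm x)\<^sup>2))"
    "(LINT x|lborel. F ((norm (x::real^2))\<^sup>2)) = pi * (l - G 0)"
proof -
  have "(\<integral>\<^sup>+x. ennreal (F ((norm (x::real^2))\<^sup>2)) \<partial>lborel) = (\<integral>\<^sup>+t. ennreal (F t) \<partial>distr lborel borel (\<lambda>x::real^2. (norm x)\<^sup>2))"
    by (subst nn_integral_distr) auto
  also have "\<dots> = (\<integral>\<^sup>+t. ennreal pi * (ennreal (F t) * indicator {0..} t) \<partial>lborel)"
    unfolding distr_norm_sq by (subst nn_integral_density) (auto simp: mult_ac)
  also have "\<dots> = ennreal pi * (\<integral>\<^sup>+t. ennreal (F t) * indicator {0..} t \<partial>lborel)"
    by (rule nn_integral_cmult) simp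
  also have "(\<integral>\<^sup>+t. ennreal (F t) * indicator {0..} t \<partial>lborel) = ennreal (l - G 0)"
    by (rule nn_integral_FTC_atLeast[OF _ der nonneg lim]) simp_all
  finally have nn: "(\<integral>\<^sup>+x. ennreal (F ((norm (x::real^2))\<^sup>2)) \<partial>lborel) = ennreal pi * ennreal (l - G 0)" .
  have "G 0 \<le> l"
  proof (rule tendsto_lowerbound[OF lim])
    show "\<forall>\<^sub>F t in at_top. G 0 \<le> G t"
      using eventually_ge_at_top[of 0]
    proof eventually_elim
      case (elim t)
      have "\<exists>y. (G has_real_derivative y) (at x) \<and> y \<ge> 0" if "0 \<le> x" for x using der[OF that] nonneg[OF that] by blast
      then show ?case using elim by (intro DERIV_nonneg_imp_nondecreasing[of 0 t G]) blast+
    qed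
  qed simp
  then have nn': "(\<integral>\<^sup>+x. ennreal (F ((norm (x::real^2))\<^sup>2)) \<partial>lborel) = ennreal (pi * (l - G 0))"
    unfolding nn by (simp add: ennreal_mult)
  show "integrable lborel (\<lambda>x::real^2. F ((norm x)\<^sup>2))"
    by (rule integrableI_nonneg) (use nn' nonneg in auto)
  show "(LINT x|lborel. F ((norm (x::real^2))\<^sup>2)) = pi * (l - G 0)"
    by (subst integral_eq_nn_integral) (use nn' nonneg \<open>G 0 \<le> l\<close> in auto)
qed

section \<open>Rotationally symmetric maps with explicit derivatives and densities\<close>

lemma has_derivative_vec3:
  fixes f :: "'a::real_normed_vector \<Rightarrow> real^3"
  assumes "\<And>j. ((\<lambda>x. f x $ j) has_derivative (\<lambda>v. D v $ j)) (at x)"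
  shows "(f has_derivative D) (at x)"
proof -
  have "((\<lambda>x. \<Sum>j\<in>UNIV. f x $ j *\<^sub>R (axis j 1 :: real^3)) has_derivative (\<lambda>v. \<Sum>j\<in>UNIV. D v $ j *\<^sub>R (axis j 1 :: real^3))) (at x)"
    by (intro has_derivative_sum has_derivative_scaleR_left assms)
  moreover have *: "(\<Sum>j\<in>UNIV. y $ j *\<^sub>R axis j 1) = y" for y :: "real^3"
    by (simp add: sum_3 vec_eq_iff forall_3 axis_def)
  ultimately show ?thesis by (simp only: *)
qed

text \<open>With \<open>z = x$1 + i x$2\<close>, the map \<open>sk\<close> below is the one with stereographic coordinate
  \<open>(n$1 + i n$2) / (1 - n$3) = i z / (L q(|z|^2))\<close> if \<open>s = 1\<close>, and with \<open>z\<close> replaced by its conjugate if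
  \<open>s = -1\<close>. The profile \<open>q = 1\<close> gives the skyrmion of size \<open>L\<close>; where \<open>q = 0\<close> the map is \<open>e3\<close>. The two
  derivatives of \<open>sk\<close> are \<open>sk1\<close> and \<open>sk2\<close>, and \<open>p\<close> is the derivative of \<open>q\<close>.\<close>

locale radial_map =
  fixes q p :: "real \<Rightarrow> real" and L s :: real
  assumes L: "0 < L" and s: "s * s = 1"
    and q_der: "\<And>t. (q has_real_derivative p t) (at t)" and p_cont: "continuous_on UNIV p"
    and q0: "q 0 = 1" and q_ge: "\<And>t. 0 \<le> t \<Longrightarrow> 0 \<le> q t" and q_le: "\<And>t. 0 \<le> t \<Longrightarrow> q t \<le> 1"
    and p_le: "\<And>t. 0 \<le> t \<Longrightarrow> p t \<le> 0"
begin

text \<open>The third component of the map is \<open>mn / dn\<close>. In the gradient density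
  \<open>zn\<close> stands for the radial stretching and \<open>q\<close> for the angular one, so
  the map is conformal where they agree, that is where \<open>t * p t = 0\<close>. \<open>wn\<close>
  only abbreviates a factor in the derivatives.\<close>

definition "dn t = t + L\<^sup>2 * (q t)\<^sup>2"
definition "mn t = t - L\<^sup>2 * (q t)\<^sup>2"
definition "wn t = p t * mn t - q t"
definition "zn t = q t - 2 * t * p t"

definition sk :: "real^2 \<Rightarrow> real^3" where
  "sk x = (let t = (norm x)\<^sup>2 in (1 / dn t) *\<^sub>R vector [- (2 * s * L * q t * x$2), 2 * L * q t * x$1, mn t])"

definition sk1 :: "real^2 \<Rightarrow> real^3" where
  "sk1 x = (let t = (norm x)\<^sup>2 in (2 * L / (dn t)\<^sup>2) *\<^sub>R
     vector [- (2 * s * x$1 * x$2 * wn t), 2 * (x$1)\<^sup>2 * wn t + q t * dn t, 2 * L * q t * x$1 * zn t])"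

definition sk2 :: "real^2 \<Rightarrow> real^3" where
  "sk2 x = (let t = (norm x)\<^sup>2 in (2 * L / (dn t)\<^sup>2) *\<^sub>R
     vector [- (s * (2 * (x$2)\<^sup>2 * wn t + q t * dn t)), 2 * x$1 * x$2 * wn t, 2 * L * q t * x$2 * zn t])"

text \<open>At the centre positivity comes from \<open>q 0 = 1\<close>; elsewhere the summand
  \<open>t\<close> suffices, even where the profile vanishes.\<close>

lemma dn_pos: "0 \<le> t \<Longrightarrow> 0 < dn t"
  using L q0 by (cases "t = 0") (auto simp: dn_def add_pos_nonneg)

lemma dn_ge: "t \<le> dn t" by (simp add: dn_def)

lemma sk_nth: "sk x $ 1 = - (2 * s * L * q ((norm x)\<^sup>2) * x$2) / dn ((norm x)\<^sup>2)"
    "sk x $ 2 = 2 * L * q ((norm x)\<^sup>2) * x$1 / dn ((norm x)\<^sup>2)" "sk x $ 3 = mn ((norm x)\<^sup>2) / dn ((norm x)\<^sup>2)"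
  by (simp_all add: sk_def Let_def)

lemma sk1_nth: "sk1 x $ 1 = 2 * L / (dn ((norm x)\<^sup>2))\<^sup>2 * - (2 * s * x$1 * x$2 * wn ((norm x)\<^sup>2))"
    "sk1 x $ 2 = 2 * L / (dn ((norm x)\<^sup>2))\<^sup>2 * (2 * (x$1)\<^sup>2 * wn ((norm x)\<^sup>2) + q ((norm x)\<^sup>2) * dn ((norm x)\<^sup>2))"
    "sk1 x $ 3 = 2 * L / (dn ((norm x)\<^sup>2))\<^sup>2 * (2 * L * q ((norm x)\<^sup>2) * x$1 * zn ((norm x)\<^sup>2))"
  by (simp_all add: sk1_def Let_def)

lemma sk2_nth: "sk2 x $ 1 = 2 * L / (dn ((norm x)\<^sup>2))\<^sup>2 * - (s * (2 * (x$2)\<^sup>2 * wn ((norm x)\<^sup>2) + q ((norm x)\<^sup>2) * dn ((norm x)\<^sup>2)))"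
    "sk2 x $ 2 = 2 * L / (dn ((norm x)\<^sup>2))\<^sup>2 * (2 * x$1 * x$2 * wn ((norm x)\<^sup>2))"
    "sk2 x $ 3 = 2 * L / (dn ((norm x)\<^sup>2))\<^sup>2 * (2 * L * q ((norm x)\<^sup>2) * x$2 * zn ((norm x)\<^sup>2))"
  by (simp_all add: sk2_def Let_def)

text \<open>Names for all radial quantities at one point, with the reciprocal \<open>k\<close> tied
  to \<open>d\<close> by \<open>k * d = 1\<close>, turn the following identities into polynomial
  ones.\<close>

context
  fixes x :: "real^2" and t d m w z k y1 y2 Q P :: real
  defines "t \<equiv> (norm x)\<^sup>2" and "d \<equiv> dn ((norm x)\<^sup>2)" and "m \<equiv> mn ((norm x)\<^sup>2)" and "w \<equiv> wn ((norm x)\<^sup>2)" and "z \<equiv> zn ((norm x)\<^sup>2)"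
    and "k \<equiv> 1 / dn ((norm x)\<^sup>2)" and "y1 \<equiv> x$1" and "y2 \<equiv> x$2" and "Q \<equiv> q ((norm x)\<^sup>2)" and "P \<equiv> p ((norm x)\<^sup>2)"
begin

lemma profile_eqs: "t = y1\<^sup>2 + y2\<^sup>2" "d = t + L\<^sup>2 * Q\<^sup>2" "m = t - L\<^sup>2 * Q\<^sup>2" "w = P * m - Q" "z = Q - 2 * t * P"
  by (simp_all add: t_def d_def m_def w_def z_def y1_def y2_def Q_def P_def dn_def mn_def wn_def zn_def norm2_sq)

lemma inv_dn: "k * d = 1"
  using dn_pos[of "(norm x)\<^sup>2"] by (simp add: k_def d_def)

text \<open>The second identity is the unit length of the map. With the first one they reduce the
  densities below to expressions in \<open>Q\<close>, \<open>z\<close> and \<open>k\<close>.\<close>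

lemma profile_identities: "2 * t * w + Q * d = - (m * z)" "m\<^sup>2 + 4 * L\<^sup>2 * Q\<^sup>2 * t = d\<^sup>2"
  unfolding profile_eqs(2-5) by algebra+

lemma sk_k: "sk x $ 1 = k * - (2 * s * L * Q * y2)" "sk x $ 2 = k * (2 * L * Q * y1)" "sk x $ 3 = k * m"
  by (simp_all add: sk_nth k_def Q_def y1_def y2_def m_def)

lemma sk1_k: "sk1 x $ 1 = 2 * L * k\<^sup>2 * - (2 * s * y1 * y2 * w)" "sk1 x $ 2 = 2 * L * k\<^sup>2 * (2 * y1\<^sup>2 * w + Q * d)"
   "sk1 x $ 3 = 2 * L * k\<^sup>2 * (2 * L * Q * y1 * z)"
  by (simp_all add: sk1_nth k_def Q_def y1_def y2_def w_def z_def d_def power_divide)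

lemma sk2_k: "sk2 x $ 1 = 2 * L * k\<^sup>2 * - (s * (2 * y2\<^sup>2 * w + Q * d))" "sk2 x $ 2 = 2 * L * k\<^sup>2 * (2 * y1 * y2 * w)"
   "sk2 x $ 3 = 2 * L * k\<^sup>2 * (2 * L * Q * y2 * z)"
  by (simp_all add: sk2_nth k_def Q_def y1_def y2_def w_def z_def d_def power_divide)

lemma norm_sk: "norm (sk x) = 1"
proof -
  have "(norm (sk x))\<^sup>2 = k\<^sup>2 * (m\<^sup>2 + 4 * L\<^sup>2 * Q\<^sup>2 * (s * s * y2\<^sup>2 + y1\<^sup>2))"
    unfolding norm3_sq sk_k by algebra
  also have "s * s * y2\<^sup>2 + y1\<^sup>2 = t" unfolding s profile_eqs(1) by simp
  also have "k\<^sup>2 * (m\<^sup>2 + 4 * L\<^sup>2 * Q\<^sup>2 * t) = (k * d)\<^sup>2" unfolding profile_identities(2) by (simp add: power_mult_distrib)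
  finally have "(norm (sk x))\<^sup>2 = 1" by (simp add: inv_dn)
  then show ?thesis by (metis abs_norm_cancel abs_square_eq_1)
qed

lemma grad_sk: "(norm (sk1 x))\<^sup>2 + (norm (sk2 x))\<^sup>2 = 4 * L\<^sup>2 * (z\<^sup>2 + Q\<^sup>2) * k\<^sup>2"
proof -
  have "(norm (sk1 x))\<^sup>2 + (norm (sk2 x))\<^sup>2 = 4 * L\<^sup>2 * k^4 *
     (4 * (s * s) * y1\<^sup>2 * y2\<^sup>2 * w\<^sup>2 + (2 * y1\<^sup>2 * w + Q * d)\<^sup>2 + 4 * L\<^sup>2 * Q\<^sup>2 * y1\<^sup>2 * z\<^sup>2
      + (s * s) * (2 * y2\<^sup>2 * w + Q * d)\<^sup>2 + 4 * y1\<^sup>2 * y2\<^sup>2 * w\<^sup>2 + 4 * L\<^sup>2 * Q\<^sup>2 * y2\<^sup>2 * z\<^sup>2)"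
    unfolding norm3_sq sk1_k sk2_k by algebra
  also have "\<dots> = 4 * L\<^sup>2 * k^4 * ((2 * t * w + Q * d)\<^sup>2 + Q\<^sup>2 * d\<^sup>2 + 4 * L\<^sup>2 * Q\<^sup>2 * t * z\<^sup>2)"
    unfolding s profile_eqs(1) by algebra
  also have "\<dots> = 4 * L\<^sup>2 * k^4 * (z\<^sup>2 * (m\<^sup>2 + 4 * L\<^sup>2 * Q\<^sup>2 * t) + Q\<^sup>2 * d\<^sup>2)"
    unfolding profile_identities(1) by algebra
  also have "\<dots> = 4 * L\<^sup>2 * (z\<^sup>2 + Q\<^sup>2) * k\<^sup>2 * (k * d)\<^sup>2"
    unfolding profile_identities(2) by algebra
  finally show ?thesis by (simp add: inv_dn)
qed

lemma orth_sk: "sk x \<bullet> sk1 x = 0" "sk x \<bullet> sk2 x = 0"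
proof -
  have "sk x \<bullet> sk1 x = 4 * L\<^sup>2 * k^3 * Q * y1 * (2 * (s * s * y2\<^sup>2 + y1\<^sup>2) * w + Q * d + m * z)"
    unfolding inner3 sk_k sk1_k by algebra
  also have "s * s * y2\<^sup>2 + y1\<^sup>2 = t" unfolding s profile_eqs(1) by simp
  finally show "sk x \<bullet> sk1 x = 0" by (simp add: profile_identities(1))
  have "sk x \<bullet> sk2 x = 4 * L\<^sup>2 * k^3 * Q * y2 * (2 * (s * s * y2\<^sup>2 + y1\<^sup>2) * w + (s * s) * (Q * d) + m * z)"
    unfolding inner3 sk_k sk2_k by algebra
  also have "s * s * y2\<^sup>2 + y1\<^sup>2 = t" unfolding s profile_eqs(1) by simp
  finally show "sk x \<bullet> sk2 x = 0" by (simp add: s profile_identities(1))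
qed

lemma jac_sk: "jac (sk x) (sk1 x) (sk2 x) = - (s * (4 * L\<^sup>2 * Q * z * k\<^sup>2))"
proof -
  have "jac (sk x) (sk1 x) (sk2 x) = 4 * L\<^sup>2 * k^5 * s * Q * d * (m * (2 * (y1\<^sup>2 + y2\<^sup>2) * w + Q * d) - 4 * L\<^sup>2 * Q\<^sup>2 * z * (y1\<^sup>2 + y2\<^sup>2))"
    unfolding jac_eq sk_k sk1_k sk2_k by algebra
  also have "\<dots> = - (4 * L\<^sup>2 * k^5 * s * Q * d * z * (m\<^sup>2 + 4 * L\<^sup>2 * Q\<^sup>2 * t))"
    unfolding profile_eqs(1)[symmetric] profile_identities(1) by algebra
  also have "\<dots> = - (s * (4 * L\<^sup>2 * Q * z * k\<^sup>2)) * (k * d)^3"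
    unfolding profile_identities(2) by algebra
  finally show ?thesis by (simp add: inv_dn)
qed

text \<open>Only for \<open>s = 1\<close> do the terms in \<open>y1^2\<close> and
  \<open>y2^2\<close> add up to \<open>t\<close>; for \<open>s = -1\<close> they would appear as a
  difference and the helicity density would not be radial.\<close>

lemma heldens_sk:
  assumes "s = 1" shows "heldens (sk x) (sk1 x) (sk2 x) = - (4 * L^3 * Q\<^sup>2 * (z + Q) * k\<^sup>2)"
proof -
  have m: "m = d - 2 * L\<^sup>2 * Q\<^sup>2" unfolding profile_eqs(2,3) by simp
  have m': "k * m - 1 = - (2 * L\<^sup>2 * Q\<^sup>2 * k)" using inv_dn unfolding m by algebra
  have "heldens (sk x) (sk1 x) (sk2 x) = - (8 * L^3 * Q\<^sup>2 * k^3 * z * (y1\<^sup>2 + y2\<^sup>2))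
      + (k * m - 1) * (2 * L * k\<^sup>2 * (2 * (y1\<^sup>2 + y2\<^sup>2) * w + 2 * (Q * d)))"
    unfolding heldens_eq sk_k sk1_k sk2_k using assms by algebra
  also have "\<dots> = - (4 * L^3 * Q\<^sup>2 * k^3 * (2 * z * t + (2 * t * w + Q * d) + Q * d))"
    unfolding m' profile_eqs(1)[symmetric] by algebra
  also have "\<dots> = - (4 * L^3 * Q\<^sup>2 * k^3 * (z * (2 * t - m) + Q * d))"
    unfolding profile_identities(1) by algebra
  also have "2 * t - m = d" unfolding profile_eqs(2,3) by simp
  also have "- (4 * L^3 * Q\<^sup>2 * k^3 * (z * d + Q * d)) = - (4 * L^3 * Q\<^sup>2 * (z + Q) * k\<^sup>2) * (k * d)"
    by algebra
  finally show ?thesis by (simp add: inv_dn)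
qed

lemma sk3: "1 - sk x $ 3 = 2 * L\<^sup>2 * Q\<^sup>2 * k"
proof -
  have m: "m = d - 2 * L\<^sup>2 * Q\<^sup>2" unfolding profile_eqs(2,3) by simp
  show ?thesis unfolding sk_k m using inv_dn by algebra
qed

text \<open>The combination is \<open>4 L^2 (z - Q)^2 k^2\<close>, the failure of conformality, and
  \<open>z - Q = - 2 t P\<close> measures how far the profile is from constant.\<close>

lemma norm_conf_sk: "(norm (conf (- s) (sk x) (sk1 x) (sk2 x)))\<^sup>2 = 16 * L\<^sup>2 * P\<^sup>2 * t\<^sup>2 * k\<^sup>2"
proof -
  have "(- s)\<^sup>2 = 1" using s by (simp add: power2_eq_square)
  then have "(norm (conf (- s) (sk x) (sk1 x) (sk2 x)))\<^sup>2 = 4 * L\<^sup>2 * (z\<^sup>2 + Q\<^sup>2) * k\<^sup>2 - 8 * (s * s) * L\<^sup>2 * Q * z * k\<^sup>2"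
    by (subst norm_conf[OF norm_sk orth_sk]) (auto simp: grad_sk jac_sk)
  also have "\<dots> = 4 * L\<^sup>2 * (z - Q)\<^sup>2 * k\<^sup>2" unfolding s by algebra
  also have "\<dots> = 16 * L\<^sup>2 * P\<^sup>2 * t\<^sup>2 * k\<^sup>2" unfolding profile_eqs(5) by algebra
  finally show ?thesis .
qed

text \<open>The size \<open>L = 2 * r\<close> is the one that turns the expansion into a single
  square, that of \<open>z + Q - 2 Q^2 = 2 (Q - Q^2 - t P)\<close>. It vanishes for the constant
  profile 1, the skyrmion.\<close>

lemma bdefect_sk:
  assumes "s = 1" "L = 2 * r"
  shows "(norm (bdefect r (sk x) (sk1 x) (sk2 x)))\<^sup>2 = 4 * L^4 * (Q - Q\<^sup>2 - t * P)\<^sup>2 * k\<^sup>2"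
proof -
  have c: "(norm (conf 1 (sk x) (sk1 x) (sk2 x)))\<^sup>2 = 4 * L\<^sup>2 * (z\<^sup>2 + Q\<^sup>2) * k\<^sup>2 + 2 * (4 * L\<^sup>2 * Q * z * k\<^sup>2)"
    using norm_conf[OF norm_sk orth_sk, of 1] unfolding grad_sk jac_sk using assms(1) by simp
  have h: "conf 1 (sk x) (sk1 x) (sk2 x) \<bullet> hfield (sk x) = 4 * L^3 * Q\<^sup>2 * (z + Q) * k\<^sup>2"
    using conf_inner_hfield[OF norm_sk orth_sk] heldens_sk[OF assms(1)] by simp
  have "(norm (bdefect r (sk x) (sk1 x) (sk2 x)))\<^sup>2
     = r\<^sup>2 * (norm (conf 1 (sk x) (sk1 x) (sk2 x)))\<^sup>2 - 2 * r * (conf 1 (sk x) (sk1 x) (sk2 x) \<bullet> hfield (sk x)) + (norm (hfield (sk x)))\<^sup>2"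
    unfolding power2_norm_eq_inner bdefect_def by (simp add: algebra_simps inner_commute power2_eq_square)
  also have "\<dots> = r\<^sup>2 * (4 * L\<^sup>2 * (z\<^sup>2 + Q\<^sup>2) * k\<^sup>2 + 2 * (4 * L\<^sup>2 * Q * z * k\<^sup>2)) - 2 * r * (4 * L^3 * Q\<^sup>2 * (z + Q) * k\<^sup>2) + (2 * L\<^sup>2 * Q\<^sup>2 * k)\<^sup>2"
    unfolding c h norm_hfield[OF norm_sk] sk3 by simp
  also have "\<dots> = L^4 * (z + Q - 2 * Q\<^sup>2)\<^sup>2 * k\<^sup>2"
    unfolding assms(2) by algebra
  also have "\<dots> = 4 * L^4 * (Q - Q\<^sup>2 - t * P)\<^sup>2 * k\<^sup>2"
    unfolding profile_eqs(5) by algebra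
  finally show ?thesis .
qed

end

lemma q_cont: "continuous_on UNIV q"
  using q_der DERIV_isCont continuous_at_imp_continuous_on by blast

lemma sk_has_derivative: "(sk has_derivative (\<lambda>v. v$1 *\<^sub>R sk1 x + v$2 *\<^sub>R sk2 x)) (at x)"
proof -
  define t where "t = (norm x)\<^sup>2"
  define \<tau> where "\<tau> v = 2 * (x$1 * v$1 + x$2 * v$2)" for v :: "real^2"
  have t: "t = (x$1)\<^sup>2 + (x$2)\<^sup>2" by (simp add: t_def norm2_sq)
  have d0: "dn t \<noteq> 0" using dn_pos[of t] by (simp add: t_def)
  have dt: "((\<lambda>x. (norm x)\<^sup>2) has_derivative \<tau>) (at x)"
    unfolding norm2_sq \<tau>_def by (auto intro!: derivative_eq_intros)
  have dq: "((\<lambda>x. q ((norm x)\<^sup>2)) has_derivative (\<lambda>v. p t * \<tau> v)) (at x)"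
    using has_derivative_compose[OF dt q_der[unfolded has_field_derivative_def]] by (simp add: t_def)
  have dd: "((\<lambda>x. dn ((norm x)\<^sup>2)) has_derivative (\<lambda>v. \<tau> v + L\<^sup>2 * (2 * q t * (p t * \<tau> v)))) (at x)"
    unfolding dn_def
    by (rule has_derivative_eq_rhs[OF has_derivative_add[OF dt has_derivative_mult_right[OF has_derivative_power[OF dq]]]])
      (simp add: t_def fun_eq_iff)
  have dm: "((\<lambda>x. mn ((norm x)\<^sup>2)) has_derivative (\<lambda>v. \<tau> v - L\<^sup>2 * (2 * q t * (p t * \<tau> v)))) (at x)"
    unfolding mn_def
    by (rule has_derivative_eq_rhs[OF has_derivative_diff[OF dt has_derivative_mult_right[OF has_derivative_power[OF dq]]]])
      (simp add: t_def fun_eq_iff)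
  have q1: "((\<lambda>x. - (2 * s * L * q ((norm x)\<^sup>2) * x$2)) has_derivative (\<lambda>v. - (2 * s * L * (p t * \<tau> v * x$2 + q t * v$2)))) (at x)"
    by (rule has_derivative_eq_rhs[OF has_derivative_minus[OF has_derivative_mult[OF has_derivative_mult_right[OF dq] has_derivative_vec_nth]]])
      (simp add: t_def fun_eq_iff algebra_simps)
  have q2: "((\<lambda>x. 2 * L * q ((norm x)\<^sup>2) * x$1) has_derivative (\<lambda>v. 2 * L * (p t * \<tau> v * x$1 + q t * v$1))) (at x)"
    by (rule has_derivative_eq_rhs[OF has_derivative_mult[OF has_derivative_mult_right[OF dq] has_derivative_vec_nth]])
      (simp add: t_def fun_eq_iff algebra_simps)
  define \<delta> where "\<delta> v = \<tau> v + L\<^sup>2 * (2 * q t * (p t * \<tau> v))" for v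
  \<comment> \<open>The quotient rule in the form shared by all three components; what remains for
    each is a polynomial identity for the numerator.\<close>
  have quot: "((\<lambda>x. f x / dn ((norm x)\<^sup>2)) has_derivative (\<lambda>v. v$1 * (2 * L / (dn t)\<^sup>2 * \<alpha>) + v$2 * (2 * L / (dn t)\<^sup>2 * \<beta>))) (at x)"
    if "(f has_derivative f') (at x)"
      "\<And>v. f' v * dn t - f x * \<delta> v = v$1 * (2 * L * \<alpha>) + v$2 * (2 * L * \<beta>)" for f f' \<alpha> \<beta>
  proof (rule has_derivative_eq_rhs[OF has_derivative_divide'[OF that(1) dd]])
    show "dn ((norm x)\<^sup>2) \<noteq> 0" using d0 unfolding t_def .
    show "(\<lambda>v. (f' v * dn ((norm x)\<^sup>2) - f x * (\<tau> v + L\<^sup>2 * (2 * q t * (p t * \<tau> v)))) / (dn ((norm x)\<^sup>2) * dn ((norm x)\<^sup>2)))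
      = (\<lambda>v. v$1 * (2 * L / (dn t)\<^sup>2 * \<alpha>) + v$2 * (2 * L / (dn t)\<^sup>2 * \<beta>))"
      unfolding t_def[symmetric] \<delta>_def[symmetric] that(2) by (simp add: power2_eq_square add_divide_distrib)
  qed
  have c1: "((\<lambda>x. sk x $ 1) has_derivative (\<lambda>v. v$1 * sk1 x $ 1 + v$2 * sk2 x $ 1)) (at x)"
    unfolding sk_nth sk1_nth sk2_nth t_def[symmetric]
  proof (rule quot[OF q1])
    show "- (2 * s * L * (p t * \<tau> v * x$2 + q t * v$2)) * dn t - - (2 * s * L * q ((norm x)\<^sup>2) * x$2) * \<delta> v
      = v$1 * (2 * L * - (2 * s * x$1 * x$2 * wn t)) + v$2 * (2 * L * - (s * (2 * (x$2)\<^sup>2 * wn t + q t * dn t)))" for v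
      unfolding t_def[symmetric] \<delta>_def \<tau>_def wn_def mn_def dn_def by algebra
  qed
  have c2: "((\<lambda>x. sk x $ 2) has_derivative (\<lambda>v. v$1 * sk1 x $ 2 + v$2 * sk2 x $ 2)) (at x)"
    unfolding sk_nth sk1_nth sk2_nth t_def[symmetric]
  proof (rule quot[OF q2])
    show "2 * L * (p t * \<tau> v * x$1 + q t * v$1) * dn t - 2 * L * q ((norm x)\<^sup>2) * x$1 * \<delta> v
      = v$1 * (2 * L * (2 * (x$1)\<^sup>2 * wn t + q t * dn t)) + v$2 * (2 * L * (2 * x$1 * x$2 * wn t))" for v
      unfolding t_def[symmetric] \<delta>_def \<tau>_def wn_def mn_def dn_def by algebra
  qed
  have c3: "((\<lambda>x. sk x $ 3) has_derivative (\<lambda>v. v$1 * sk1 x $ 3 + v$2 * sk2 x $ 3)) (at x)"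
    unfolding sk_nth sk1_nth sk2_nth t_def[symmetric]
  proof (rule quot[OF dm])
    show "(\<tau> v - L\<^sup>2 * (2 * q t * (p t * \<tau> v))) * dn t - mn ((norm x)\<^sup>2) * \<delta> v
      = v$1 * (2 * L * (2 * L * q t * x$1 * zn t)) + v$2 * (2 * L * (2 * L * q t * x$2 * zn t))" for v
      unfolding t_def[symmetric] \<delta>_def \<tau>_def zn_def mn_def dn_def t by algebra
  qed
  show ?thesis
  proof (rule has_derivative_vec3)
    fix j :: 3
    show "((\<lambda>x. sk x $ j) has_derivative (\<lambda>v. (v$1 *\<^sub>R sk1 x + v$2 *\<^sub>R sk2 x) $ j)) (at x)"
      using exhaust_3[of j] c1 c2 c3 by auto
  qed
qed

lemma C1_sk: "C1_sphere_map sk sk1 sk2"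
proof -
  have qc: "continuous_on UNIV (\<lambda>x::real^2. q ((norm x)\<^sup>2))" and pc: "continuous_on UNIV (\<lambda>x::real^2. p ((norm x)\<^sup>2))"
    by (intro continuous_on_compose2[OF q_cont] continuous_on_compose2[OF p_cont] continuous_intros; simp)+
  have dc: "continuous_on UNIV (\<lambda>x::real^2. dn ((norm x)\<^sup>2))" "continuous_on UNIV (\<lambda>x::real^2. mn ((norm x)\<^sup>2))"
    "continuous_on UNIV (\<lambda>x::real^2. zn ((norm x)\<^sup>2))"
    unfolding dn_def mn_def zn_def by (intro continuous_intros qc pc)+
  have wc: "continuous_on UNIV (\<lambda>x::real^2. wn ((norm x)\<^sup>2))"
    unfolding wn_def by (intro continuous_intros qc pc dc)
  have d0: "dn ((norm x)\<^sup>2) \<noteq> 0" for x :: "real^2" using dn_pos[of "(norm x)\<^sup>2"] by simp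
  have cv: "continuous_on UNIV f" if "\<And>j. continuous_on UNIV (\<lambda>x. f x $ j)" for f :: "real^2 \<Rightarrow> real^3"
    using continuous_on_vec_lambda[of UNIV "\<lambda>i x. f x $ i"] that by (simp add: vec_lambda_eta)
  have "continuous_on UNIV (\<lambda>x. sk1 x $ 1)" "continuous_on UNIV (\<lambda>x. sk1 x $ 2)" "continuous_on UNIV (\<lambda>x. sk1 x $ 3)"
    "continuous_on UNIV (\<lambda>x. sk2 x $ 1)" "continuous_on UNIV (\<lambda>x. sk2 x $ 2)" "continuous_on UNIV (\<lambda>x. sk2 x $ 3)"
    unfolding sk1_nth sk2_nth by (intro continuous_intros dc wc qc; simp add: d0)+
  then have "continuous_on UNIV (\<lambda>x. sk1 x $ j)" "continuous_on UNIV (\<lambda>x. sk2 x $ j)" for j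
    using exhaust_3[of j] by auto
  then have "continuous_on UNIV sk1" "continuous_on UNIV sk2" using cv by blast+
  then show ?thesis using norm_sk sk_has_derivative by (simp add: C1_sphere_map_def)
qed

text \<open>Up to sign this is the degree density. Its primitive in \<open>t\<close> is
  \<open>2 mn / dn\<close>, twice the third component of the map, which runs from -1 at the centre
  to 1 at infinity for every admissible profile; so truncation leaves the degree unchanged.\<close>

lemma jac_radial_integral:
  shows "integrable lborel (\<lambda>x::real^2. 4 * L\<^sup>2 * q ((norm x)\<^sup>2) * zn ((norm x)\<^sup>2) / (dn ((norm x)\<^sup>2))\<^sup>2)"
    "(LINT x|lborel. 4 * L\<^sup>2 * q ((norm (x::real^2))\<^sup>2) * zn ((norm x)\<^sup>2) / (dn ((norm x)\<^sup>2))\<^sup>2) = 4 * pi"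
proof -
  define F where "F t = 4 * L\<^sup>2 * q t * zn t / (dn t)\<^sup>2" for t
  define G where "G t = 2 * mn t / dn t" for t
  have [measurable]: "q \<in> borel_measurable borel" "p \<in> borel_measurable borel"
    by (intro borel_measurable_continuous_onI q_cont p_cont)+
  have m: "F \<in> borel_measurable borel" unfolding F_def zn_def dn_def by measurable
  have nn: "0 \<le> F t" if "0 \<le> t" for t
    using that q_ge[OF that] p_le[OF that] by (auto simp: F_def zn_def intro!: divide_nonneg_nonneg mult_nonneg_nonneg order_trans[OF mult_nonneg_nonpos])
  have der: "(G has_real_derivative F t) (at t)" if "0 \<le> t" for t
  proof -
    have d0: "dn t \<noteq> 0" using dn_pos[OF that] by simp
    have dq: "((\<lambda>t. L\<^sup>2 * (q t)\<^sup>2) has_real_derivative L\<^sup>2 * (2 * q t * p t)) (at t)"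
      by (auto intro!: derivative_eq_intros q_der)
    have dm: "((\<lambda>t. 2 * mn t) has_real_derivative 2 * (1 - L\<^sup>2 * (2 * q t * p t))) (at t)"
      unfolding mn_def by (intro DERIV_cmult DERIV_diff DERIV_ident dq)
    have dd: "(dn has_real_derivative 1 + L\<^sup>2 * (2 * q t * p t)) (at t)"
      unfolding dn_def[abs_def] by (intro DERIV_add DERIV_ident dq)
    have "2 * (1 - L\<^sup>2 * (2 * q t * p t)) * dn t - 2 * mn t * (1 + L\<^sup>2 * (2 * q t * p t)) = 4 * L\<^sup>2 * q t * zn t"
      unfolding dn_def mn_def zn_def by algebra
    then show ?thesis
      using DERIV_divide[OF dm dd d0] by (simp add: G_def[abs_def] F_def power2_eq_square)
  qed
  have lim: "(G \<longlongrightarrow> 2) at_top"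
  proof -
    have "((\<lambda>t. G t - 2) \<longlongrightarrow> 0) at_top"
    proof (rule Lim_null_comparison)
      show "\<forall>\<^sub>F t in at_top. norm (G t - 2) \<le> 4 * L\<^sup>2 * inverse t"
        using eventually_gt_at_top[of 0]
      proof eventually_elim
        case (elim t)
        have d: "dn t > 0" "t \<le> dn t" using dn_pos[of t] dn_ge elim by auto
        have "mn t = dn t - 2 * (L\<^sup>2 * (q t)\<^sup>2)" by (simp add: mn_def dn_def)
        then have "G t - 2 = - (4 * L\<^sup>2 * (q t)\<^sup>2 / dn t)" using d by (simp add: G_def diff_divide_distrib right_diff_distrib)
        then have "norm (G t - 2) = 4 * L\<^sup>2 * (q t)\<^sup>2 / dn t" using d by simp
        also have "\<dots> \<le> 4 * L\<^sup>2 * 1 / t"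
          using d elim q_ge[of t] q_le[of t] by (intro frac_le mult_left_mono power_le_one) auto
        finally show ?case by (simp add: divide_inverse)
      qed
      show "((\<lambda>t. 4 * L\<^sup>2 * inverse t) \<longlongrightarrow> 0) at_top"
        by (intro tendsto_mult_right_zero tendsto_inverse_0_at_top filterlim_ident)
    qed
    then show ?thesis by (simp add: LIM_zero_iff)
  qed
  have "G 0 = -2" using L by (simp add: G_def mn_def dn_def q0)
  then show "integrable lborel (\<lambda>x::real^2. 4 * L\<^sup>2 * q ((norm x)\<^sup>2) * zn ((norm x)\<^sup>2) / (dn ((norm x)\<^sup>2))\<^sup>2)"
    "(LINT x|lborel. 4 * L\<^sup>2 * q ((norm (x::real^2))\<^sup>2) * zn ((norm x)\<^sup>2) / (dn ((norm x)\<^sup>2))\<^sup>2) = 4 * pi"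
    using radial_integral[OF m nn der lim] by (simp_all add: F_def)
qed

lemma jac_sk_eq: "jac (sk x) (sk1 x) (sk2 x) = - s * (4 * L\<^sup>2 * q ((norm x)\<^sup>2) * zn ((norm x)\<^sup>2) / (dn ((norm x)\<^sup>2))\<^sup>2)"
  using jac_sk[of x] by (simp add: power_divide)

lemma integral_jac_sk: "(LINT x|lborel. jac (sk x) (sk1 x) (sk2 x)) = - s * (4 * pi)"
  unfolding jac_sk_eq integral_mult_right_zero jac_radial_integral(2) ..

lemma norm_conf_sk_eq: "(norm (conf (- s) (sk x) (sk1 x) (sk2 x)))\<^sup>2 = 16 * L\<^sup>2 * (p ((norm x)\<^sup>2))\<^sup>2 * ((norm x)\<^sup>2)\<^sup>2 / (dn ((norm x)\<^sup>2))\<^sup>2"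
  using norm_conf_sk[of x] by (simp add: power_divide)

lemma grad_sk_eq: "(norm (sk1 x))\<^sup>2 + (norm (sk2 x))\<^sup>2 = 4 * L\<^sup>2 * ((zn ((norm x)\<^sup>2))\<^sup>2 + (q ((norm x)\<^sup>2))\<^sup>2) / (dn ((norm x)\<^sup>2))\<^sup>2"
  using grad_sk[of x] by (simp add: power_divide)

lemma sk3_eq: "1 - sk x $ 3 = 2 * L\<^sup>2 * (q ((norm x)\<^sup>2))\<^sup>2 / dn ((norm x)\<^sup>2)"
  using sk3[of x] by simp

lemma bdefect_sk_eq:
  assumes "s = 1" "L = 2 * r"
  shows "(norm (bdefect r (sk x) (sk1 x) (sk2 x)))\<^sup>2
    = 4 * L^4 * (q ((norm x)\<^sup>2) - (q ((norm x)\<^sup>2))\<^sup>2 - (norm x)\<^sup>2 * p ((norm x)\<^sup>2))\<^sup>2 / (dn ((norm x)\<^sup>2))\<^sup>2"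
  using bdefect_sk[OF assms, of x] by (simp add: power_divide)

end

lemma radial_map_const:
  assumes "0 < L" "s * s = 1" shows "radial_map (\<lambda>_. 1) (\<lambda>_. 0) L s"
  using assms by unfold_locales auto

lemma hsk_r_eq:
  assumes "0 < r"
  shows "hsk_r r = radial_map.sk (\<lambda>_. 1) (2 * r) 1"
proof
  fix x :: "real^2"
  interpret radial_map "\<lambda>_. 1" "\<lambda>_. 0" "2 * r" 1 by (rule radial_map_const) (use assms in auto)
  define T K where "T = (norm x)\<^sup>2" and "K = (2 * r)\<^sup>2"
  have K: "K > 0" "T + K > 0" using assms by (auto simp: K_def T_def intro: add_nonneg_pos)
  have e: "(norm ((1 / (2 * r)) *\<^sub>R x))\<^sup>2 = T / K"
    using assms by (simp add: T_def K_def power_divide power_mult_distrib)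
  have f: "T / K + 1 = (T + K) / K" "T / K - 1 = (T - K) / K" using K by (simp_all add: field_simps)
  have g: "a / (2 * r) / ((T + K) / K) = 2 * r * a / (T + K)" for a
    using assms by (simp add: K_def power2_eq_square)
  have c: "((1 / (2 * r)) *\<^sub>R x) $ i = x $ i / (2 * r)" for i by simp
  show "hsk_r r x = sk x"
    unfolding hsk_r_def vec_eq_iff forall_3 hsk_nth sk_nth e dn_def mn_def T_def[symmetric] K_def[symmetric] c
      power_one mult_1_right f times_divide_eq_right g
    using K by simp
qed

text \<open>For the constant profile with \<open>L = 2 r\<close> both squares with
  \<open>\<sigma> = -1\<close> vanish identically, so the energy is exactly the topological term
  \<open>(2 r^2 - 1) (- 4 pi)\<close>.\<close>

lemma hsk_r_Mspace:
  assumes r: "0 < r"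
  shows "(\<lambda>x. hsk_r r (x - c)) \<in> Mspace" "degree (\<lambda>x. hsk_r r (x - c)) = -1"
    "Energy r (\<lambda>x. hsk_r r (x - c)) = 4 * pi * (1 - 2 * r\<^sup>2)"
proof -
  interpret radial_map "\<lambda>_. 1" "\<lambda>_. 0" "2 * r" 1 by (rule radial_map_const) (use assms in auto)
  have zn1: "zn t = 1" for t by (simp add: zn_def)
  let ?h = "\<lambda>x. hsk_r r (x - c)" and ?a = "\<lambda>x. sk1 (x - c)" and ?b = "\<lambda>x. sk2 (x - c)"
  have C: "C1_sphere_map ?h ?a ?b"
    unfolding hsk_r_eq[OF r] by (rule C1_sphere_map_translate[OF C1_sk])
  note w = C1_sphere_map_weak_grad[OF C]
  have n1: "norm (?h x) = 1" for x using C by (simp add: C1_sphere_map_def)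
  \<comment> \<open>With \<open>q = zn = 1\<close> the gradient density is twice the absolute degree
    density; likewise the potential term below is \<open>L^2\<close> times it.\<close>
  have iD0: "integrable lborel (\<lambda>x. (norm (sk1 x))\<^sup>2 + (norm (sk2 x))\<^sup>2)"
    unfolding grad_sk_eq using integrable_mult_right[OF jac_radial_integral(1), of 2] by (simp add: zn1)
  have iD: "integrable lebesgue (\<lambda>x. (norm (jointgrad ?a ?b 1 x))\<^sup>2 + (norm (jointgrad ?a ?b 2 x))\<^sup>2)"
    using integrable_lebesgue_borel[OF lborel_integrable_translate[OF iD0, of "- c"]] by simp
  have iV0: "integrable lborel (\<lambda>x. (1 - sk x $ 3)\<^sup>2)"
    unfolding sk3_eq using integrable_mult_right[OF jac_radial_integral(1), of "(2 * r)\<^sup>2"]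
    by (simp add: zn1 power_divide power_mult_distrib mult_ac power4_eq_xxxx power2_eq_square)
  have iV: "integrable lebesgue (\<lambda>x. (1 - ?h x $ 3)\<^sup>2)"
    using integrable_lebesgue_borel[OF lborel_integrable_translate[OF iV0, of "- c"]] by (simp add: hsk_r_eq[OF r])
  have s2: "(-1::real)\<^sup>2 = 1" by simp
  note f = energy_formula[OF w n1 iD iV r s2]
  show "?h \<in> Mspace" by (rule f(1))
  have ij: "integrable lborel (\<lambda>x. jac (sk x) (sk1 x) (sk2 x))"
    unfolding jac_sk_eq using jac_radial_integral(1) by simp
  have "(LINT x|lebesgue. jac (?h x) (jointgrad ?a ?b 1 x) (jointgrad ?a ?b 2 x)) = (LINT x|lborel. jac (sk (x - c)) (sk1 (x - c)) (sk2 (x - c)))"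
    unfolding hsk_r_eq[OF r] using lborel_integrable_translate[OF ij, of "- c"]
    by (simp add: integral_lebesgue_borel)
  also have "\<dots> = - (4 * pi)"
    using lborel_integral_translate[of "\<lambda>x. jac (sk x) (sk1 x) (sk2 x)" "- c"] ij integral_jac_sk by simp
  finally show dg: "degree ?h = -1"
    using f(2) by simp
  have 1: "(norm (conf (- 1) (sk y) (sk1 y) (sk2 y)))\<^sup>2 = 0" for y
    using norm_conf_sk_eq[of y] by simp
  have 2: "(norm (bdefect r (sk y) (sk1 y) (sk2 y)))\<^sup>2 = 0" for y
    using bdefect_sk_eq[of r y] by simp
  have I1: "(norm (conf (- 1) (?h x) (?a x) (?b x)))\<^sup>2 = 0" for x
    by (simp only: hsk_r_eq[OF r] 1)
  have I2: "(norm (bdefect r (?h x) (?a x) (?b x)))\<^sup>2 = 0" for x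
    by (simp only: hsk_r_eq[OF r] 2)
  show "Energy r ?h = 4 * pi * (1 - 2 * r\<^sup>2)"
    using f(5) unfolding dg jointgrad_simps I1 I2 by (simp add: algebra_simps)
qed

section \<open>Truncated bubbles and the main theorem\<close>

lemma DERIV_max_0_squared: "((\<lambda>u. (max 0 u)\<^sup>2) has_real_derivative 2 * max 0 u) (at u)"
proof -
  consider "u > 0" | "u < 0" | "u = 0" by linarith
  then show ?thesis
  proof cases
    case 1
    have "((\<lambda>u. u\<^sup>2) has_real_derivative 2 * max 0 u) (at u)"
      using 1 by (auto intro!: derivative_eq_intros)
    moreover have "\<forall>\<^sub>F v in nhds u. (max 0 v)\<^sup>2 = v\<^sup>2"
      using eventually_nhds_in_open[of "{0<..}" u] 1 by (auto elim!: eventually_mono)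
    ultimately show ?thesis by (subst DERIV_cong_ev) auto
  next
    case 2
    have "((\<lambda>u. 0) has_real_derivative 2 * max 0 u) (at u)" using 2 by simp
    moreover have "\<forall>\<^sub>F v in nhds u. (max 0 v)\<^sup>2 = 0"
      using eventually_nhds_in_open[of "{..<0}" u] 2 by (auto elim!: eventually_mono)
    ultimately show ?thesis by (subst DERIV_cong_ev) auto
  next
    case 3
    have "((\<lambda>h::real. ((max 0 (0 + h))\<^sup>2 - (max 0 0)\<^sup>2) / h) \<longlongrightarrow> 0) (at 0)"
    proof (rule Lim_null_comparison)
      show "\<forall>\<^sub>F h in at 0. norm (((max 0 (0 + h))\<^sup>2 - (max 0 0)\<^sup>2) / h) \<le> \<bar>h\<bar>" for h :: real
      proof (rule always_eventually, rule allI)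
        fix h :: real
        show "norm (((max 0 (0 + h))\<^sup>2 - (max 0 0)\<^sup>2) / h) \<le> \<bar>h\<bar>"
          by (cases "h > 0") (auto simp: power2_eq_square)
      qed
      show "((\<lambda>h. \<bar>h\<bar>) \<longlongrightarrow> (0::real)) (at 0)" by (auto intro!: tendsto_eq_intros)
    qed
    then show ?thesis using 3 by (simp add: DERIV_def)
  qed
qed

text \<open>The square makes the cutoff continuously differentiable at \<open>t = T\<close>. The
  parameter \<open>T\<close> is a squared radius, and the cutoff acts on the inverse stereographic
  coordinate.\<close>

definition cutq :: "real \<Rightarrow> real \<Rightarrow> real" where "cutq T t = (max 0 (1 - t / T))\<^sup>2"
definition cutp :: "real \<Rightarrow> real \<Rightarrow> real" where "cutp T t = - (2 / T) * max 0 (1 - t / T)"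

lemma radial_map_cut:
  assumes "0 < T" "0 < L" "s * s = 1"
  shows "radial_map (cutq T) (cutp T) L s"
proof
  show "(cutq T has_real_derivative cutp T t) (at t)" for t
  proof -
    have "((\<lambda>t. 1 - t / T) has_real_derivative - (1 / T)) (at t)"
      using assms(1) by (auto intro!: derivative_eq_intros)
    from DERIV_chain2[OF DERIV_max_0_squared this] show ?thesis
      by (simp add: cutq_def[abs_def] cutp_def)
  qed
  show "continuous_on UNIV (cutp T)" unfolding cutp_def using assms by (intro continuous_intros) auto
  show "cutq T t \<le> 1" if "0 \<le> t" for t
    unfolding cutq_def using assms(1) that by (intro power_le_one) auto
  show "cutp T t \<le> 0" for t
    using assms(1) by (simp add: cutp_def)
qed (use assms in \<open>auto simp: cutq_def\<close>)

lemma cut_0: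
  assumes "0 < T" "T < t" shows "cutq T t = 0" "cutp T t = 0"
  using assms by (auto simp: cutq_def cutp_def)

lemma cutp_squared_le:
  assumes "0 < T" "0 \<le> t" shows "(cutp T t)\<^sup>2 \<le> 4 / T\<^sup>2"
proof -
  have "(max 0 (1 - t / T))\<^sup>2 \<le> 1" using assms by (intro power_le_one) auto
  then show ?thesis by (simp add: cutp_def power_mult_distrib power_divide divide_right_mono)
qed

text \<open>With \<open>u = 1 - t / T\<close> the expression is
  \<open>u^2 (1 - u^2) + 2 u (1 - u)\<close>, and both summands are at most
  \<open>2 (1 - u) = 2 t / T\<close>. A bound linear in \<open>t\<close> is wanted because division
  by \<open>dn t \<ge> t\<close> then leaves a constant.\<close>

lemma cut_defect_le:
  assumes "0 < T" "0 \<le> t"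
  shows "\<bar>cutq T t - (cutq T t)\<^sup>2 - t * cutp T t\<bar> \<le> 4 * t / T"
proof (cases "t \<le> T")
  case True
  define u where "u = 1 - t / T"
  have u: "0 \<le> u" "u \<le> 1" "t / T = 1 - u" using True assms by (auto simp: u_def)
  have "max 0 (1 - t / T) = u" using u(1) unfolding u_def by (rule max_absorb2)
  then have e: "cutq T t = u\<^sup>2" "t * cutp T t = - (2 * (t / T) * u)" by (simp_all add: cutq_def cutp_def)
  have "u\<^sup>2 \<le> 1" using u by (intro power_le_one) auto
  then have a: "0 \<le> u\<^sup>2 * (1 - u\<^sup>2)" "u\<^sup>2 * (1 - u\<^sup>2) \<le> 1 - u\<^sup>2"
    by (auto intro!: mult_nonneg_nonneg mult_left_le_one_le)
  have "1 - u\<^sup>2 = (1 - u) * (1 + u)" by (simp add: power2_eq_square algebra_simps)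
  also have "\<dots> \<le> (1 - u) * 2" using u by (intro mult_left_mono) auto
  finally have b: "1 - u\<^sup>2 \<le> 2 * (1 - u)" by simp
  have c: "0 \<le> (1 - u) * u" "(1 - u) * u \<le> 1 - u" using u by (auto intro!: mult_nonneg_nonneg mult_right_le_one_le)
  have "cutq T t - (cutq T t)\<^sup>2 - t * cutp T t = u\<^sup>2 * (1 - u\<^sup>2) + 2 * ((1 - u) * u)"
    unfolding e u(3) by (simp add: power2_eq_square algebra_simps)
  moreover have "\<bar>A + 2 * B\<bar> \<le> 4 * (1 - u)"
    if "0 \<le> A" "A \<le> C" "C \<le> 2 * (1 - u)" "0 \<le> B" "B \<le> 1 - u" for A B C :: real
  proof -
    have "0 \<le> 2 * B" "2 * B \<le> 2 * (1 - u)" using that(4,5) by simp_all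
    then have "A + 2 * B \<le> 2 * (1 - u) + 2 * (1 - u)"
      using that(2,3) by (intro add_mono order_trans[of A C "2 * (1 - u)"])
    moreover have "\<bar>A + 2 * B\<bar> = A + 2 * B"
      using that(1,4) by (intro abs_of_nonneg add_nonneg_nonneg) auto
    ultimately show ?thesis by simp
  qed
  note this[OF a b c]
  ultimately have "\<bar>cutq T t - (cutq T t)\<^sup>2 - t * cutp T t\<bar> \<le> 4 * (1 - u)" by simp
  then show ?thesis using u(3) by simp
next
  case False
  then show ?thesis using assms cut_0[of T t] by simp
qed

lemma bubble_cut:
  assumes "0 < T" "0 < L" "s * s = 1"
  shows "bubble (radial_map.sk (cutq T) L s) (radial_map.sk1 (cutq T) (cutp T) L s) (radial_map.sk2 (cutq T) (cutp T) L s) (sqrt T)"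
proof -
  interpret radial_map "cutq T" "cutp T" L s by (rule radial_map_cut[OF assms])
  have "sk x = e3 \<and> sk1 x = 0 \<and> sk2 x = 0" if x: "sqrt T < norm x" for x
  proof -
    have T: "T < (norm x)\<^sup>2" using x assms(1) by (metis real_less_rsqrt real_sqrt_less_iff norm_ge_zero real_sqrt_pow2 real_sqrt_unique)
    then have "(norm x)\<^sup>2 \<noteq> 0" using assms(1) by linarith
    then show ?thesis
      using cut_0[OF assms(1) T]
      by (simp add: vec_eq_iff forall_3 sk_nth sk1_nth sk2_nth e3_nth mn_def dn_def wn_def zn_def)
  qed
  then show ?thesis using C1_sk by (simp add: bubble_def)
qed

lemma integral_le_disc:
  fixes f :: "real^2 \<Rightarrow> real"
  assumes f: "integrable lebesgue f" and T: "0 < T" and b: "\<And>x. f x \<le> c" and z: "\<And>x. T < (norm x)\<^sup>2 \<Longrightarrow> f x \<le> 0"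
  shows "(LINT x|lebesgue. f x) \<le> c * (pi * T)"
proof -
  have i: "integrable lebesgue (\<lambda>x. indicator (cball (0::real^2) (sqrt T)) x * c)"
    by (rule integrable_lebesgue_borel[OF integrable_indicator_cball])
  have "(LINT x|lebesgue. f x) \<le> (LINT x|lebesgue. indicator (cball (0::real^2) (sqrt T)) x * c)"
  proof (rule integral_mono[OF f i])
    fix x :: "real^2"
    show "f x \<le> indicator (cball (0::real^2) (sqrt T)) x * c"
    proof (cases "norm x \<le> sqrt T")
      case False
      then have "T < (norm x)\<^sup>2" using real_le_rsqrt[of "norm x" T] by (meson not_le)
      then show ?thesis using z False by simp
    qed (use b in simp)
  qed
  also have "\<dots> = measure lborel (cball (0::real^2) (sqrt T)) * c" by simp
  also have "measure lborel (cball (0::real^2) (sqrt T)) = pi * T"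
    using T emeasure_cball[of "sqrt T" "0::real^2"] by (simp add: measure_def unit_ball_vol_2)
  finally show ?thesis by (simp add: mult_ac)
qed

lemma divide_squares_le_1:
  fixes t d :: real assumes "0 \<le> t" "t \<le> d" shows "t\<^sup>2 / d\<^sup>2 \<le> 1"
  using assms by (cases "d = 0") (auto intro!: divide_le_eq_1_pos[THEN iffD2] power_mono)

lemma bubble_energy:
  assumes B: "bubble n a b R" and r: "0 < r" and \<sigma>: "\<sigma>\<^sup>2 = 1"
  shows "integrable lebesgue (\<lambda>x. (norm (conf \<sigma> (n x) (a x) (b x)))\<^sup>2)"
    "integrable lebesgue (\<lambda>x. (norm (bdefect r (n x) (a x) (b x)))\<^sup>2)"
    "(LINT x|lborel. edens r (n x) (a x) (b x)) = (1 - r\<^sup>2) / 2 * (LINT x|lebesgue. (norm (conf \<sigma> (n x) (a x) (b x)))\<^sup>2)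
      + (LINT x|lebesgue. (norm (bdefect r (n x) (a x) (b x)))\<^sup>2) / 2
      + (\<sigma> * (1 - r\<^sup>2) + r\<^sup>2) * (LINT x|lborel. jac (n x) (a x) (b x))"
proof -
  have C: "C1_sphere_map n a b" using B by (simp add: bubble_def)
  have n1: "norm (n x) = 1" for x using C by (simp add: C1_sphere_map_def)
  note i = bubble_integrable[OF B]
  have D: "integrable lebesgue (\<lambda>x. (norm (jointgrad a b 1 x))\<^sup>2 + (norm (jointgrad a b 2 x))\<^sup>2)"
    using integrable_lebesgue_borel[OF i(3)] by simp
  note f = energy_formula[OF C1_sphere_map_weak_grad[OF C] n1 D integrable_lebesgue_borel[OF i(4)] r \<sigma>]
  show "integrable lebesgue (\<lambda>x. (norm (conf \<sigma> (n x) (a x) (b x)))\<^sup>2)"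
    "integrable lebesgue (\<lambda>x. (norm (bdefect r (n x) (a x) (b x)))\<^sup>2)"
    using f(3,4) by simp_all
  show "(LINT x|lborel. edens r (n x) (a x) (b x)) = (1 - r\<^sup>2) / 2 * (LINT x|lebesgue. (norm (conf \<sigma> (n x) (a x) (b x)))\<^sup>2)
      + (LINT x|lebesgue. (norm (bdefect r (n x) (a x) (b x)))\<^sup>2) / 2
      + (\<sigma> * (1 - r\<^sup>2) + r\<^sup>2) * (LINT x|lborel. jac (n x) (a x) (b x))"
    using f(5) bubble_Mspace(2,3)[OF B r] by simp
qed

text \<open>On the disc of area \<open>pi * T\<close> both squares are of order
  \<open>1 / T^2\<close>, so the excess over the topological term is of order
  \<open>1 / T\<close>.\<close>

lemma bubble_neg:
  assumes r: "0 < r" "r < 1" and \<epsilon>: "\<epsilon> > 0"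
  shows "\<exists>n a b R. bubble n a b R \<and> (LINT x|lborel. jac (n x) (a x) (b x)) = - (4 * pi) \<and>
    (LINT x|lborel. edens r (n x) (a x) (b x)) \<le> 4 * pi * (1 - 2 * r\<^sup>2) + \<epsilon>"
proof -
  define L where "L = 2 * r"
  \<comment> \<open>Chosen so that the two errors \<open>32 pi L^2 / T\<close> and
    \<open>32 pi L^4 / T\<close> add up to \<open>\<epsilon>\<close>.\<close>
  define T where "T = 32 * pi * (L\<^sup>2 + L^4) / \<epsilon>"
  have L: "0 < L" using r by (simp add: L_def)
  have T: "0 < T" using L \<epsilon> by (auto simp: T_def intro!: divide_pos_pos mult_pos_pos add_pos_pos)
  interpret radial_map "cutq T" "cutp T" L 1 by (rule radial_map_cut) (use T L in auto)
  have B: "bubble sk sk1 sk2 (sqrt T)" by (rule bubble_cut) (use T L in auto)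
  have s2: "(-1::real)\<^sup>2 = 1" by simp
  note e = bubble_energy[OF B r(1) s2]
  have J: "(LINT x|lborel. jac (sk x) (sk1 x) (sk2 x)) = - (4 * pi)" using integral_jac_sk by simp
  have td: "((norm x)\<^sup>2)\<^sup>2 / (dn ((norm x)\<^sup>2))\<^sup>2 \<le> 1" for x :: "real^2"
    by (rule divide_squares_le_1[OF zero_le_power2 dn_ge])
  have I1: "(LINT x|lebesgue. (norm (conf (-1) (sk x) (sk1 x) (sk2 x)))\<^sup>2) \<le> 16 * L\<^sup>2 * (4 / T\<^sup>2) * (pi * T)"
  proof (rule integral_le_disc[OF e(1) T])
    fix x :: "real^2"
    have "16 * L\<^sup>2 * (cutp T ((norm x)\<^sup>2))\<^sup>2 * (((norm x)\<^sup>2)\<^sup>2 / (dn ((norm x)\<^sup>2))\<^sup>2) \<le> 16 * L\<^sup>2 * (4 / T\<^sup>2) * 1"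
      by (intro mult_mono mult_left_mono td cutp_squared_le T) auto
    then show "(norm (conf (-1) (sk x) (sk1 x) (sk2 x)))\<^sup>2 \<le> 16 * L\<^sup>2 * (4 / T\<^sup>2)"
      using norm_conf_sk_eq[of x] by simp
    show "(norm (conf (-1) (sk x) (sk1 x) (sk2 x)))\<^sup>2 \<le> 0" if "T < (norm x)\<^sup>2"
      using norm_conf_sk_eq[of x] cut_0[OF T that] by simp
  qed
  have I2: "(LINT x|lebesgue. (norm (bdefect r (sk x) (sk1 x) (sk2 x)))\<^sup>2) \<le> 4 * L^4 * (16 / T\<^sup>2) * (pi * T)"
  proof (rule integral_le_disc[OF e(2) T])
    fix x :: "real^2"
    let ?t = "(norm x)\<^sup>2"
    note h = bdefect_sk_eq[OF refl L_def, of x]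
    have "(cutq T ?t - (cutq T ?t)\<^sup>2 - ?t * cutp T ?t)\<^sup>2 \<le> (4 * ?t / T)\<^sup>2"
      using cut_defect_le[OF T, of ?t] power_mono[OF cut_defect_le[OF T, of ?t] abs_ge_zero, of 2] by simp
    then have "(cutq T ?t - (cutq T ?t)\<^sup>2 - ?t * cutp T ?t)\<^sup>2 / (dn ?t)\<^sup>2 \<le> (4 * ?t / T)\<^sup>2 / (dn ?t)\<^sup>2"
      by (rule divide_right_mono) simp
    also have "\<dots> = 16 / T\<^sup>2 * (?t\<^sup>2 / (dn ?t)\<^sup>2)" by (simp add: power_divide power_mult_distrib)
    also have "\<dots> \<le> 16 / T\<^sup>2 * 1" by (intro mult_left_mono td) auto
    finally have "4 * L^4 * ((cutq T ?t - (cutq T ?t)\<^sup>2 - ?t * cutp T ?t)\<^sup>2 / (dn ?t)\<^sup>2) \<le> 4 * L^4 * (16 / T\<^sup>2)"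
      by (intro mult_left_mono) auto
    then show "(norm (bdefect r (sk x) (sk1 x) (sk2 x)))\<^sup>2 \<le> 4 * L^4 * (16 / T\<^sup>2)"
      using h by simp
    show "(norm (bdefect r (sk x) (sk1 x) (sk2 x)))\<^sup>2 \<le> 0" if "T < (norm x)\<^sup>2"
      using h cut_0[OF T that] by simp
  qed
  have nn: "0 \<le> (LINT x|lebesgue. (norm (conf (-1) (sk x) (sk1 x) (sk2 x)))\<^sup>2)" by (intro integral_nonneg_AE) simp
  have "(1 - r\<^sup>2) / 2 * (LINT x|lebesgue. (norm (conf (-1) (sk x) (sk1 x) (sk2 x)))\<^sup>2)
      \<le> 1 / 2 * (16 * L\<^sup>2 * (4 / T\<^sup>2) * (pi * T))"
    by (intro mult_mono I1 nn) auto
  also have "\<dots> = 32 * pi * L\<^sup>2 / T" using T by (simp add: power2_eq_square)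
  finally have J1: "(1 - r\<^sup>2) / 2 * (LINT x|lebesgue. (norm (conf (-1) (sk x) (sk1 x) (sk2 x)))\<^sup>2) \<le> 32 * pi * L\<^sup>2 / T" .
  have "4 * L^4 * (16 / T\<^sup>2) * (pi * T) = 64 * pi * L^4 / T" using T by (simp add: power2_eq_square)
  then have J2: "(LINT x|lebesgue. (norm (bdefect r (sk x) (sk1 x) (sk2 x)))\<^sup>2) / 2 \<le> 32 * pi * L^4 / T"
    using I2 by simp
  have "32 * pi * L\<^sup>2 / T + 32 * pi * L^4 / T = 32 * pi * (L\<^sup>2 + L^4) / T"
    by (simp add: add_divide_distrib distrib_left)
  also have "\<dots> = \<epsilon>"
  proof -
    have "L\<^sup>2 + L^4 > 0" using L by (intro add_pos_pos) auto
    then show ?thesis using \<epsilon> by (simp add: T_def)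
  qed
  finally have "(LINT x|lborel. edens r (sk x) (sk1 x) (sk2 x)) \<le> \<epsilon> + ((-1) * (1 - r\<^sup>2) + r\<^sup>2) * (- (4 * pi))"
    using e(3) J J1 J2 by simp
  also have "\<dots> = 4 * pi * (1 - 2 * r\<^sup>2) + \<epsilon>" by (simp add: algebra_simps)
  finally show ?thesis using B J by blast
qed

text \<open>The opposite orientation \<open>s = -1\<close> changes the sign of the degree. Here the
  cutoff radius stays 1 and the size \<open>L\<close> tends to zero: the conformality defect, and
  with it the potential, are of order \<open>L^2\<close>, so no smallness is required of the
  helicity term itself.\<close>

lemma bubble_pos:
  assumes r: "0 < r" "r < 1" and \<epsilon>: "\<epsilon> > 0"
  shows "\<exists>n a b R. bubble n a b R \<and> (LINT x|lborel. jac (n x) (a x) (b x)) = 4 * pi \<and>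
    (LINT x|lborel. edens r (n x) (a x) (b x)) \<le> 4 * pi + \<epsilon>"
proof -
  \<comment> \<open>The weighted squares contribute at most \<open>32 pi L^2\<close> and
    \<open>68 pi L^2\<close>, whence the 100.\<close>
  define L where "L = sqrt (\<epsilon> / (100 * pi))"
  have L_eps: "0 < L" "L\<^sup>2 = \<epsilon> / (100 * pi)" using \<epsilon> by (auto simp: L_def)
  interpret radial_map "cutq 1" "cutp 1" L "-1" by (rule radial_map_cut) (use L_eps in auto)
  interpret K: radial_map "\<lambda>_. 1" "\<lambda>_. 0" L 1 by (rule radial_map_const) (use L_eps in auto)
  have B: "bubble sk sk1 sk2 (sqrt 1)" by (rule bubble_cut) (use L_eps in auto)
  have T: "0 < (1::real)" by simp
  have s2: "(1::real)\<^sup>2 = 1" by simp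
  note e = bubble_energy[OF B r(1) s2]
  have r2: "r\<^sup>2 \<le> 1" using r by (simp add: power_le_one)
  have J: "(LINT x|lborel. jac (sk x) (sk1 x) (sk2 x)) = 4 * pi" using integral_jac_sk by simp
  have td: "((norm x)\<^sup>2)\<^sup>2 / (dn ((norm x)\<^sup>2))\<^sup>2 \<le> 1" for x :: "real^2"
    by (rule divide_squares_le_1[OF zero_le_power2 dn_ge])
  have I1: "(LINT x|lebesgue. (norm (conf 1 (sk x) (sk1 x) (sk2 x)))\<^sup>2) \<le> 16 * L\<^sup>2 * (4 / 1\<^sup>2) * (pi * 1)"
  proof (rule integral_le_disc[OF e(1) T])
    fix x :: "real^2"
    have "16 * L\<^sup>2 * (cutp 1 ((norm x)\<^sup>2))\<^sup>2 * (((norm x)\<^sup>2)\<^sup>2 / (dn ((norm x)\<^sup>2))\<^sup>2) \<le> 16 * L\<^sup>2 * (4 / 1\<^sup>2) * 1"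
      by (intro mult_mono mult_left_mono td cutp_squared_le T) auto
    then show "(norm (conf 1 (sk x) (sk1 x) (sk2 x)))\<^sup>2 \<le> 16 * L\<^sup>2 * (4 / 1\<^sup>2)"
      using norm_conf_sk_eq[of x] by simp
    show "(norm (conf 1 (sk x) (sk1 x) (sk2 x)))\<^sup>2 \<le> 0" if "1 < (norm x)\<^sup>2"
      using norm_conf_sk_eq[of x] cut_0[OF T that] by simp
  qed
  \<comment> \<open>The absolute degree density of the untruncated bubble of size \<open>L\<close>,
    with known integral \<open>4 pi\<close>. It majorises the potential density, since
    \<open>q^2 / (t + L^2 q^2)\<close> for \<open>0 \<le> q \<le> 1\<close> is largest at
    \<open>q = 1\<close>.\<close>
  define g where "g x = 4 * L\<^sup>2 / ((norm x)\<^sup>2 + L\<^sup>2)\<^sup>2" for x :: "real^2"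
  have gi: "integrable lborel g" "(LINT x|lborel. g x) = 4 * pi"
    using K.jac_radial_integral by (simp_all add: g_def[abs_def] K.zn_def K.dn_def)
  have V: "(1 - sk x $ 3)\<^sup>2 \<le> L\<^sup>2 * g x" for x
  proof -
    let ?t = "(norm x)\<^sup>2" and ?q = "cutq 1 ((norm x)\<^sup>2)"
    have d: "dn ?t > 0" by (rule dn_pos) simp
    have q: "?q\<^sup>2 \<le> 1" using q_le[of ?t] q_ge[of ?t] by (simp add: power_le_one)
    have p: "?t + L\<^sup>2 > 0" using L_eps(1) by (simp add: add_nonneg_pos)
    have "?q\<^sup>2 * ?t \<le> ?t"
      using mult_right_mono[OF q, of ?t] by simp
    then have "?q\<^sup>2 * ?t + ?q\<^sup>2 * L\<^sup>2 \<le> dn ?t" by (simp add: dn_def mult.commute)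
    then have "?q\<^sup>2 * (?t + L\<^sup>2) \<le> dn ?t" by (simp only: distrib_left)
    then have "?q\<^sup>2 / dn ?t \<le> 1 / (?t + L\<^sup>2)"
      using d p by (simp add: field_simps)
    then have "(?q\<^sup>2 / dn ?t)\<^sup>2 \<le> (1 / (?t + L\<^sup>2))\<^sup>2"
      using d by (intro power_mono) auto
    then have "4 * L^4 * (?q\<^sup>2 / dn ?t)\<^sup>2 \<le> 4 * L^4 * (1 / (?t + L\<^sup>2))\<^sup>2"
      by (intro mult_left_mono) auto
    moreover have "(1 - sk x $ 3)\<^sup>2 = 4 * L^4 * (?q\<^sup>2 / dn ?t)\<^sup>2"
      unfolding sk3_eq by (simp add: power_divide power_mult_distrib)
    moreover have "L\<^sup>2 * g x = 4 * L^4 * (1 / (?t + L\<^sup>2))\<^sup>2"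
      by (simp add: g_def power_divide power4_eq_xxxx power2_eq_square)
    ultimately show ?thesis by simp
  qed
  have gL: "integrable lebesgue g" "(LINT x|lebesgue. g x) = 4 * pi"
    using gi integrable_lebesgue_borel integral_lebesgue_borel[of g] by auto
  have "(LINT x|lebesgue. (norm (bdefect r (sk x) (sk1 x) (sk2 x)))\<^sup>2)
    \<le> (LINT x|lebesgue. 2 * (norm (conf 1 (sk x) (sk1 x) (sk2 x)))\<^sup>2 + 2 * (L\<^sup>2 * g x))"
  proof (rule integral_mono[OF e(2)])
    show "integrable lebesgue (\<lambda>x. 2 * (norm (conf 1 (sk x) (sk1 x) (sk2 x)))\<^sup>2 + 2 * (L\<^sup>2 * g x))"
      using e(1) gL(1) by simp
    fix x
    have "r\<^sup>2 * (norm (conf 1 (sk x) (sk1 x) (sk2 x)))\<^sup>2 \<le> (norm (conf 1 (sk x) (sk1 x) (sk2 x)))\<^sup>2"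
      using r2 by (intro mult_left_le_one_le) auto
    then show "(norm (bdefect r (sk x) (sk1 x) (sk2 x)))\<^sup>2 \<le> 2 * (norm (conf 1 (sk x) (sk1 x) (sk2 x)))\<^sup>2 + 2 * (L\<^sup>2 * g x)"
      using bdefect_le[OF norm_sk, of r x "sk1 x" "sk2 x"] V[of x] r by simp
  qed
  also have "\<dots> = 2 * (LINT x|lebesgue. (norm (conf 1 (sk x) (sk1 x) (sk2 x)))\<^sup>2) + 2 * (L\<^sup>2 * (4 * pi))"
    using e(1) gL by simp
  also have "\<dots> \<le> 2 * (16 * L\<^sup>2 * (4 / 1\<^sup>2) * (pi * 1)) + 2 * (L\<^sup>2 * (4 * pi))"
    by (intro add_right_mono mult_left_mono I1) simp
  also have "\<dots> = 136 * pi * L\<^sup>2" by simp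
  finally have I2: "(LINT x|lebesgue. (norm (bdefect r (sk x) (sk1 x) (sk2 x)))\<^sup>2) \<le> 136 * pi * L\<^sup>2" .
  have nn: "0 \<le> (LINT x|lebesgue. (norm (conf 1 (sk x) (sk1 x) (sk2 x)))\<^sup>2)" by (intro integral_nonneg_AE) simp
  have J1: "(1 - r\<^sup>2) / 2 * (LINT x|lebesgue. (norm (conf 1 (sk x) (sk1 x) (sk2 x)))\<^sup>2)
      \<le> 1 / 2 * (16 * L\<^sup>2 * (4 / 1\<^sup>2) * (pi * 1))"
    by (intro mult_mono I1 nn) auto
  have "100 * pi * L\<^sup>2 = \<epsilon>" using L_eps(2) by simp
  then have "(LINT x|lborel. edens r (sk x) (sk1 x) (sk2 x)) \<le> 4 * pi + \<epsilon>"
    using e(3) J J1 I2 by simp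
  then show ?thesis using B J by blast
qed

text \<open>\<open>grad\<close> is selected separately for each map, so equality almost everywhere
  does not transfer by itself. But \<open>grad n\<close> is also a weak gradient of
  \<open>m\<close>, and the degree may be computed with any weak gradient.\<close>

lemma degree_cong_AE:
  assumes n: "n \<in> Mspace" and m: "m \<in> Mspace" and eq: "AE x in lebesgue. n x = m x"
  shows "degree n = degree m"
proof -
  note N = MspaceD[OF n] and M = MspaceD[OF m]
  have w: "is_weak_grad m (grad n)"
    unfolding is_weak_grad_def
  proof (intro conjI allI impI)
    show "m \<in> borel_measurable lebesgue" using M(1) by (simp add: is_weak_grad_def)
    show "grad n i \<in> borel_measurable lebesgue" for i using N(1) by (simp add: is_weak_grad_def)
    show "set_integrable lebesgue K (\<lambda>x. (norm (grad n i x))\<^sup>2)" if "compact K" for i K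
      using N(1) that by (simp add: is_weak_grad_def)
    fix \<phi> i j assume t: "test_fun \<phi>"
    have pm: "pd \<phi> i \<in> borel_measurable lebesgue"
      using test_fun_borel(2)[OF t] by (auto intro: measurable_completion)
    have "(LINT x|lebesgue. m x $ j * pd \<phi> i x) = (LINT x|lebesgue. n x $ j * pd \<phi> i x)"
    proof (rule integral_cong_AE)
      show "AE x in lebesgue. m x $ j * pd \<phi> i x = n x $ j * pd \<phi> i x" using eq by eventually_elim simp
    qed (use N(1) M(1) pm in \<open>auto simp: is_weak_grad_def intro!: borel_measurable_times lebesgue_component\<close>)
    then show "(LINT x|lebesgue. m x $ j * pd \<phi> i x) = - (LINT x|lebesgue. grad n i x $ j * \<phi> x)"
      using N(1) t by (simp add: is_weak_grad_def)
  qed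
  have [measurable]: "(\<lambda>x. n x $ j) \<in> borel_measurable lebesgue" "(\<lambda>x. m x $ j) \<in> borel_measurable lebesgue"
    "(\<lambda>x. grad n i x $ j) \<in> borel_measurable lebesgue" for i j
    using N(1) M(1) by (auto simp: is_weak_grad_def intro!: lebesgue_component)
  have "(LINT x|lebesgue. jac (n x) (grad n 1 x) (grad n 2 x)) = (LINT x|lebesgue. jac (m x) (grad n 1 x) (grad n 2 x))"
  proof (rule integral_cong_AE)
    show "AE x in lebesgue. jac (n x) (grad n 1 x) (grad n 2 x) = jac (m x) (grad n 1 x) (grad n 2 x)"
      using eq by eventually_elim simp
  qed (unfold jac_eq, measurable)
  then show ?thesis
    using energy_formula(2)[OF w M(2) N(3) M(4), of 1 1] energy_formula(2)[OF N, of 1 1] by simp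
qed

text \<open>A real-valued \<open>INF\<close> is a genuine lower bound only on a set bounded below;
  the bound with \<open>\<sigma> = 1\<close> supplies this in every degree.\<close>

lemma is_minimizer_iff:
  assumes r: "0 < r" "r < 1"
  shows "is_minimizer r k n \<longleftrightarrow> n \<in> Mdeg k \<and> (\<forall>m\<in>Mdeg k. Energy r n \<le> Energy r m)"
proof -
  have bdd: "bdd_below (Energy r ` Mdeg k)"
  proof (rule bdd_belowI2)
    fix m assume "m \<in> Mdeg k"
    then have "m \<in> Mspace" "degree m = of_int k" by (auto simp: Mdeg_def)
    then show "4 * pi * of_int k \<le> Energy r m"
      using energy_lower_bound[OF _ r power_one[of 2]] by fastforce
  qed
  show ?thesis
  proof
    assume "is_minimizer r k n"
    then show "n \<in> Mdeg k \<and> (\<forall>m\<in>Mdeg k. Energy r n \<le> Energy r m)"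
      using cINF_lower[OF bdd] by (auto simp: is_minimizer_def)
  next
    assume n: "n \<in> Mdeg k \<and> (\<forall>m\<in>Mdeg k. Energy r n \<le> Energy r m)"
    then have "Energy r n = (INF m\<in>Mdeg k. Energy r m)"
      using bdd by (intro antisym cINF_greatest cINF_lower) auto
    with n show "is_minimizer r k n" by (simp add: is_minimizer_def)
  qed
qed

text \<open>Competitors of degree \<open>\<sigma> * j\<close> are \<open>j\<close> disjoint copies of a bubble of degree \<open>\<sigma>\<close>.\<close>

lemma minimizer_energy_le:
  assumes r: "0 < r" "r < 1" and min: "is_minimizer r k n" and k: "k = \<sigma> * int j"
    and bub: "\<And>\<epsilon>. \<epsilon> > 0 \<Longrightarrow> \<exists>n a b R. bubble n a b R \<and> (LINT x|lborel. jac (n x) (a x) (b x)) = of_int \<sigma> * (4 * pi) \<and>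
      (LINT x|lborel. edens r (n x) (a x) (b x)) \<le> e + \<epsilon>"
  shows "Energy r n \<le> real j * e"
proof (rule field_le_epsilon)
  fix \<epsilon> :: real assume \<epsilon>: "\<epsilon> > 0"
  \<comment> \<open>\<open>j\<close> copies multiply the excess by \<open>j\<close>; dividing by
    \<open>j + 1\<close> keeps the total below \<open>\<epsilon>\<close> and is safe for
    \<open>j = 0\<close>.\<close>
  then obtain n' a b R where B: "bubble n' a b R" "(LINT x|lborel. jac (n' x) (a x) (b x)) = of_int \<sigma> * (4 * pi)"
    "(LINT x|lborel. edens r (n' x) (a x) (b x)) \<le> e + \<epsilon> / (real j + 1)"
    using bub[of "\<epsilon> / (real j + 1)"] by auto
  obtain m u v S where m: "bubble m u v S"
    "(LINT x|lborel. edens r (m x) (u x) (v x)) = real j * (LINT x|lborel. edens r (n' x) (a x) (b x))"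
    "(LINT x|lborel. jac (m x) (u x) (v x)) = real j * (LINT x|lborel. jac (n' x) (a x) (b x))"
    using bubble_copies[OF B(1), of r j] by blast
  note M = bubble_Mspace[OF m(1) r(1)]
  have "4 * pi * degree m = 4 * pi * of_int k"
    unfolding M(2) m(3) B(2) k by simp
  then have "m \<in> Mdeg k" using M(1) by (simp add: Mdeg_def)
  then have "Energy r n \<le> Energy r m"
    using min by (simp add: is_minimizer_iff[OF r])
  also have "\<dots> = real j * (LINT x|lborel. edens r (n' x) (a x) (b x))"
    unfolding M(3) m(2) ..
  also have "\<dots> \<le> real j * (e + \<epsilon> / (real j + 1))" using B(3) by (intro mult_left_mono) auto
  also have "\<dots> = real j * e + \<epsilon> * (real j / (real j + 1))" by (simp add: algebra_simps)
  also have "\<dots> \<le> real j * e + \<epsilon> * 1" using \<epsilon> by (intro add_left_mono mult_left_mono) auto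
  finally show "Energy r n \<le> real j * e + \<epsilon>" by simp
qed

theorem theorem1p2:
  fixes r :: real
  assumes "0 < r" and "r < 1"
  shows "is_minimizer r 0 (\<lambda>_. e3)
       \<and> (\<forall>n. is_minimizer r 0 n \<longrightarrow> (AE x in lebesgue. n x = e3))
       \<and> (\<forall>x0. is_minimizer r (-1) (\<lambda>x. hsk_r r (x - x0)))
       \<and> (\<forall>n. is_minimizer r (-1) n \<longrightarrow> (\<exists>x0. AE x in lebesgue. n x = hsk_r r (x - x0)))
       \<and> (\<forall>k::int. k \<noteq> 0 \<and> k \<noteq> -1 \<longrightarrow> \<not> (\<exists>n. is_minimizer r k n))"
proof -
  note r = assms
  note triv = bubble_Mspace[OF bubble_trivial r(1)]
  have E0: "(\<lambda>_. e3) \<in> Mspace" "degree (\<lambda>_. e3) = 0" "Energy r (\<lambda>_. e3) = 0"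
    using triv by (simp_all add: dens_e3)
  have lower_pos: "4 * pi * of_int k \<le> Energy r m" if "m \<in> Mdeg k" for m k
    using energy_lower_bound[OF _ r power_one[of 2], of m] that by (auto simp: Mdeg_def)
  have lower_neg: "(2 * r\<^sup>2 - 1) * (4 * pi * of_int k) \<le> Energy r m" if "m \<in> Mdeg k" for m k
    using energy_lower_bound[OF _ r, of m "-1"] that by (auto simp: Mdeg_def algebra_simps)
  have min0: "is_minimizer r 0 (\<lambda>_. e3)"
    unfolding is_minimizer_iff[OF r] using E0 lower_pos[of _ 0] by (simp add: Mdeg_def)
  have uniq0: "AE x in lebesgue. n x = e3" if "is_minimizer r 0 n" for n
  proof (rule energy_equality_pos[OF _ r])
    have n: "n \<in> Mdeg 0" "Energy r n \<le> 0"
      using that E0 by (auto simp: is_minimizer_iff[OF r] Mdeg_def)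
    then show "n \<in> Mspace" "Energy r n \<le> 4 * pi * degree n" by (auto simp: Mdeg_def)
  qed
  have h: "(\<lambda>x. hsk_r r (x - x0)) \<in> Mdeg (-1)" for x0
    using hsk_r_Mspace[OF r(1)] by (simp add: Mdeg_def)
  have min1: "is_minimizer r (-1) (\<lambda>x. hsk_r r (x - x0))" for x0
    unfolding is_minimizer_iff[OF r]
  proof (intro conjI h ballI)
    fix m assume "m \<in> Mdeg (-1)"
    from lower_neg[OF this] show "Energy r (\<lambda>x. hsk_r r (x - x0)) \<le> Energy r m"
      unfolding hsk_r_Mspace(3)[OF r(1)] by (simp add: algebra_simps)
  qed
  \<comment> \<open>Excludes the trivial alternative of the equality case in every nonzero
    degree.\<close>
  have not_e3: "degree n = 0" if "n \<in> Mspace" "AE x in lebesgue. n x = e3" for n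
    using degree_cong_AE[OF that(1) E0(1) that(2)] E0(2) by simp
  have uniq1: "\<exists>x0. AE x in lebesgue. n x = hsk_r r (x - x0)" if "is_minimizer r (-1) n" for n
  proof -
    have n: "n \<in> Mspace" "degree n = -1" "Energy r n \<le> 4 * pi * (1 - 2 * r\<^sup>2)"
      using that h[of 0] hsk_r_Mspace(3)[OF r(1), of 0] by (auto simp: is_minimizer_iff[OF r] Mdeg_def)
    have "(AE x in lebesgue. n x = e3) \<or> (\<exists>x0. AE x in lebesgue. n x = hsk_r r (x - x0))"
      by (rule energy_equality_neg[OF n(1) r]) (use n(2,3) in \<open>simp add: algebra_simps\<close>)
    then show ?thesis using not_e3[OF n(1)] n(2) by auto
  qed
  have none: False if k: "k \<noteq> 0" "k \<noteq> -1" and min: "is_minimizer r k n" for k n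
  proof -
    have n: "n \<in> Mspace" "degree n = of_int k" using min by (auto simp: is_minimizer_def Mdeg_def)
    show False
    proof (cases "k > 0")
      case True
      have "Energy r n \<le> real (nat k) * (4 * pi)"
        by (rule minimizer_energy_le[OF r min, of 1]) (use True bubble_pos[OF r] in auto)
      then have "AE x in lebesgue. n x = e3"
        using True n(2) by (intro energy_equality_pos[OF n(1) r]) (simp add: mult.commute)
      then show False using not_e3[OF n(1)] n(2) k by simp
    next
      case False
      \<comment> \<open>The energy per copy is negative when \<open>r^2 > 1/2\<close>; the
        comparison is linear in it and does not depend on its sign.\<close>
      have "Energy r n \<le> real (nat (- k)) * (4 * pi * (1 - 2 * r\<^sup>2))"
        by (rule minimizer_energy_le[OF r min, of "-1"]) (use False bubble_neg[OF r] in auto)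
      also have "real (nat (- k)) = - of_int k" using False by simp
      finally have "(AE x in lebesgue. n x = e3) \<or> (\<exists>x0. AE x in lebesgue. n x = hsk_r r (x - x0))"
        using n(2) by (intro energy_equality_neg[OF n(1) r]) (simp add: algebra_simps)
      then show False
      proof
        assume "AE x in lebesgue. n x = e3"
        then show False using not_e3[OF n(1)] n(2) k by simp
      next
        assume "\<exists>x0. AE x in lebesgue. n x = hsk_r r (x - x0)"
        then obtain x0 where "AE x in lebesgue. n x = hsk_r r (x - x0)" by blast
        then have "degree n = -1"
          using degree_cong_AE[OF n(1) hsk_r_Mspace(1)[OF r(1)]] hsk_r_Mspace(2)[OF r(1)] by simp
        then show False using n(2) k by (metis of_int_eq_iff of_int_minus of_int_1)
      qed
    qed
  qed
  from min0 uniq0 min1 uniq1 none show ?thesis by blast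
qed

end
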